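(* Every generalized weakly-Weyl Finsler metric is a W-GDW-metric (weakly generalized Douglas-Weyl Finsler metric).
   Context: Let $M$ be an $n$-dimensional smooth manifold. A Finsler metric on $M$ is a non-negative function $F$ on $TM$ that is $C^\infty$ on $TM_0=TM\setminus\{0\}$, positively homogeneous of degree one in $y$, and such that $g_{ij}=\frac12\frac{\partial^2F^2}{\partial y^i\partial y^j}$ is positive definite at every $y\neq 0$. Its spray coefficients are $G^i(x,y)=\frac14 g^{il}\left\{\frac{\partial^2F^2}{\partial x^k\partial y^l}y^k-\frac{\partial F^2}{\partial x^l}\right\}$. Notation: "$._k$" denotes $\partial/\partial y^k$; "$|_m$" denotes the horizontal covariant derivative with respect to the Berwald connection of $F$, e.g. $T^i{}_{j|m}=\frac{\partial T^i{}_j}{\partial x^m}-G^r{}_{.m}T^i{}_{j.r}+T^r{}_jG^i{}_{.r.m}-T^i{}_rG^r{}_{.j.m}$, and similarly for other tensors on $TM_0$. A subscript $0$ denotes contraction with $y$: $T_{|0}=T_{|m}y^m$. The Douglas tensor is $D_j{}^i{}_{kl}=\frac{\partial^3}{\partial y^j\partial y^k\partial y^l}\left(G^i-\frac1{n+1}\frac{\partial G^m}{\partial y^m}y^i\right)$. Put $\tilde D_j{}^i{}_{kl}=D_j{}^i{}_{kl|0}$. $F$ is a W-GDW-metric if there are a scalar function $\lambda=\lambda(x,y)$ on $TM$ and coefficients $U_{jkl}$ of some tensor field such that $\tilde D_j{}^i{}_{kl|0}+\lambda F\tilde D_j{}^i{}_{kl}=U_{jkl}y^i$. The Riemann curvature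 is $R^i{}_k=2\frac{\partial G^i}{\partial x^k}-\frac{\partial^2G^i}{\partial x^m\partial y^k}y^m+2G^m\frac{\partial^2G^i}{\partial y^m\partial y^k}-\frac{\partial G^i}{\partial y^m}\frac{\partial G^m}{\partial y^k}$. The Weyl curvature is $W^i{}_k=A^i{}_k-\frac1{n+1}A^m{}_{k.m}y^i$, where $A^i{}_k=R^i{}_k-R\,\delta^i{}_k$ and $R=\frac1{n-1}R^m{}_m$. Put $W_j{}^i{}_{kl}=\frac13\left(W^i{}_{k.l}-W^i{}_{l.k}\right)_{.j}$ and $\tilde W_j{}^i{}_{kl}=W_j{}^i{}_{ml.k}y^m$ (that is, $y^m\,\partial W_j{}^i{}_{ml}/\partial y^k$). $F$ is a generalized weakly-Weyl Finsler metric if $\tilde W_j{}^i{}_{kl|0}+\lambda F\tilde W_j{}^i{}_{kl}=\mu_r\tilde W_j{}^r{}_{kl}y^i$ for some tensor $\mu_r$ and some smooth scalar function $\lambda$ on $TM$. *)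

theory Defs
  imports "HOL-Analysis.Analysis"
begin

section \<open>Smooth functions on open subsets of Euclidean spaces\<close>

primrec Ck_on :: "nat \<Rightarrow> 'a::euclidean_space set \<Rightarrow> ('a \<Rightarrow> 'b::real_normed_vector) \<Rightarrow> bool" where
  "Ck_on 0 S f \<longleftrightarrow> continuous_on S f"
| "Ck_on (Suc k) S f \<longleftrightarrow> (\<forall>x\<in>S. f differentiable (at x)) \<and>
     (\<forall>v. Ck_on k S (\<lambda>x. frechet_derivative f (at x) v))"

definition smooth_on :: "'a::euclidean_space set \<Rightarrow> ('a \<Rightarrow> 'b::real_normed_vector) \<Rightarrow> bool" where
  "smooth_on S f \<longleftrightarrow> open S \<and> (\<forall>k. Ck_on k S f)"

section \<open>Smooth manifolds and their tangent bundles\<close>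

text \<open>A chart is a pair of its domain and its coordinate map; the values of the coordinate map
  outside the domain are irrelevant.  The dimension of the manifold is \<open>CARD('n)\<close>.\<close>

type_synonym ('m, 'n) chart = "'m set \<times> ('m \<Rightarrow> real^'n)"

definition cimage :: "('m, 'n::finite) chart \<Rightarrow> (real^'n) set" where
  "cimage c = snd c ` fst c"

definition cinv :: "('m, 'n::finite) chart \<Rightarrow> real^'n \<Rightarrow> 'm" where
  "cinv c = inv_into (fst c) (snd c)"

definition overlap :: "('m, 'n::finite) chart \<Rightarrow> ('m, 'n) chart \<Rightarrow> (real^'n) set" where
  "overlap c c' = snd c ` (fst c \<inter> fst c')"

definition transition :: "('m, 'n::finite) chart \<Rightarrow> ('m, 'n) chart \<Rightarrow> real^'n \<Rightarrow> real^'n" where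
  "transition c c' = snd c' \<circ> cinv c"

definition dtransition :: "('m, 'n::finite) chart \<Rightarrow> ('m, 'n) chart \<Rightarrow> real^'n \<Rightarrow> real^'n \<Rightarrow> real^'n" where
  "dtransition c c' x = frechet_derivative (transition c c') (at x)"

text \<open>The atlas is not required to be maximal.\<close>

definition smooth_manifold :: "'m topology \<Rightarrow> ('m, 'n::finite) chart set \<Rightarrow> bool" where
  "smooth_manifold X A \<longleftrightarrow>
     Hausdorff_space X \<and> second_countable X \<and> \<Union>(fst ` A) = topspace X \<and>
     (\<forall>c\<in>A. openin X (fst c) \<and> open (cimage c) \<and>
        homeomorphic_map (subtopology X (fst c)) (top_of_set (cimage c)) (snd c)) \<and>
     (\<forall>c\<in>A. \<forall>c'\<in>A. smooth_on (overlap c c') (transition c c'))"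

text \<open>A tangent vector at \<open>p\<close> is the family of its components in all charts around \<open>p\<close>, related by
  the Jacobians of the transition maps (and set to \<open>0\<close> at the charts not around \<open>p\<close>).\<close>

type_synonym ('m, 'n) tvec = "'m \<times> (('m, 'n) chart \<Rightarrow> real^'n)"

definition tangent_bundle :: "('m, 'n::finite) chart set \<Rightarrow> ('m, 'n) tvec set" where
  "tangent_bundle A = {(p, v).
     p \<in> \<Union>(fst ` A) \<and>
     (\<forall>c. c \<notin> A \<or> p \<notin> fst c \<longrightarrow> v c = 0) \<and>
     (\<forall>c\<in>A. \<forall>c'\<in>A. p \<in> fst c \<inter> fst c' \<longrightarrow> v c' = dtransition c c' (snd c p) (v c))}"

definition tscale :: "real \<Rightarrow> ('m, 'n::finite) tvec \<Rightarrow> ('m, 'n) tvec" where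
  "tscale t w = (fst w, \<lambda>c. t *\<^sub>R snd w c)"

text \<open>\<open>tpoint A c x y\<close> is the tangent vector with standard coordinates \<open>(x, y)\<close> in the chart \<open>c\<close>,
  and \<open>local_rep A f c\<close> is the expression of a function \<open>f\<close> on the tangent bundle in these
  coordinates.\<close>

definition tpoint :: "('m, 'n::finite) chart set \<Rightarrow> ('m, 'n) chart \<Rightarrow> real^'n \<Rightarrow> real^'n \<Rightarrow> ('m, 'n) tvec" where
  "tpoint A c x y = (cinv c x,
     \<lambda>c'. if c' \<in> A \<and> cinv c x \<in> fst c' then dtransition c c' x y else 0)"

definition local_rep :: "('m, 'n::finite) chart set \<Rightarrow> (('m, 'n) tvec \<Rightarrow> real) \<Rightarrow> ('m, 'n) chart \<Rightarrow>
    real^'n \<Rightarrow> real^'n \<Rightarrow> real" where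
  "local_rep A f c x y = f (tpoint A c x y)"

text \<open>The tangent bundle consists precisely of the vectors \<open>tpoint A c x y\<close>.\<close>

lemma tangent_bundle_eq_tpoint:
  fixes A :: "('m, 'n::finite) chart set"
  assumes M: "smooth_manifold X A"
  shows "tangent_bundle A = {tpoint A c x y |c x y. c \<in> A \<and> x \<in> cimage c}"
proof (intro equalityI subsetI)
  fix w assume w: "w \<in> tangent_bundle A"
  obtain p v where wpv [simp]: "w = (p, v)" by (cases w)
  have "p \<in> \<Union>(fst ` A)"
    using w unfolding wpv tangent_bundle_def mem_Collect_eq prod.case by (elim conjE)
  then obtain c where c: "c \<in> A" "p \<in> fst c" by blast
  have "inj_on (snd c) (fst c)"
  proof -
    have "openin X (fst c)" "homeomorphic_map (subtopology X (fst c)) (top_of_set (cimage c)) (snd c)"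
      using M c by (auto simp: smooth_manifold_def)
    then show ?thesis
      by (metis homeomorphic_map_def openin_subset topspace_subtopology_subset)
  qed
  then have p: "cinv c (snd c p) = p"
    using c by (simp add: cinv_def)
  have "tpoint A c (snd c p) (v c) = w"
  proof -
    have z: "v d = 0" if "\<not> (d \<in> A \<and> p \<in> fst d)" for d
    proof -
      have "\<forall>d. d \<notin> A \<or> p \<notin> fst d \<longrightarrow> v d = 0"
        using w unfolding wpv tangent_bundle_def mem_Collect_eq prod.case by (elim conjE)
      then show ?thesis using that by blast
    qed
    have nz: "v d = dtransition c d (snd c p) (v c)" if "d \<in> A \<and> p \<in> fst d" for d
    proof -
      have "\<forall>c\<in>A. \<forall>c'\<in>A. p \<in> fst c \<inter> fst c' \<longrightarrow> v c' = dtransition c c' (snd c p) (v c)"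
        using w unfolding wpv tangent_bundle_def mem_Collect_eq prod.case by (elim conjE)
      then show ?thesis using c that by blast
    qed
    then have "(if d \<in> A \<and> p \<in> fst d then dtransition c d (snd c p) (v c) else 0) = v d" for d
    proof (cases "d \<in> A \<and> p \<in> fst d")
      case True
      show ?thesis unfolding if_P[OF True] using nz[OF True] by (rule sym)
    next
      case False
      show ?thesis unfolding if_not_P[OF False] using z[OF False] by (rule sym)
    qed
    then have "(\<lambda>d. if d \<in> A \<and> p \<in> fst d then dtransition c d (snd c p) (v c) else 0) = v"
      by (rule ext)
    then show ?thesis unfolding tpoint_def p wpv by (rule arg_cong[of _ _ "Pair p"])
  qed
  moreover have "snd c p \<in> cimage c" using c by (simp add: cimage_def)
  ultimately show "w \<in> {tpoint A c x y |c x y. c \<in> A \<and> x \<in> cimage c}" using c by blast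
next
  fix w assume "w \<in> {tpoint A c x y |c x y. c \<in> A \<and> x \<in> cimage c}"
  then obtain c x y where w: "w = tpoint A c x y" and c: "c \<in> A" and x: "x \<in> cimage c" by blast
  define p where "p = cinv c x"
  have p: "p \<in> fst c" "snd c p = x"
    using x by (auto simp: p_def cinv_def cimage_def inv_into_into f_inv_into_f)
  have inj: "inj_on (snd d) (fst d)" if "d \<in> A" for d
  proof -
    have "openin X (fst d)" "homeomorphic_map (subtopology X (fst d)) (top_of_set (cimage d)) (snd d)"
      using M that by (auto simp: smooth_manifold_def)
    then show ?thesis
      by (metis homeomorphic_map_def openin_subset topspace_subtopology_subset)
  qed
  have cinv: "cinv d (snd d q) = q" if "d \<in> A" "q \<in> fst d" for d q
    using inj[OF that(1)] that by (simp add: cinv_def)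
  have op: "open (overlap d d')" if "d \<in> A" "d' \<in> A" for d d'
    using M that by (auto simp: smooth_manifold_def smooth_on_def)
  have diff: "(transition d d' has_derivative dtransition d d' z) (at z)"
    if "d \<in> A" "d' \<in> A" "z \<in> overlap d d'" for d d' z
  proof -
    have "Ck_on (Suc 0) (overlap d d') (transition d d')"
      using M that by (auto simp: smooth_manifold_def smooth_on_def simp del: Ck_on.simps)
    then have "transition d d' differentiable (at z)" using that by simp
    then show ?thesis unfolding dtransition_def by (simp add: frechet_derivative_works)
  qed
  have chain: "dtransition c c2 x y = dtransition c1 c2 (snd c1 p) (dtransition c c1 x y)"
    if A: "c1 \<in> A" "c2 \<in> A" and q: "p \<in> fst c1" "p \<in> fst c2" for c1 c2
  proof -
    let ?W = "overlap c c1 \<inter> overlap c c2"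
    have xW: "x \<in> ?W" using p q by (auto simp: overlap_def)
    have tx: "transition c c1 x = snd c1 p" by (simp add: transition_def p_def)
    have "snd c1 p \<in> overlap c1 c2" using q by (auto simp: overlap_def)
    then have "((transition c1 c2 \<circ> transition c c1) has_derivative
        (dtransition c1 c2 (snd c1 p) \<circ> dtransition c c1 x)) (at x)"
      using diff[OF c A(1), of x] diff[OF A, of "snd c1 p"] xW tx by (auto intro: diff_chain_at)
    moreover have "transition c c2 z = (transition c1 c2 \<circ> transition c c1) z" if "z \<in> ?W" for z
    proof -
      obtain a where a: "z = snd c a" "a \<in> fst c" "a \<in> fst c1"
        using \<open>z \<in> ?W\<close> by (auto simp: overlap_def)
      then show ?thesis using cinv c A by (simp add: transition_def)
    qed
    ultimately have "(transition c c2 has_derivative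
        (dtransition c1 c2 (snd c1 p) \<circ> dtransition c c1 x)) (at x)"
      using has_derivative_transform_within_open[of _ _ x UNIV ?W "transition c c2"]
        op[OF c A(1)] op[OF c A(2)] xW by (simp add: open_Int)
    then show ?thesis
      using diff[OF c A(2), of x] xW has_derivative_unique by (metis IntD2 comp_apply)
  qed
  show "w \<in> tangent_bundle A"
    unfolding w tpoint_def tangent_bundle_def p_def[symmetric] mem_Collect_eq prod.case
  proof (intro conjI allI ballI impI)
    show "p \<in> \<Union> (fst ` A)" using c p by blast
  next
    fix d assume "d \<notin> A \<or> p \<notin> fst d"
    then show "(if d \<in> A \<and> p \<in> fst d then dtransition c d x y else 0) = 0" by auto
  next
    fix d d' assume "d \<in> A" "d' \<in> A" "p \<in> fst d \<inter> fst d'"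
    then show "(if d' \<in> A \<and> p \<in> fst d' then dtransition c d' x y else 0) =
        dtransition d d' (snd d p) (if d \<in> A \<and> p \<in> fst d then dtransition c d x y else 0)"
      using chain[of d d'] by simp
  qed
qed

text \<open>As usual in Finsler geometry (and as for the metric itself), smoothness of scalar functions
  and tensors means smoothness on the slit tangent bundle (\<open>y \<noteq> 0\<close>), where all the equations
  below live.\<close>

abbreviation slit :: "('m, 'n::finite) chart \<Rightarrow> ((real^'n) \<times> (real^'n)) set" where
  "slit c \<equiv> cimage c \<times> (- {0})"

definition smooth_scalar :: "('m, 'n::finite) chart set \<Rightarrow> (('m, 'n) tvec \<Rightarrow> real) \<Rightarrow> bool" where
  "smooth_scalar A f \<longleftrightarrow> (\<forall>c\<in>A. smooth_on (slit c) (\<lambda>(x, y). local_rep A f c x y))"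

definition jacobian :: "('m, 'n::finite) chart \<Rightarrow> ('m, 'n) chart \<Rightarrow> real^'n \<Rightarrow> 'n \<Rightarrow> 'n \<Rightarrow> real" where
  "jacobian c c' x a j = dtransition c c' x (axis j 1) $ a"

text \<open>Smooth covariant tensor fields of rank one and three on the slit tangent bundle, given by
  their components in all charts of the atlas.\<close>

definition tensor_field1 :: "('m, 'n::finite) chart set \<Rightarrow>
    (('m, 'n) chart \<Rightarrow> 'n \<Rightarrow> real^'n \<Rightarrow> real^'n \<Rightarrow> real) \<Rightarrow> bool" where
  "tensor_field1 A T \<longleftrightarrow>
     (\<forall>c\<in>A. \<forall>j. smooth_on (slit c) (\<lambda>(x, y). T c j x y)) \<and>
     (\<forall>c\<in>A. \<forall>c'\<in>A. \<forall>x\<in>overlap c c'. \<forall>y. y \<noteq> 0 \<longrightarrow> (\<forall>j.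
        T c j x y =
          (\<Sum>a\<in>UNIV. jacobian c c' x a j * T c' a (transition c c' x) (dtransition c c' x y))))"

definition tensor_field3 :: "('m, 'n::finite) chart set \<Rightarrow>
    (('m, 'n) chart \<Rightarrow> 'n \<Rightarrow> 'n \<Rightarrow> 'n \<Rightarrow> real^'n \<Rightarrow> real^'n \<Rightarrow> real) \<Rightarrow> bool" where
  "tensor_field3 A T \<longleftrightarrow>
     (\<forall>c\<in>A. \<forall>j k l. smooth_on (slit c) (\<lambda>(x, y). T c j k l x y)) \<and>
     (\<forall>c\<in>A. \<forall>c'\<in>A. \<forall>x\<in>overlap c c'. \<forall>y. y \<noteq> 0 \<longrightarrow> (\<forall>j k l.
        T c j k l x y =
          (\<Sum>a\<in>UNIV. \<Sum>b\<in>UNIV. \<Sum>d\<in>UNIV.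
             jacobian c c' x a j * jacobian c c' x b k * jacobian c c' x d l *
             T c' a b d (transition c c' x) (dtransition c c' x y))))"

section \<open>Local expressions in standard coordinates \<open>(x, y)\<close>\<close>

type_synonym 'n coord_fun = "real^'n \<Rightarrow> real^'n \<Rightarrow> real"

definition dx :: "'n::finite \<Rightarrow> 'n coord_fun \<Rightarrow> 'n coord_fun" where
  "dx k f x y = frechet_derivative (\<lambda>x'. f x' y) (at x) (axis k 1)"

definition dy :: "'n::finite \<Rightarrow> 'n coord_fun \<Rightarrow> 'n coord_fun" where
  "dy k f x y = frechet_derivative (\<lambda>y'. f x y') (at y) (axis k 1)"

definition sq :: "'n coord_fun \<Rightarrow> 'n coord_fun" where
  "sq F x y = (F x y)\<^sup>2"

definition fund_tensor :: "'n::finite coord_fun \<Rightarrow> real^'n \<Rightarrow> real^'n \<Rightarrow> real^'n^'n" where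
  "fund_tensor F x y = (\<chi> i j. 1/2 * dy i (dy j (sq F)) x y)"

definition spray :: "'n::finite coord_fun \<Rightarrow> 'n \<Rightarrow> 'n coord_fun" where
  "spray F i x y = 1/4 * (\<Sum>l\<in>UNIV. matrix_inv (fund_tensor F x y) $ i $ l *
     ((\<Sum>k\<in>UNIV. dx k (dy l (sq F)) x y * y $ k) - dx l (sq F) x y))"

text \<open>Components of tensors with one upper and three lower indices: \<open>T j i k l\<close> stands for
  $T_j{}^i{}_{kl}$.  In the next two definitions \<open>G i\<close> are the spray coefficients;
  \<open>hcov3 G T m\<close> is $T_j{}^i{}_{kl|m}$ and \<open>hcov3_0 G T\<close> is $T_j{}^i{}_{kl|0}$.\<close>

definition hcov3 :: "('n::finite \<Rightarrow> 'n coord_fun) \<Rightarrow> ('n \<Rightarrow> 'n \<Rightarrow> 'n \<Rightarrow> 'n \<Rightarrow> 'n coord_fun) \<Rightarrow>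
    'n \<Rightarrow> 'n \<Rightarrow> 'n \<Rightarrow> 'n \<Rightarrow> 'n \<Rightarrow> 'n coord_fun" where
  "hcov3 G T m j i k l x y =
     dx m (T j i k l) x y
     - (\<Sum>r\<in>UNIV. dy m (G r) x y * dy r (T j i k l) x y)
     + (\<Sum>r\<in>UNIV. T j r k l x y * dy m (dy r (G i)) x y)
     - (\<Sum>r\<in>UNIV. T r i k l x y * dy m (dy j (G r)) x y)
     - (\<Sum>r\<in>UNIV. T j i r l x y * dy m (dy k (G r)) x y)
     - (\<Sum>r\<in>UNIV. T j i k r x y * dy m (dy l (G r)) x y)"

definition hcov3_0 :: "('n::finite \<Rightarrow> 'n coord_fun) \<Rightarrow> ('n \<Rightarrow> 'n \<Rightarrow> 'n \<Rightarrow> 'n \<Rightarrow> 'n coord_fun) \<Rightarrow>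
    'n \<Rightarrow> 'n \<Rightarrow> 'n \<Rightarrow> 'n \<Rightarrow> 'n coord_fun" where
  "hcov3_0 G T j i k l x y = (\<Sum>m\<in>UNIV. hcov3 G T m j i k l x y * y $ m)"

definition douglas :: "('n::finite \<Rightarrow> 'n coord_fun) \<Rightarrow> 'n \<Rightarrow> 'n \<Rightarrow> 'n \<Rightarrow> 'n \<Rightarrow> 'n coord_fun" where
  "douglas G j i k l =
     dy j (dy k (dy l (\<lambda>x y.
       G i x y - 1 / (real CARD('n) + 1) * (\<Sum>m\<in>UNIV. dy m (G m) x y) * y $ i)))"

definition douglas_tilde :: "('n::finite \<Rightarrow> 'n coord_fun) \<Rightarrow> 'n \<Rightarrow> 'n \<Rightarrow> 'n \<Rightarrow> 'n \<Rightarrow> 'n coord_fun" where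
  "douglas_tilde G = hcov3_0 G (douglas G)"

definition riemann :: "('n::finite \<Rightarrow> 'n coord_fun) \<Rightarrow> 'n \<Rightarrow> 'n \<Rightarrow> 'n coord_fun" where
  "riemann G i k x y =
     2 * dx k (G i) x y
     - (\<Sum>m\<in>UNIV. dx m (dy k (G i)) x y * y $ m)
     + 2 * (\<Sum>m\<in>UNIV. G m x y * dy m (dy k (G i)) x y)
     - (\<Sum>m\<in>UNIV. dy m (G i) x y * dy k (G m) x y)"

definition ricci_scalar :: "('n::finite \<Rightarrow> 'n coord_fun) \<Rightarrow> 'n coord_fun" where
  "ricci_scalar G x y = 1 / (real CARD('n) - 1) * (\<Sum>m\<in>UNIV. riemann G m m x y)"

definition weyl_A :: "('n::finite \<Rightarrow> 'n coord_fun) \<Rightarrow> 'n \<Rightarrow> 'n \<Rightarrow> 'n coord_fun" where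
  "weyl_A G i k x y = riemann G i k x y - ricci_scalar G x y * (if i = k then 1 else 0)"

definition weyl :: "('n::finite \<Rightarrow> 'n coord_fun) \<Rightarrow> 'n \<Rightarrow> 'n \<Rightarrow> 'n coord_fun" where
  "weyl G i k x y =
     weyl_A G i k x y - 1 / (real CARD('n) + 1) * (\<Sum>m\<in>UNIV. dy m (weyl_A G m k) x y) * y $ i"

definition weyl4 :: "('n::finite \<Rightarrow> 'n coord_fun) \<Rightarrow> 'n \<Rightarrow> 'n \<Rightarrow> 'n \<Rightarrow> 'n \<Rightarrow> 'n coord_fun" where
  "weyl4 G j i k l =
     dy j (\<lambda>x y. 1/3 * (dy l (weyl G i k) x y - dy k (weyl G i l) x y))"

definition weyl_tilde :: "('n::finite \<Rightarrow> 'n coord_fun) \<Rightarrow> 'n \<Rightarrow> 'n \<Rightarrow> 'n \<Rightarrow> 'n \<Rightarrow> 'n coord_fun" where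
  "weyl_tilde G j i k l x y = (\<Sum>m\<in>UNIV. y $ m * dy k (weyl4 G j i m l) x y)"

section \<open>Finsler metrics\<close>

definition finsler_metric :: "('m, 'n::finite) chart set \<Rightarrow> (('m, 'n) tvec \<Rightarrow> real) \<Rightarrow> bool" where
  "finsler_metric A F \<longleftrightarrow>
     (\<forall>w\<in>tangent_bundle A. 0 \<le> F w) \<and>
     smooth_scalar A F \<and>
     (\<forall>w\<in>tangent_bundle A. \<forall>t>0. F (tscale t w) = t * F w) \<and>
     (\<forall>c\<in>A. \<forall>x\<in>cimage c. \<forall>y. y \<noteq> 0 \<longrightarrow>
        (\<forall>v. v \<noteq> 0 \<longrightarrow> 0 < v \<bullet> (fund_tensor (local_rep A F c) x y *v v)))"

definition W_GDW :: "('m, 'n::finite) chart set \<Rightarrow> (('m, 'n) tvec \<Rightarrow> real) \<Rightarrow> bool" where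
  "W_GDW A F \<longleftrightarrow> (\<exists>lam U. smooth_scalar A lam \<and> tensor_field3 A U \<and>
     (\<forall>c\<in>A. \<forall>x\<in>cimage c. \<forall>y. y \<noteq> 0 \<longrightarrow>
        (let Fc = local_rep A F c; G = spray Fc; Dt = douglas_tilde G in
          \<forall>j i k l. hcov3_0 G Dt j i k l x y + local_rep A lam c x y * Fc x y * Dt j i k l x y
            = U c j k l x y * y $ i)))"

definition generalized_weakly_Weyl :: "('m, 'n::finite) chart set \<Rightarrow> (('m, 'n) tvec \<Rightarrow> real) \<Rightarrow> bool" where
  "generalized_weakly_Weyl A F \<longleftrightarrow> (\<exists>lam \<mu>. smooth_scalar A lam \<and> tensor_field1 A \<mu> \<and>
     (\<forall>c\<in>A. \<forall>x\<in>cimage c. \<forall>y. y \<noteq> 0 \<longrightarrow>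
        (let Fc = local_rep A F c; G = spray Fc; Wt = weyl_tilde G in
          \<forall>j i k l. hcov3_0 G Wt j i k l x y + local_rep A lam c x y * Fc x y * Wt j i k l x y
            = (\<Sum>r\<in>UNIV. \<mu> c r x y * Wt j r k l x y) * y $ i)))"

end

theory Submission
  imports Defs
begin

text \<open>Put \<open>B\<close> for the third \<open>y\<close>-derivatives of the spray coefficients.  Differentiating the formula
  for the Riemann curvature twice and summing cyclically gives
  $R^i{}_{l.jk} + R^i{}_{j.kl} + R^i{}_{k.lj} = -3 B_j{}^i{}_{kl|0}$, for every spray.  Since
  $W^i{}_k y^k = 0$ and $W$ is homogeneous of degree two,
  $\tilde W_j{}^i{}_{kl} = -\frac13 (W^i{}_{l.jk} + W^i{}_{j.kl} + W^i{}_{k.lj})$.  Writing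
  $W^i{}_k = R^i{}_k - R \delta^i{}_k + \tau_k y^i$ and eliminating the terms with $\delta$ by the trace
  of the cyclic identity yields $\tilde W_j{}^i{}_{kl} = \tilde D_j{}^i{}_{kl} + Q_{jkl} y^i$.  As
  $y^i{}_{|0} = 0$, the two defining equations then differ by a multiple of $y^i$.  The resulting
  coefficients $U_{jkl}$ form a tensor because $\tilde D_{|0} + \lambda F \tilde D$ does and
  $y \neq 0$.\<close>

section \<open>Calculus of smooth functions\<close>

text \<open>The curvature identity is local, whereas the conclusion asks for one tensor field
  \<open>U\<close> on the slit tangent bundle. The correction Q and the Weyl curvature would each
  call for a transformation law of their own; instead such a law is established only for the spray,
  the Douglas tensor and the operator \<open>|_0\<close>, and \<open>U\<close> inherits it by
  cancelling a nonzero component of \<open>y\<close>. The constant -3 is the result of a count: in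
  the second derivatives of the curvature the terms with position derivatives carry the coefficients
  2, -1, -1 and cancel cyclically, as do the products of second derivatives of \<open>G\<close>,
  while each of the three summands contributes -1 times the derivative of B along the spray. The
  trace eliminates the \<delta> terms because both sides acquire the same factor n + 1; for the
  scalar R it is (n - 1) + 1 + 1. All identities are asserted only where \<open>y\<close> is
  nonzero, so every differentiation is applied to an equation valid on an open set, and the
  homogeneity of \<open>F\<close> enters in the form of Euler's relation.\<close>

lemma Ck_on_cong:
  assumes "open S" "\<And>x. x \<in> S \<Longrightarrow> f x = g x"
  shows "Ck_on k S f \<longleftrightarrow> Ck_on k S g"
  using assms(2)
proof (induction k arbitrary: f g)
  case 0
  then show ?case by (auto intro: continuous_on_eq)
next
  case (Suc k)
  have hd: "(f has_derivative d) (at x) \<longleftrightarrow> (g has_derivative d) (at x)" if "x \<in> S" for x d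
    using has_derivative_transform_within_open[OF _ assms(1) that, of f d UNIV g]
      has_derivative_transform_within_open[OF _ assms(1) that, of g d UNIV f] Suc.prems by auto
  then have "f differentiable (at x) \<longleftrightarrow> g differentiable (at x)" if "x \<in> S" for x
    using that by (simp add: differentiable_def)
  moreover have "frechet_derivative f (at x) = frechet_derivative g (at x)" if "x \<in> S" for x
    using that hd by (simp add: frechet_derivative_def)
  then have "Ck_on k S (\<lambda>x. frechet_derivative f (at x) v) \<longleftrightarrow>
      Ck_on k S (\<lambda>x. frechet_derivative g (at x) v)" for v
    by (intro Suc.IH) simp
  ultimately show ?case by simp
qed

text \<open>\<open>Ck_on\<close> speaks of \<open>frechet_derivative\<close>, a choice term;
  uniqueness of the derivative allows any explicit family \<open>f'\<close> in its place. Most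
  closure rules below are inductions on \<open>k\<close> through this rule.\<close>

lemma Ck_on_SucI:
  assumes "open S" "\<And>x. x \<in> S \<Longrightarrow> (f has_derivative f' x) (at x)"
    and "\<And>v. Ck_on k S (\<lambda>x. f' x v)"
  shows "Ck_on (Suc k) S f"
proof -
  have "frechet_derivative f (at x) = f' x" if "x \<in> S" for x
    using frechet_derivative_at[OF assms(2)[OF that]] by simp
  then have "Ck_on k S (\<lambda>x. frechet_derivative f (at x) v) \<longleftrightarrow> Ck_on k S (\<lambda>x. f' x v)" for v
    by (intro Ck_on_cong assms(1)) simp
  then show ?thesis using assms by (auto simp: differentiable_def)
qed

lemma Ck_on_Suc_has_derivative:
  assumes "Ck_on (Suc k) S f" "x \<in> S"
  shows "(f has_derivative frechet_derivative f (at x)) (at x)"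
  using assms by (simp add: frechet_derivative_works[symmetric])

lemma Ck_on_Suc_frechet_derivative:
  "Ck_on (Suc k) S f \<Longrightarrow> Ck_on k S (\<lambda>x. frechet_derivative f (at x) v)"
  by simp

text \<open>The recursion descends to the fact that differentiability implies continuity. The rules
  for products and inverses rely on it, since their derivatives still contain undifferentiated
  factors.\<close>

lemma Ck_on_SucD:
  "Ck_on (Suc k) S f \<Longrightarrow> Ck_on k S f"
proof (induction k arbitrary: f)
  case 0
  then show ?case
    by (auto intro!: continuous_at_imp_continuous_on differentiable_imp_continuous_within)
next
  case (Suc k)
  then show ?case by (metis Ck_on.simps(2))
qed

lemma Ck_on_subset: "Ck_on k S f \<Longrightarrow> T \<subseteq> S \<Longrightarrow> Ck_on k T f"
  by (induction k arbitrary: f) (auto intro: continuous_on_subset)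

lemma Ck_on_const: "open S \<Longrightarrow> Ck_on k S (\<lambda>x. c)"
proof (induction k arbitrary: c)
  case (Suc k)
  show ?case by (rule Ck_on_SucI[OF \<open>open S\<close> has_derivative_const]) (use Suc in simp)
qed auto

lemma Ck_on_linear:
  assumes "open S" "bounded_linear h"
  shows "Ck_on k S h"
proof (cases k)
  case 0
  then show ?thesis using assms by (simp add: linear_continuous_on)
next
  case (Suc m)
  show ?thesis unfolding Suc
    by (rule Ck_on_SucI[OF assms(1) bounded_linear_imp_has_derivative[OF assms(2)]])
      (rule Ck_on_const[OF assms(1)])
qed

lemma Ck_on_linear_compose:
  assumes "open S" "bounded_linear h" "Ck_on k S f"
  shows "Ck_on k S (\<lambda>x. h (f x))"
  using assms(3)
proof (induction k arbitrary: f)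
  case 0
  then show ?case using assms by (simp add: bounded_linear.continuous_on)
next
  case (Suc k)
  show ?case
    by (rule Ck_on_SucI[OF assms(1)
          bounded_linear.has_derivative[OF assms(2) Ck_on_Suc_has_derivative[OF Suc.prems]]])
      (use Suc in auto)
qed

lemma Ck_on_add:
  assumes "open S" "Ck_on k S f" "Ck_on k S g"
  shows "Ck_on k S (\<lambda>x. f x + g x)"
  using assms(2,3)
proof (induction k arbitrary: f g)
  case 0
  then show ?case by (simp add: continuous_on_add)
next
  case (Suc k)
  show ?case
    by (rule Ck_on_SucI[OF assms(1) has_derivative_add[OF Ck_on_Suc_has_derivative[OF Suc.prems(1)]
          Ck_on_Suc_has_derivative[OF Suc.prems(2)]]]) (use Suc in auto)
qed

lemma Ck_on_mult:
  fixes f g :: "'a::euclidean_space \<Rightarrow> real"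
  assumes "open S" "Ck_on k S f" "Ck_on k S g"
  shows "Ck_on k S (\<lambda>x. f x * g x)"
  using assms(2,3)
proof (induction k arbitrary: f g)
  case 0
  then show ?case by (simp add: continuous_on_mult)
next
  case (Suc k)
  have "Ck_on k S f" "Ck_on k S g" using Suc.prems Ck_on_SucD by auto
  then show ?case using Suc
    by (intro Ck_on_SucI[OF assms(1) has_derivative_mult[OF Ck_on_Suc_has_derivative[OF Suc.prems(1)]
          Ck_on_Suc_has_derivative[OF Suc.prems(2)]]] Ck_on_add assms(1)) auto
qed

text \<open>The derivative of 1/f is made of f' and of 1/f itself, so \<open>f\<close> stays fixed
  in the induction and the hypothesis supplies the factors \<open>inverse (f x)\<close>.\<close>

lemma Ck_on_inverse:
  fixes f :: "'a::euclidean_space \<Rightarrow> real"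
  assumes "open S" "Ck_on k S f" "\<And>x. x \<in> S \<Longrightarrow> f x \<noteq> 0"
  shows "Ck_on k S (\<lambda>x. inverse (f x))"
  using assms(2)
proof (induction k)
  case 0
  then show ?case using assms(3) by (simp add: continuous_on_inverse)
next
  case (Suc k)
  have i: "Ck_on k S (\<lambda>x. inverse (f x))" using Suc Ck_on_SucD by auto
  have "Ck_on k S (\<lambda>x. (-1) * (inverse (f x) * frechet_derivative f (at x) v * inverse (f x)))" for v
    using Suc.prems by (intro Ck_on_mult assms(1) i Ck_on_const) auto
  then show ?case
    by (intro Ck_on_SucI[OF assms(1) Deriv.has_derivative_inverse[OF assms(3)
      Ck_on_Suc_has_derivative[OF Suc.prems]]]) auto
qed

lemma Ck_on_sum:
  assumes "open S" "finite I" "\<And>i. i \<in> I \<Longrightarrow> Ck_on k S (f i)"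
  shows "Ck_on k S (\<lambda>x. \<Sum>i\<in>I. f i x)"
  using assms(2,3)
  by (induction I rule: finite_induct) (auto intro!: Ck_on_const Ck_on_add assms(1) simp del: Ck_on.simps)

text \<open>The chain rule is expanded in \<open>Basis\<close> so that the derivative is a finite
  sum of products of real functions, the shape to which \<open>Ck_on_sum\<close> and
  \<open>Ck_on_mult\<close> apply.\<close>

lemma has_derivative_compose_Basis:
  fixes f :: "'b::euclidean_space \<Rightarrow> real" and g :: "'a::euclidean_space \<Rightarrow> 'b"
  assumes f: "f differentiable (at (g x))"
    and g: "\<And>b. b \<in> Basis \<Longrightarrow> (\<lambda>x. g x \<bullet> b) differentiable (at x)"
  shows "((\<lambda>x. f (g x)) has_derivative (\<lambda>v. \<Sum>b\<in>Basis.
      frechet_derivative (\<lambda>x. g x \<bullet> b) (at x) v * frechet_derivative f (at (g x)) b)) (at x)"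
proof -
  have "g differentiable (at x)"
    using g by (subst differentiable_componentwise_within) auto
  then have gd: "(g has_derivative (frechet_derivative g (at x))) (at x)"
    using frechet_derivative_works by blast
  have fd: "(f has_derivative frechet_derivative f (at (g x))) (at (g x))"
    using f frechet_derivative_works by blast
  have comp: "frechet_derivative g (at x) v \<bullet> b = frechet_derivative (\<lambda>x. g x \<bullet> b) (at x) v" for v b
    using frechet_derivative_at[OF has_derivative_inner_left[OF gd, of b]] by (rule fun_cong)
  interpret linear "frechet_derivative f (at (g x))"
    using has_derivative_linear[OF fd] .
  have "((\<lambda>x. f (g x)) has_derivative
      (\<lambda>v. frechet_derivative f (at (g x)) (frechet_derivative g (at x) v))) (at x)"
    using has_derivative_compose[OF gd fd] .
  moreover have "frechet_derivative f (at (g x)) (frechet_derivative g (at x) v) =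
     (\<Sum>b\<in>Basis. frechet_derivative (\<lambda>x. g x \<bullet> b) (at x) v * frechet_derivative f (at (g x)) b)" for v
  proof -
    have "frechet_derivative f (at (g x)) (frechet_derivative g (at x) v) =
      frechet_derivative f (at (g x)) (\<Sum>b\<in>Basis. (frechet_derivative g (at x) v \<bullet> b) *\<^sub>R b)"
      by (simp add: euclidean_representation)
    then show ?thesis by (simp add: sum scale comp)
  qed
  ultimately show ?thesis by simp
qed

text \<open>The outer function varies in the induction, since its hypothesis is needed for the
  partial derivatives of \<open>f\<close> composed with the same \<open>g\<close>.\<close>

lemma Ck_on_compose:
  fixes f :: "'b::euclidean_space \<Rightarrow> real" and g :: "'a::euclidean_space \<Rightarrow> 'b"
  assumes "open S" "Ck_on k T f" "\<And>b. b \<in> Basis \<Longrightarrow> Ck_on k S (\<lambda>x. g x \<bullet> b)"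
    and g: "g ` S \<subseteq> T"
  shows "Ck_on k S (\<lambda>x. f (g x))"
  using assms(2,3)
proof (induction k arbitrary: f)
  case 0
  then have "continuous_on S g"
    by (subst continuous_on_componentwise) auto
  moreover have "continuous_on T f" using 0 by simp
  ultimately show ?case using continuous_on_compose2[OF _ _ g] by simp
next
  case (Suc k)
  have der: "((\<lambda>x. f (g x)) has_derivative (\<lambda>v. \<Sum>b\<in>Basis.
      frechet_derivative (\<lambda>x. g x \<bullet> b) (at x) v * frechet_derivative f (at (g x)) b)) (at x)"
    if "x \<in> S" for x
  proof (rule has_derivative_compose_Basis)
    show "f differentiable (at (g x))" using Suc.prems(1) g that by auto
    show "(\<lambda>x. g x \<bullet> b) differentiable (at x)" if "b \<in> Basis" for b
      using Suc.prems(2)[OF that] \<open>x \<in> S\<close> by simp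
  qed
  have lower: "Ck_on k S (\<lambda>x. g x \<bullet> b)" if "b \<in> Basis" for b
    using Suc.prems(2)[OF that] by (rule Ck_on_SucD)
  have term_Ck: "Ck_on k S (\<lambda>x. frechet_derivative (\<lambda>x. g x \<bullet> b) (at x) v *
      frechet_derivative f (at (g x)) b)" if "b \<in> Basis" for b v
  proof (rule Ck_on_mult[OF assms(1)])
    show "Ck_on k S (\<lambda>x. frechet_derivative (\<lambda>x. g x \<bullet> b) (at x) v)"
      by (rule Ck_on_Suc_frechet_derivative[OF Suc.prems(2)[OF that]])
    show "Ck_on k S (\<lambda>x. frechet_derivative f (at (g x)) b)"
      by (rule Suc.IH[where f = "\<lambda>y. frechet_derivative f (at y) b"])
        (rule Ck_on_Suc_frechet_derivative[OF Suc.prems(1)], rule lower)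
  qed
  show ?case by (intro Ck_on_SucI[OF assms(1) der] Ck_on_sum assms(1) term_Ck) auto
qed

text \<open>Second differences: the increment of \<open>f\<close> over the parallelogram spanned by
  tu and tv is symmetric in u and v, and it equals t^2 times either mixed derivative at a point
  within O(t) of \<open>z\<close>. Continuity of the mixed derivatives does the rest.\<close>

lemma frechet_derivative_commute:
  fixes f :: "'a::euclidean_space \<Rightarrow> real"
  assumes S: "open S" "z \<in> S" and f: "Ck_on 2 S f"
  shows "frechet_derivative (\<lambda>z. frechet_derivative f (at z) u) (at z) v =
    frechet_derivative (\<lambda>z. frechet_derivative f (at z) v) (at z) u"
proof -
  define D where "D w z = frechet_derivative f (at z) w" for w z
  define D2 where "D2 w w' z = frechet_derivative (D w) (at z) w'" for w w' z
  have fd: "(f has_derivative (\<lambda>w. D w p)) (at p)" if "p \<in> S" for p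
    using Ck_on_Suc_has_derivative[of 1 S f p] f that
    unfolding D_def by (simp add: numeral_2_eq_2 eta_contract_eq del: Ck_on.simps)
  have Dd: "(D w has_derivative (\<lambda>w'. D2 w w' p)) (at p)" if "p \<in> S" for p w
  proof -
    have "Ck_on (Suc 0) S (D w)" using f unfolding D_def[abs_def] numeral_2_eq_2 by (metis Ck_on.simps(2))
    from Ck_on_Suc_has_derivative[OF this that] show ?thesis
      unfolding D2_def by simp
  qed
  have cont: "continuous_on S (D2 w w')" for w w'
    using f unfolding D_def[abs_def] D2_def[abs_def] numeral_2_eq_2 by (metis Ck_on.simps)
  obtain r where r: "r > 0" "ball z r \<subseteq> S" using S openE by blast
  \<comment> \<open>The mean value theorem is used twice: along u for the difference in the
    direction v, and along v for the derivative \<open>D u\<close>. The point \<open>p\<close> is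
    controlled only through its distance from \<open>z\<close>.\<close>
  have key: "\<exists>p. dist z p \<le> t * (norm u + norm v) \<and>
     f (z + t *\<^sub>R u + t *\<^sub>R v) - f (z + t *\<^sub>R u) - f (z + t *\<^sub>R v) + f z = t * t * D2 u v p"
    if t: "0 < t" "t * (norm u + norm v) < r" for t u v
  proof -
    have inS: "z + a *\<^sub>R u + b *\<^sub>R v \<in> S" "dist z (z + a *\<^sub>R u + b *\<^sub>R v) \<le> t * (norm u + norm v)"
      if "0 \<le> a" "a \<le> t" "0 \<le> b" "b \<le> t" for a b
    proof -
      have "norm (a *\<^sub>R u + b *\<^sub>R v) \<le> a * norm u + b * norm v"
        using norm_triangle_ineq[of "a *\<^sub>R u" "b *\<^sub>R v"] that by simp
      also have "\<dots> \<le> t * norm u + t * norm v"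
        using that by (intro add_mono mult_right_mono) auto
      finally have "norm (a *\<^sub>R u + b *\<^sub>R v) \<le> t * (norm u + norm v)"
        by (simp add: distrib_left)
      moreover have "dist z (z + a *\<^sub>R u + b *\<^sub>R v) = norm (a *\<^sub>R u + b *\<^sub>R v)"
      proof -
        have "dist z (z + w) = norm w" for w by (simp add: dist_norm)
        then show ?thesis by (simp only: add.assoc)
      qed
      ultimately show "dist z (z + a *\<^sub>R u + b *\<^sub>R v) \<le> t * (norm u + norm v)" by simp
      then show "z + a *\<^sub>R u + b *\<^sub>R v \<in> S" using t r by (auto simp: subset_iff)
    qed
    have lin: "linear (\<lambda>w. D w p)" if "p \<in> S" for p using fd[OF that] has_derivative_linear by blast
    have lin2: "linear (\<lambda>w'. D2 w w' p)" if "p \<in> S" for p w using Dd[OF that] has_derivative_linear by blast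
    have d1: "((\<lambda>a. f (z + a *\<^sub>R u + b *\<^sub>R v)) has_real_derivative D u (z + a *\<^sub>R u + b *\<^sub>R v)) (at a)"
      if "0 \<le> a" "a \<le> t" "0 \<le> b" "b \<le> t" for a b
    proof -
      have "((\<lambda>a. f (z + a *\<^sub>R u + b *\<^sub>R v)) has_derivative (\<lambda>h. D (h *\<^sub>R u) (z + a *\<^sub>R u + b *\<^sub>R v))) (at a)"
        by (rule has_derivative_compose[of "\<lambda>a. z + a *\<^sub>R u + b *\<^sub>R v" "\<lambda>h. h *\<^sub>R u" a UNIV, OF _ fd[OF inS(1)[OF that]]])
          (auto intro!: derivative_eq_intros)
      then show ?thesis
        using linear_scale[OF lin[OF inS(1)[OF that]]]
        by (simp add: has_field_derivative_def mult_commute_abs)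
    qed
    have d2: "((\<lambda>b. D u (z + a *\<^sub>R u + b *\<^sub>R v)) has_real_derivative D2 u v (z + a *\<^sub>R u + b *\<^sub>R v)) (at b)"
      if "0 \<le> a" "a \<le> t" "0 \<le> b" "b \<le> t" for a b
    proof -
      have "((\<lambda>b. D u (z + a *\<^sub>R u + b *\<^sub>R v)) has_derivative (\<lambda>h. D2 u (h *\<^sub>R v) (z + a *\<^sub>R u + b *\<^sub>R v))) (at b)"
        by (rule has_derivative_compose[of "\<lambda>b. z + a *\<^sub>R u + b *\<^sub>R v" "\<lambda>h. h *\<^sub>R v" b UNIV, OF _ Dd[OF inS(1)[OF that]]])
          (auto intro!: derivative_eq_intros)
      then show ?thesis
        using linear_scale[OF lin2[OF inS(1)[OF that]]]
        by (simp add: has_field_derivative_def mult_commute_abs)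
    qed
    have "\<exists>a>0. a < t \<and> (f (z + t *\<^sub>R u + t *\<^sub>R v) - f (z + t *\<^sub>R u + 0 *\<^sub>R v)) -
        (f (z + 0 *\<^sub>R u + t *\<^sub>R v) - f (z + 0 *\<^sub>R u + 0 *\<^sub>R v)) =
        (t - 0) * (D u (z + a *\<^sub>R u + t *\<^sub>R v) - D u (z + a *\<^sub>R u + 0 *\<^sub>R v))"
      using t by (intro MVT2) (auto intro!: DERIV_diff d1 simp del: scale_zero_left)
    then obtain a where a: "0 < a" "a < t" and
      e1: "f (z + t *\<^sub>R u + t *\<^sub>R v) - f (z + t *\<^sub>R u) - f (z + t *\<^sub>R v) + f z =
        t * (D u (z + a *\<^sub>R u + t *\<^sub>R v) - D u (z + a *\<^sub>R u + 0 *\<^sub>R v))" by auto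
    have "\<exists>b>0. b < t \<and> D u (z + a *\<^sub>R u + t *\<^sub>R v) - D u (z + a *\<^sub>R u + 0 *\<^sub>R v) =
        (t - 0) * D2 u v (z + a *\<^sub>R u + b *\<^sub>R v)"
      using t a by (intro MVT2) (auto intro!: d2 simp del: scale_zero_left)
    then obtain b where b: "0 < b" "b < t" and
      e2: "D u (z + a *\<^sub>R u + t *\<^sub>R v) - D u (z + a *\<^sub>R u + 0 *\<^sub>R v) =
        t * D2 u v (z + a *\<^sub>R u + b *\<^sub>R v)" by auto
    show ?thesis
      using e1 e2 inS(2)[of a b] a b by (intro exI[of _ "z + a *\<^sub>R u + b *\<^sub>R v"]) auto
  qed
  have "D2 u v z = D2 v u z"
  proof (rule ccontr)
    assume ne: "D2 u v z \<noteq> D2 v u z"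
    \<comment> \<open>Half the gap: a common value cannot lie within \<open>e\<close> of both
      derivatives at \<open>z\<close>.\<close>
    define e where "e = \<bar>D2 u v z - D2 v u z\<bar> / 2"
    have e: "e > 0" using ne by (simp add: e_def)
    have c: "continuous (at z) (D2 w w')" for w w' using cont S continuous_on_eq_continuous_at by blast
    obtain d1 where d1: "d1 > 0" "\<And>p. dist p z < d1 \<Longrightarrow> dist (D2 u v p) (D2 u v z) < e"
      using c[of u v] e unfolding continuous_at_eps_delta by blast
    obtain d2 where d2: "d2 > 0" "\<And>p. dist p z < d2 \<Longrightarrow> dist (D2 v u p) (D2 v u z) < e"
      using c[of v u] e unfolding continuous_at_eps_delta by blast
    define m where "m = min r (min d1 d2)"
    \<comment> \<open>The summand 1 keeps the denominator positive for u = v = 0 and makes t(|u| +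
      |v|) strictly smaller than \<open>m\<close>.\<close>
    define t where "t = m / (norm u + norm v + 1)"
    have m: "m > 0" using d1 d2 r by (simp add: m_def)
    have t: "t > 0" using m by (simp add: t_def add_nonneg_pos)
    have "t * (norm u + norm v) < t * (norm u + norm v + 1)" using t by simp
    also have "\<dots> = m"
    proof -
      have "norm u + norm v + 1 > 0" by (simp add: add_nonneg_pos)
      then show ?thesis by (simp add: t_def)
    qed
    finally have tm: "t * (norm u + norm v) < m" .
    obtain p where p: "dist z p \<le> t * (norm u + norm v)"
      "f (z + t *\<^sub>R u + t *\<^sub>R v) - f (z + t *\<^sub>R u) - f (z + t *\<^sub>R v) + f z = t * t * D2 u v p"
      using key[of t u v] t tm by (auto simp: m_def)
    obtain q where q: "dist z q \<le> t * (norm u + norm v)"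
      "f (z + t *\<^sub>R v + t *\<^sub>R u) - f (z + t *\<^sub>R v) - f (z + t *\<^sub>R u) + f z = t * t * D2 v u q"
      using key[of t v u] t tm by (auto simp: m_def add.commute)
    have "t * t * D2 u v p = t * t * D2 v u q" using p(2) q(2) by (simp add: algebra_simps)
    then have "D2 u v p = D2 v u q" using t by simp
    moreover have "dist (D2 u v p) (D2 u v z) < e" using d1(2)[of p] p(1) tm
      by (simp add: m_def dist_commute)
    moreover have "dist (D2 v u q) (D2 v u z) < e" using d2(2)[of q] q(1) tm
      by (simp add: m_def dist_commute)
    ultimately show False unfolding e_def dist_real_def by (smt (verit) field_sum_of_halves)
  qed
  then show ?thesis unfolding D2_def D_def[abs_def] .
qed

section \<open>Smooth functions of position and direction\<close>

lemma matrix_inv_right: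
  fixes A :: "real^'n::finite^'n"
  assumes "invertible A"
  shows "A ** matrix_inv A = mat 1"
  using someI_ex[OF assms[unfolded invertible_def]] by (simp add: matrix_inv_def)

text \<open>Functions stay curried because \<open>dx\<close> and \<open>dy\<close> freeze one
  argument; the smoothness is nevertheless joint in (x, y), so that both kinds of derivative can be
  mixed.\<close>

definition csmooth :: "((real^'n::finite) \<times> (real^'n)) set \<Rightarrow> 'n coord_fun \<Rightarrow> bool" where
  "csmooth S f \<longleftrightarrow> smooth_on S (\<lambda>(x, y). f x y)"

lemma csmooth_open: "csmooth S f \<Longrightarrow> open S"
  by (simp add: csmooth_def smooth_on_def)

lemma csmooth_subset: "csmooth S f \<Longrightarrow> open T \<Longrightarrow> T \<subseteq> S \<Longrightarrow> csmooth T f"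
  by (auto simp: csmooth_def smooth_on_def intro: Ck_on_subset)

lemma csmooth_has_derivative:
  assumes "csmooth S f" "(x, y) \<in> S"
  shows "((\<lambda>(x, y). f x y) has_derivative frechet_derivative (\<lambda>(x, y). f x y) (at (x, y))) (at (x, y))"
  using assms Ck_on_Suc_has_derivative[of 0 S] unfolding csmooth_def smooth_on_def by blast

text \<open>Freezing an argument is composition with an affine embedding, so a partial derivative is
  the total derivative in the direction (e_k, 0). In this way partial derivatives inherit smoothness
  and symmetry from the total derivative.\<close>

lemma dx_eq:
  assumes "csmooth S f" "(x, y) \<in> S"
  shows "dx k f x y = frechet_derivative (\<lambda>(x, y). f x y) (at (x, y)) (axis k 1, 0)"
proof -
  have "((\<lambda>x'. case (x', y) of (x, y) \<Rightarrow> f x y) has_derivative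
      (\<lambda>h. frechet_derivative (\<lambda>(x, y). f x y) (at (x, y)) (h, 0))) (at x)"
    by (rule has_derivative_compose[of "\<lambda>x'. (x', y)" "\<lambda>h. (h, 0)" x UNIV,
          OF _ csmooth_has_derivative[OF assms]])
      (auto intro!: derivative_eq_intros)
  from fun_cong[OF frechet_derivative_at[OF this], of "axis k 1"] show ?thesis
    by (simp add: dx_def)
qed

lemma dy_eq:
  assumes "csmooth S f" "(x, y) \<in> S"
  shows "dy k f x y = frechet_derivative (\<lambda>(x, y). f x y) (at (x, y)) (0, axis k 1)"
proof -
  have "((\<lambda>y'. case (x, y') of (x, y) \<Rightarrow> f x y) has_derivative
      (\<lambda>h. frechet_derivative (\<lambda>(x, y). f x y) (at (x, y)) (0, h))) (at y)"
    by (rule has_derivative_compose[of "\<lambda>y'. (x, y')" "\<lambda>h. (0, h)" y UNIV,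
          OF _ csmooth_has_derivative[OF assms]])
      (auto intro!: derivative_eq_intros)
  from fun_cong[OF frechet_derivative_at[OF this], of "axis k 1"] show ?thesis
    by (simp add: dy_def)
qed

locale coords =
  fixes S :: "((real^'n::finite) \<times> (real^'n)) set"
  assumes open_S: "open S"
begin

lemma csmooth_cong:
  assumes "\<And>x y. (x, y) \<in> S \<Longrightarrow> f x y = g x y"
  shows "csmooth S f \<longleftrightarrow> csmooth S g"
  unfolding csmooth_def smooth_on_def using open_S assms
  by (intro conj_cong all_cong1 Ck_on_cong) auto

lemma csmooth_dx: "csmooth S f \<Longrightarrow> csmooth S (dx k f)"
proof -
  assume f: "csmooth S f"
  have "csmooth S (dx k f) \<longleftrightarrow>
      csmooth S (\<lambda>x y. frechet_derivative (\<lambda>(x, y). f x y) (at (x, y)) (axis k 1, 0))"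
    by (rule csmooth_cong) (rule dx_eq[OF f])
  moreover have "Ck_on m S (\<lambda>z. frechet_derivative (\<lambda>(x, y). f x y) (at z) (axis k 1, 0))" for m
    using f unfolding csmooth_def smooth_on_def by (blast intro: Ck_on_Suc_frechet_derivative)
  ultimately show ?thesis
    using open_S by (simp add: csmooth_def smooth_on_def case_prod_unfold)
qed

lemma csmooth_dy: "csmooth S f \<Longrightarrow> csmooth S (dy k f)"
proof -
  assume f: "csmooth S f"
  have "csmooth S (dy k f) \<longleftrightarrow>
      csmooth S (\<lambda>x y. frechet_derivative (\<lambda>(x, y). f x y) (at (x, y)) (0, axis k 1))"
    by (rule csmooth_cong) (rule dy_eq[OF f])
  moreover have "Ck_on m S (\<lambda>z. frechet_derivative (\<lambda>(x, y). f x y) (at z) (0, axis k 1))" for m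
    using f unfolding csmooth_def smooth_on_def by (blast intro: Ck_on_Suc_frechet_derivative)
  ultimately show ?thesis
    using open_S by (simp add: csmooth_def smooth_on_def case_prod_unfold)
qed

section \<open>Closure of smooth coordinate functions under algebraic operations and matrix
  inversion\<close>

lemma csmooth_const: "csmooth S (\<lambda>x y. c)"
  using open_S by (simp add: csmooth_def smooth_on_def case_prod_unfold Ck_on_const)

lemma csmooth_snd: "csmooth S (\<lambda>x y. y $ i)"
  unfolding csmooth_def smooth_on_def case_prod_unfold
  by (intro conjI allI open_S Ck_on_linear bounded_linear_compose[OF bounded_linear_vec_nth]
      bounded_linear_snd)

lemma csmooth_add: "csmooth S f \<Longrightarrow> csmooth S g \<Longrightarrow> csmooth S (\<lambda>x y. f x y + g x y)"
  by (auto simp: csmooth_def smooth_on_def case_prod_unfold intro!: Ck_on_add)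

lemma csmooth_mult: "csmooth S f \<Longrightarrow> csmooth S g \<Longrightarrow> csmooth S (\<lambda>x y. f x y * g x y)"
  by (auto simp: csmooth_def smooth_on_def case_prod_unfold intro!: Ck_on_mult)

lemma csmooth_minus: "csmooth S f \<Longrightarrow> csmooth S (\<lambda>x y. - f x y)"
  using csmooth_mult[OF csmooth_const[of "-1"]] by simp

lemma csmooth_diff: "csmooth S f \<Longrightarrow> csmooth S g \<Longrightarrow> csmooth S (\<lambda>x y. f x y - g x y)"
  using csmooth_add[OF _ csmooth_minus] by simp

lemma csmooth_sum: "(\<And>i. i \<in> I \<Longrightarrow> csmooth S (f i)) \<Longrightarrow> csmooth S (\<lambda>x y. \<Sum>i\<in>I. f i x y)"
proof (cases "finite I")
  case True
  assume "\<And>i. i \<in> I \<Longrightarrow> csmooth S (f i)"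
  with True show ?thesis
    by (induction I rule: finite_induct) (auto intro!: csmooth_const csmooth_add)
qed (simp add: csmooth_const)

lemma csmooth_prod: "(\<And>i. i \<in> I \<Longrightarrow> csmooth S (f i)) \<Longrightarrow> csmooth S (\<lambda>x y. \<Prod>i\<in>I. f i x y)"
proof (cases "finite I")
  case True
  assume "\<And>i. i \<in> I \<Longrightarrow> csmooth S (f i)"
  with True show ?thesis
    by (induction I rule: finite_induct) (auto intro!: csmooth_const csmooth_mult)
qed (simp add: csmooth_const)

lemma csmooth_divide:
  assumes "csmooth S f" "csmooth S g" "\<And>x y. (x, y) \<in> S \<Longrightarrow> g x y \<noteq> 0"
  shows "csmooth S (\<lambda>x y. f x y / g x y)"
  using assms unfolding divide_inverse
  by (intro csmooth_mult) (auto simp: csmooth_def smooth_on_def case_prod_unfold intro!: Ck_on_inverse)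

lemma csmooth_cdivide: "csmooth S f \<Longrightarrow> csmooth S (\<lambda>x y. f x y / c)"
  using csmooth_mult[OF csmooth_const[of "1 / c"]] by simp

lemmas csmooth_intros = csmooth_cdivide csmooth_const csmooth_snd csmooth_add csmooth_mult csmooth_minus
  csmooth_diff csmooth_sum csmooth_dx csmooth_dy

lemma csmooth_det:
  assumes "\<And>i j. csmooth S (\<lambda>x y. M x y $ i $ j)"
  shows "csmooth S (\<lambda>x y. det (M x y))"
  unfolding det_def by (intro csmooth_intros csmooth_prod assms)

text \<open>Cramer's rule writes each entry of the inverse as a quotient of determinants. These are
  polynomials in the matrix entries, and the denominator does not vanish on
  \<open>S\<close>.\<close>

lemma csmooth_matrix_inv:
  fixes M :: "real^'n \<Rightarrow> real^'n \<Rightarrow> real^'n^'n"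
  assumes M: "\<And>i j. csmooth S (\<lambda>x y. M x y $ i $ j)"
    and inv: "\<And>x y. (x, y) \<in> S \<Longrightarrow> invertible (M x y)"
  shows "csmooth S (\<lambda>x y. matrix_inv (M x y) $ i $ j)"
proof -
  have "matrix_inv (M x y) $ i $ j =
      det (\<chi> a b. if b = i then axis j 1 $ a else M x y $ a $ b) / det (M x y)" if "(x, y) \<in> S" for x y
  proof -
    have "M x y *v (matrix_inv (M x y) *v axis j 1) = axis j 1"
      by (simp add: matrix_vector_mul_assoc matrix_inv_right[OF inv[OF that]])
    moreover have "det (M x y) \<noteq> 0" using inv[OF that] by (simp add: invertible_det_nz)
    ultimately have "matrix_inv (M x y) *v axis j 1 = (\<chi> k. det (\<chi> a b. if b = k then axis j 1 $ a else M x y $ a $ b) / det (M x y))"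
      using cramer by blast
    moreover have "(matrix_inv (M x y) *v axis j 1) $ i = matrix_inv (M x y) $ i $ j"
      by (simp add: matrix_vector_mult_basis column_def)
    ultimately show ?thesis by simp
  qed
  moreover have "csmooth S (\<lambda>x y. det (\<chi> a b. if b = i then axis j 1 $ a else M x y $ a $ b) / det (M x y))"
  proof (intro csmooth_divide csmooth_det M)
    show "csmooth S (\<lambda>x y. (\<chi> a b. if b = i then axis j 1 $ a else M x y $ a $ b) $ p $ q)" for p q
      by (cases "q = i") (auto intro: csmooth_const M)
  qed (use inv in \<open>auto simp: invertible_det_nz\<close>)
  ultimately show ?thesis by (subst csmooth_cong)
qed

text \<open>Slices of an open set are open, so an identity known only on \<open>S\<close> may be
  differentiated. This is how identities restricted to nonzero \<open>y\<close> are differentiated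
  later.\<close>

lemma dx_cong:
  assumes "(x, y) \<in> S" "\<And>x y. (x, y) \<in> S \<Longrightarrow> f x y = g x y"
  shows "dx k f x y = dx k g x y"
proof -
  have o: "open ((\<lambda>x'. (x', y)) -` S)"
    by (rule open_vimage[OF open_S]) (auto intro!: continuous_intros)
  have "((\<lambda>x'. f x' y) has_derivative d) (at x) \<longleftrightarrow> ((\<lambda>x'. g x' y) has_derivative d) (at x)" for d
    using has_derivative_transform_within_open[OF _ o, of "\<lambda>x'. f x' y" d x UNIV "\<lambda>x'. g x' y"]
      has_derivative_transform_within_open[OF _ o, of "\<lambda>x'. g x' y" d x UNIV "\<lambda>x'. f x' y"] assms by auto
  then show ?thesis by (simp add: dx_def frechet_derivative_def)
qed

lemma dy_cong:
  assumes "(x, y) \<in> S" "\<And>x y. (x, y) \<in> S \<Longrightarrow> f x y = g x y"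
  shows "dy k f x y = dy k g x y"
proof -
  have o: "open (Pair x -` S)"
    by (rule open_vimage[OF open_S]) (auto intro!: continuous_intros)
  have "((\<lambda>y'. f x y') has_derivative d) (at y) \<longleftrightarrow> ((\<lambda>y'. g x y') has_derivative d) (at y)" for d
    using has_derivative_transform_within_open[OF _ o, of "\<lambda>y'. f x y'" d y UNIV "\<lambda>y'. g x y'"]
      has_derivative_transform_within_open[OF _ o, of "\<lambda>y'. g x y'" d y UNIV "\<lambda>y'. f x y'"] assms by auto
  then show ?thesis by (simp add: dy_def frechet_derivative_def)
qed

lemma csmooth_slice:
  assumes "csmooth S f" "(x, y) \<in> S"
  shows "((\<lambda>x'. f x' y) has_derivative frechet_derivative (\<lambda>x'. f x' y) (at x)) (at x)"
    and "((\<lambda>y'. f x y') has_derivative frechet_derivative (\<lambda>y'. f x y') (at y)) (at y)"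
proof -
  have "((\<lambda>x'. case (x', y) of (x, y) \<Rightarrow> f x y) has_derivative
      (\<lambda>h. frechet_derivative (\<lambda>(x, y). f x y) (at (x, y)) (h, 0))) (at x)"
    by (rule has_derivative_compose[of "\<lambda>x'. (x', y)" "\<lambda>h. (h, 0)" x UNIV,
          OF _ csmooth_has_derivative[OF assms]])
      (auto intro!: derivative_eq_intros)
  then show "((\<lambda>x'. f x' y) has_derivative frechet_derivative (\<lambda>x'. f x' y) (at x)) (at x)"
    by (simp add: differentiableI flip: frechet_derivative_works)
  have "((\<lambda>y'. case (x, y') of (x, y) \<Rightarrow> f x y) has_derivative
      (\<lambda>h. frechet_derivative (\<lambda>(x, y). f x y) (at (x, y)) (0, h))) (at y)"
    by (rule has_derivative_compose[of "\<lambda>y'. (x, y')" "\<lambda>h. (0, h)" y UNIV,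
          OF _ csmooth_has_derivative[OF assms]])
      (auto intro!: derivative_eq_intros)
  then show "((\<lambda>y'. f x y') has_derivative frechet_derivative (\<lambda>y'. f x y') (at y)) (at y)"
    by (simp add: differentiableI flip: frechet_derivative_works)
qed

section \<open>Differentiation rules and commuting partial derivatives\<close>

lemma dx_const [simp]: "dx k (\<lambda>x y. c) x y = 0"
  and dy_const [simp]: "dy k (\<lambda>x y. c) x y = 0"
  by (simp_all add: dx_def dy_def)

lemma dx_indep [simp]: "dx k (\<lambda>x y. h y) x y = 0"
  and dy_indep [simp]: "dy k (\<lambda>x y. h x) x y = 0"
  by (simp_all add: dx_def dy_def)

lemma dy_snd:
  fixes i k :: 'n
  shows "dy k (\<lambda>x y. y $ i) x y = (if i = k then 1 else 0)"
proof -
  have "((\<lambda>y::real^'n. y $ i) has_derivative (\<lambda>y. y $ i)) (at y)"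
    by (rule bounded_linear_imp_has_derivative[OF bounded_linear_vec_nth])
  from frechet_derivative_at[OF this, symmetric] show ?thesis
    by (simp add: dy_def axis_def)
qed

lemma dx_add: "csmooth S f \<Longrightarrow> csmooth S g \<Longrightarrow> (x, y) \<in> S \<Longrightarrow>
    dx k (\<lambda>x y. f x y + g x y) x y = dx k f x y + dx k g x y"
  and dy_add: "csmooth S f \<Longrightarrow> csmooth S g \<Longrightarrow> (x, y) \<in> S \<Longrightarrow>
    dy k (\<lambda>x y. f x y + g x y) x y = dy k f x y + dy k g x y"
  unfolding dx_def dy_def
  by (simp_all add: frechet_derivative_at[OF has_derivative_add, OF csmooth_slice(1) csmooth_slice(1), symmetric]
      frechet_derivative_at[OF has_derivative_add, OF csmooth_slice(2) csmooth_slice(2), symmetric])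

lemma dx_mult: "csmooth S f \<Longrightarrow> csmooth S g \<Longrightarrow> (x, y) \<in> S \<Longrightarrow>
    dx k (\<lambda>x y. f x y * g x y) x y = dx k f x y * g x y + f x y * dx k g x y"
  and dy_mult: "csmooth S f \<Longrightarrow> csmooth S g \<Longrightarrow> (x, y) \<in> S \<Longrightarrow>
    dy k (\<lambda>x y. f x y * g x y) x y = dy k f x y * g x y + f x y * dy k g x y"
  unfolding dx_def dy_def
  by (simp_all add: frechet_derivative_at[OF has_derivative_mult, OF csmooth_slice(1) csmooth_slice(1), symmetric]
      frechet_derivative_at[OF has_derivative_mult, OF csmooth_slice(2) csmooth_slice(2), symmetric])

lemma dx_cmult: "csmooth S f \<Longrightarrow> (x, y) \<in> S \<Longrightarrow> dx k (\<lambda>x y. c * f x y) x y = c * dx k f x y"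
  and dy_cmult: "csmooth S f \<Longrightarrow> (x, y) \<in> S \<Longrightarrow> dy k (\<lambda>x y. c * f x y) x y = c * dy k f x y"
  by (simp_all add: dx_mult dy_mult csmooth_const)

lemma dx_cdivide: "csmooth S f \<Longrightarrow> (x, y) \<in> S \<Longrightarrow> dx k (\<lambda>x y. f x y / c) x y = dx k f x y / c"
  and dy_cdivide: "csmooth S f \<Longrightarrow> (x, y) \<in> S \<Longrightarrow> dy k (\<lambda>x y. f x y / c) x y = dy k f x y / c"
  using dx_cmult[of f x y k "1 / c"] dy_cmult[of f x y k "1 / c"] by simp_all

lemma dx_minus: "csmooth S f \<Longrightarrow> (x, y) \<in> S \<Longrightarrow> dx k (\<lambda>x y. - f x y) x y = - dx k f x y"
  and dy_minus: "csmooth S f \<Longrightarrow> (x, y) \<in> S \<Longrightarrow> dy k (\<lambda>x y. - f x y) x y = - dy k f x y"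
  using dx_cmult[of f x y k "-1"] dy_cmult[of f x y k "-1"] by simp_all

lemma dx_diff: "csmooth S f \<Longrightarrow> csmooth S g \<Longrightarrow> (x, y) \<in> S \<Longrightarrow>
    dx k (\<lambda>x y. f x y - g x y) x y = dx k f x y - dx k g x y"
  and dy_diff: "csmooth S f \<Longrightarrow> csmooth S g \<Longrightarrow> (x, y) \<in> S \<Longrightarrow>
    dy k (\<lambda>x y. f x y - g x y) x y = dy k f x y - dy k g x y"
  using dx_add[of f "\<lambda>x y. - g x y" x y k] dy_add[of f "\<lambda>x y. - g x y" x y k]
  by (simp_all add: dx_minus dy_minus csmooth_minus)

lemma dx_sum: "(\<And>i. i \<in> I \<Longrightarrow> csmooth S (f i)) \<Longrightarrow> (x, y) \<in> S \<Longrightarrow>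
    dx k (\<lambda>x y. \<Sum>i\<in>I. f i x y) x y = (\<Sum>i\<in>I. dx k (f i) x y)"
  by (induction I rule: infinite_finite_induct) (simp_all add: dx_add csmooth_sum)

lemma dy_sum: "(\<And>i. i \<in> I \<Longrightarrow> csmooth S (f i)) \<Longrightarrow> (x, y) \<in> S \<Longrightarrow>
    dy k (\<lambda>x y. \<Sum>i\<in>I. f i x y) x y = (\<Sum>i\<in>I. dy k (f i) x y)"
  by (induction I rule: infinite_finite_induct) (simp_all add: dy_add csmooth_sum)

lemmas d_simps = dx_cdivide dy_cdivide dx_add dy_add dx_mult dy_mult dx_minus dy_minus dx_diff dy_diff
  dx_sum dy_sum dy_snd csmooth_intros

lemma frechet_derivative_pair_commute:
  assumes "csmooth S f" "(x, y) \<in> S"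
  shows "frechet_derivative (\<lambda>z. frechet_derivative (\<lambda>(x, y). f x y) (at z) u) (at (x, y)) v =
     frechet_derivative (\<lambda>z. frechet_derivative (\<lambda>(x, y). f x y) (at z) v) (at (x, y)) u"
  using assms unfolding csmooth_def smooth_on_def by (intro frechet_derivative_commute[of S]) auto

lemma frechet_derivative_cong:
  assumes "z \<in> S" "\<And>z. z \<in> S \<Longrightarrow> f z = g z"
  shows "frechet_derivative f (at z) = frechet_derivative g (at z)"
proof -
  have "(f has_derivative d) (at z) \<longleftrightarrow> (g has_derivative d) (at z)" for d
    using has_derivative_transform_within_open[OF _ open_S, of f d z UNIV g]
      has_derivative_transform_within_open[OF _ open_S, of g d z UNIV f] assms by auto
  then show ?thesis by (simp add: frechet_derivative_def)
qed

lemma frechet_derivative_dx: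
  assumes "csmooth S f" "(x, y) \<in> S"
  shows "frechet_derivative (\<lambda>(x, y). dx k f x y) (at (x, y)) =
    frechet_derivative (\<lambda>z. frechet_derivative (\<lambda>(x, y). f x y) (at z) (axis k 1, 0)) (at (x, y))"
  by (rule frechet_derivative_cong) (use assms in \<open>auto simp: dx_eq\<close>)

lemma frechet_derivative_dy:
  assumes "csmooth S f" "(x, y) \<in> S"
  shows "frechet_derivative (\<lambda>(x, y). dy k f x y) (at (x, y)) =
    frechet_derivative (\<lambda>z. frechet_derivative (\<lambda>(x, y). f x y) (at z) (0, axis k 1)) (at (x, y))"
  by (rule frechet_derivative_cong) (use assms in \<open>auto simp: dy_eq\<close>)

lemma dx_dx: "csmooth S f \<Longrightarrow> (x, y) \<in> S \<Longrightarrow> dx j (dx k f) x y = dx k (dx j f) x y"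
  and dy_dy: "csmooth S f \<Longrightarrow> (x, y) \<in> S \<Longrightarrow> dy j (dy k f) x y = dy k (dy j f) x y"
  and dx_dy: "csmooth S f \<Longrightarrow> (x, y) \<in> S \<Longrightarrow> dx j (dy k f) x y = dy k (dx j f) x y"
  by (simp_all add: dx_eq[OF csmooth_dx] dy_eq[OF csmooth_dx] dx_eq[OF csmooth_dy] dy_eq[OF csmooth_dy]
      frechet_derivative_dx frechet_derivative_dy frechet_derivative_pair_commute)

end

section \<open>Sprays and the cyclic identity\<close>

context coords begin

text \<open>Homogeneity of degree \<open>c\<close> in infinitesimal form. Unlike a scaling law it is
  meaningful on any open \<open>S\<close>, and it passes directly to derivatives.\<close>

definition euler :: "real \<Rightarrow> 'n coord_fun \<Rightarrow> bool" where
  "euler c f \<longleftrightarrow> (\<forall>x y. (x, y) \<in> S \<longrightarrow> (\<Sum>m\<in>UNIV. y $ m * dy m f x y) = c * f x y)"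

lemma eulerD: "euler c f \<Longrightarrow> (x, y) \<in> S \<Longrightarrow> (\<Sum>m\<in>UNIV. y $ m * dy m f x y) = c * f x y"
  by (simp add: euler_def)

text \<open>Product rule: pulling the contraction with \<open>y\<close> inside \<open>dy j\<close>
  costs the single term with m = j. Contractions are pushed through iterated derivatives by
  this.\<close>

lemma sum_snd_dy:
  assumes "\<And>m. csmooth S (f m)" "(x, y) \<in> S"
  shows "(\<Sum>m\<in>UNIV. y $ m * dy j (f m) x y) =
    dy j (\<lambda>x y. \<Sum>m\<in>UNIV. y $ m * f m x y) x y - f j x y"
  using assms by (simp add: d_simps sum.distrib if_distrib[of "\<lambda>a. a * _"] cong: if_cong)

lemma euler_dy:
  assumes "euler c f" "csmooth S f"
  shows "euler (c - 1) (dy j f)"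
  unfolding euler_def
proof (intro allI impI)
  fix x y assume xy: "(x, y) \<in> S"
  have "(\<Sum>m\<in>UNIV. y $ m * dy m (dy j f) x y) = (\<Sum>m\<in>UNIV. y $ m * dy j (dy m f) x y)"
    by (intro sum.cong refl arg_cong2[of _ _ _ _ "(*)"] dy_dy assms xy)
  also have "\<dots> = dy j (\<lambda>x y. \<Sum>m\<in>UNIV. y $ m * dy m f x y) x y - dy j f x y"
    by (intro sum_snd_dy csmooth_dy assms xy)
  also have "dy j (\<lambda>x y. \<Sum>m\<in>UNIV. y $ m * dy m f x y) x y = dy j (\<lambda>x y. c * f x y) x y"
    by (rule dy_cong[OF xy]) (rule eulerD[OF assms(1)])
  finally show "(\<Sum>m\<in>UNIV. y $ m * dy m (dy j f) x y) = (c - 1) * dy j f x y"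
    using assms xy by (simp add: dy_cmult algebra_simps)
qed

lemma euler_dx:
  assumes "euler c f" "csmooth S f"
  shows "euler c (dx j f)"
  unfolding euler_def
proof (intro allI impI)
  fix x y assume xy: "(x, y) \<in> S"
  have "(\<Sum>m\<in>UNIV. y $ m * dy m (dx j f) x y) = (\<Sum>m\<in>UNIV. y $ m * dx j (dy m f) x y)"
    by (intro sum.cong refl arg_cong2[of _ _ _ _ "(*)"] dx_dy[symmetric] assms xy)
  also have "\<dots> = dx j (\<lambda>x y. \<Sum>m\<in>UNIV. y $ m * dy m f x y) x y"
    using assms xy by (simp add: d_simps)
  also have "\<dots> = dx j (\<lambda>x y. c * f x y) x y"
    by (rule dx_cong[OF xy]) (rule eulerD[OF assms(1)])
  finally show "(\<Sum>m\<in>UNIV. y $ m * dy m (dx j f) x y) = c * dx j f x y"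
    using assms xy by (simp add: dx_cmult)
qed

lemma euler_const: "euler 0 (\<lambda>x y. c)"
  by (simp add: euler_def)

lemma euler_snd: "euler 1 (\<lambda>x y. y $ i)"
  by (simp add: euler_def dy_snd if_distrib[of "\<lambda>a. _ * a"] cong: if_cong)

lemma euler_add: "euler c f \<Longrightarrow> euler c g \<Longrightarrow> csmooth S f \<Longrightarrow> csmooth S g \<Longrightarrow>
    euler c (\<lambda>x y. f x y + g x y)"
  by (simp add: euler_def dy_add distrib_left sum.distrib)

lemma euler_diff: "euler c f \<Longrightarrow> euler c g \<Longrightarrow> csmooth S f \<Longrightarrow> csmooth S g \<Longrightarrow>
    euler c (\<lambda>x y. f x y - g x y)"
  by (simp add: euler_def dy_diff right_diff_distrib sum_subtractf)

lemma euler_mult: 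
  assumes "euler c f" "euler d g" "csmooth S f" "csmooth S g"
  shows "euler (c + d) (\<lambda>x y. f x y * g x y)"
  unfolding euler_def
proof (intro allI impI)
  fix x y assume xy: "(x, y) \<in> S"
  have "(\<Sum>m\<in>UNIV. y $ m * dy m (\<lambda>x y. f x y * g x y) x y) =
      (\<Sum>m\<in>UNIV. y $ m * dy m f x y) * g x y + f x y * (\<Sum>m\<in>UNIV. y $ m * dy m g x y)"
    using assms xy by (simp add: dy_mult sum_distrib_left sum_distrib_right algebra_simps flip: sum.distrib)
  then show "(\<Sum>m\<in>UNIV. y $ m * dy m (\<lambda>x y. f x y * g x y) x y) = (c + d) * (f x y * g x y)"
    by (simp add: eulerD[OF assms(1) xy] eulerD[OF assms(2) xy] algebra_simps)
qed

lemma euler_sum: 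
  "(\<And>i. i \<in> I \<Longrightarrow> euler c (f i)) \<Longrightarrow> (\<And>i. i \<in> I \<Longrightarrow> csmooth S (f i)) \<Longrightarrow>
    euler c (\<lambda>x y. \<Sum>i\<in>I. f i x y)"
proof (induction I rule: infinite_finite_induct)
  case (insert i I)
  then show ?case by (simp add: euler_add csmooth_sum)
qed (simp_all add: euler_def)

end

locale spray_coords = coords S for S :: "((real^'n::finite) \<times> (real^'n)) set" +
  fixes G :: "'n \<Rightarrow> 'n coord_fun"
  assumes G: "csmooth S (G i)"
    and euler_G: "euler 2 (G i)"
begin

text \<open>The spray as a vector field, y^m d/dx^m - 2 G^r d/dy^r. On functions it is
  \<open>|_0\<close>, because G^r_{.m} y^m = 2 G^r.\<close>

definition spray_deriv :: "'n coord_fun \<Rightarrow> 'n coord_fun" where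
  "spray_deriv f x y = (\<Sum>m\<in>UNIV. y $ m * dx m f x y) - 2 * (\<Sum>r\<in>UNIV. G r x y * dy r f x y)"

text \<open>The operation \<open>|_0\<close> on three covariant indices. The connection terms
  contain G^r_{.j} because y^m G^r_{.j.m} = G^r_{.j}. It is applied to arrays of components within
  one coordinate system.\<close>

definition cov3 :: "('n \<Rightarrow> 'n \<Rightarrow> 'n \<Rightarrow> 'n coord_fun) \<Rightarrow> 'n \<Rightarrow> 'n \<Rightarrow> 'n \<Rightarrow> 'n coord_fun" where
  "cov3 q j k l x y = spray_deriv (q j k l) x y - (\<Sum>r\<in>UNIV. q r k l x y * dy j (G r) x y)
     - (\<Sum>r\<in>UNIV. q j r l x y * dy k (G r) x y) - (\<Sum>r\<in>UNIV. q j k r x y * dy l (G r) x y)"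

definition cov2 :: "('n \<Rightarrow> 'n \<Rightarrow> 'n coord_fun) \<Rightarrow> 'n \<Rightarrow> 'n \<Rightarrow> 'n coord_fun" where
  "cov2 q j k x y = spray_deriv (q j k) x y - (\<Sum>r\<in>UNIV. q r k x y * dy j (G r) x y)
     - (\<Sum>r\<in>UNIV. q j r x y * dy k (G r) x y)"

lemma csmooth_spray_deriv: "csmooth S f \<Longrightarrow> csmooth S (spray_deriv f)"
  unfolding spray_deriv_def[abs_def] by (intro csmooth_intros G)

lemma spray_deriv_cong:
  assumes "(x, y) \<in> S" "\<And>x y. (x, y) \<in> S \<Longrightarrow> f x y = g x y"
  shows "spray_deriv f x y = spray_deriv g x y"
  using dx_cong[OF assms] dy_cong[OF assms] by (simp add: spray_deriv_def)

lemma spray_deriv_snd: "spray_deriv (\<lambda>x y. y $ i) x y = - 2 * G i x y"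
  by (simp add: spray_deriv_def dy_snd if_distrib[of "\<lambda>a. _ * a"] cong: if_cong)

lemma spray_deriv_add: "csmooth S f \<Longrightarrow> csmooth S g \<Longrightarrow> (x, y) \<in> S \<Longrightarrow>
    spray_deriv (\<lambda>x y. f x y + g x y) x y = spray_deriv f x y + spray_deriv g x y"
  by (simp add: spray_deriv_def dx_add dy_add distrib_left sum.distrib)

lemma spray_deriv_diff: "csmooth S f \<Longrightarrow> csmooth S g \<Longrightarrow> (x, y) \<in> S \<Longrightarrow>
    spray_deriv (\<lambda>x y. f x y - g x y) x y = spray_deriv f x y - spray_deriv g x y"
  by (simp add: spray_deriv_def dx_diff dy_diff right_diff_distrib sum_subtractf)

lemma spray_deriv_mult: "csmooth S f \<Longrightarrow> csmooth S g \<Longrightarrow> (x, y) \<in> S \<Longrightarrow>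
    spray_deriv (\<lambda>x y. f x y * g x y) x y = spray_deriv f x y * g x y + f x y * spray_deriv g x y"
  by (simp add: spray_deriv_def dx_mult dy_mult distrib_left sum.distrib sum_distrib_left sum_distrib_right algebra_simps)

lemma spray_deriv_const [simp]: "spray_deriv (\<lambda>x y. c) x y = 0"
  by (simp add: spray_deriv_def)

lemma spray_deriv_cmult: "csmooth S f \<Longrightarrow> (x, y) \<in> S \<Longrightarrow> spray_deriv (\<lambda>x y. c * f x y) x y = c * spray_deriv f x y"
  by (simp add: spray_deriv_mult csmooth_const)

lemma spray_deriv_sum: 
  "(\<And>i. i \<in> I \<Longrightarrow> csmooth S (f i)) \<Longrightarrow> (x, y) \<in> S \<Longrightarrow>
    spray_deriv (\<lambda>x y. \<Sum>i\<in>I. f i x y) x y = (\<Sum>i\<in>I. spray_deriv (f i) x y)"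
  by (induction I rule: infinite_finite_induct) (simp_all add: spray_deriv_add csmooth_sum)

text \<open>The commutator of d/dy^j with the spray is d/dx^j - 2 G^r_{.j} d/dy^r. Its position part
  is what later offsets the leading term of the curvature in the cyclic sum.\<close>

lemma dy_spray_deriv:
  assumes "csmooth S f" "(x, y) \<in> S"
  shows "dy j (spray_deriv f) x y = spray_deriv (dy j f) x y + dx j f x y - 2 * (\<Sum>r\<in>UNIV. dy j (G r) x y * dy r f x y)"
proof -
  have "dy j (spray_deriv f) x y = (\<Sum>m\<in>UNIV. (if m = j then 1 else 0) * dx m f x y + y $ m * dy j (dx m f) x y)
     - 2 * (\<Sum>r\<in>UNIV. dy j (G r) x y * dy r f x y + G r x y * dy j (dy r f) x y)"
    unfolding spray_deriv_def[abs_def] using assms by (simp add: d_simps G)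
  also have "\<dots> = spray_deriv (dy j f) x y + dx j f x y - 2 * (\<Sum>r\<in>UNIV. dy j (G r) x y * dy r f x y)"
    using assms by (simp add: spray_deriv_def sum.distrib if_distrib[of "\<lambda>a. a * _"] dx_dy dy_dy[of _ _ _ _ j] cong: if_cong)
  finally show ?thesis .
qed

lemma sum_snd_dy_G:
  assumes "(x, y) \<in> S"
  shows "(\<Sum>m\<in>UNIV. dy m (G i) x y * y $ m) = 2 * G i x y"
    and "(\<Sum>m\<in>UNIV. dy m (dy r (G i)) x y * y $ m) = dy r (G i) x y"
  using eulerD[OF euler_G assms, of i] eulerD[OF euler_dy[OF euler_G G] assms, of r i]
  by (simp_all add: mult.commute)

text \<open>By homogeneity, contracting the covariant derivative with \<open>y\<close> leaves only first derivatives
  of the spray coefficients.\<close>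

lemma hcov3_0_eq:
  assumes "(x, y) \<in> S"
  shows "hcov3_0 G T j i k l x y = spray_deriv (T j i k l) x y + (\<Sum>r\<in>UNIV. T j r k l x y * dy r (G i) x y)
     - (\<Sum>r\<in>UNIV. T r i k l x y * dy j (G r) x y) - (\<Sum>r\<in>UNIV. T j i r l x y * dy k (G r) x y)
     - (\<Sum>r\<in>UNIV. T j i k r x y * dy l (G r) x y)"
proof -
  have *: "(\<Sum>m\<in>UNIV. (\<Sum>r\<in>UNIV. f r * g m r) * y $ m) = (\<Sum>r\<in>UNIV. f r * (\<Sum>m\<in>UNIV. g m r * y $ m))"
    for f :: "'n \<Rightarrow> real" and g
    by (simp add: sum_distrib_left sum_distrib_right mult.assoc, rule sum.swap)
  have **: "(\<Sum>m\<in>UNIV. (\<Sum>r\<in>UNIV. g m r * f r) * y $ m) = (\<Sum>r\<in>UNIV. f r * (\<Sum>m\<in>UNIV. g m r * y $ m))"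
    for f :: "'n \<Rightarrow> real" and g
    unfolding *[symmetric] by (simp add: mult.commute)
  show ?thesis
    unfolding hcov3_0_def hcov3_def distrib_right left_diff_distrib sum.distrib sum_subtractf * **
      sum_snd_dy_G[OF assms] spray_deriv_def
    by (simp add: sum_distrib_left mult_ac)
qed

lemma hcov3_0_cong:
  assumes "(x, y) \<in> S" "\<And>j i k l x y. (x, y) \<in> S \<Longrightarrow> T j i k l x y = T' j i k l x y"
  shows "hcov3_0 G T j i k l x y = hcov3_0 G T' j i k l x y"
  using assms by (simp add: hcov3_0_eq spray_deriv_cong[OF assms(1) assms(2)])

lemma csmooth_hcov3_0:
  assumes "\<And>j i k l. csmooth S (T j i k l)"
  shows "csmooth S (hcov3_0 G T j i k l)"
  by (subst csmooth_cong[OF hcov3_0_eq]) (auto intro!: csmooth_intros csmooth_spray_deriv assms G)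

text \<open>\<open>y^i\<close> is parallel along the spray: its spray derivative -2 G^i is offset by
  the connection term y^r G^i_{.r} = 2 G^i of the upper index. Hence a multiple of
  \<open>y^i\<close> is differentiated only in its coefficient.\<close>

lemma hcov3_0_add_snd:
  assumes "\<And>j i k l. csmooth S (T j i k l)" "\<And>j k l. csmooth S (q j k l)" "(x, y) \<in> S"
  shows "hcov3_0 G (\<lambda>j i k l x y. T j i k l x y + q j k l x y * y $ i) j i k l x y =
    hcov3_0 G T j i k l x y + cov3 q j k l x y * y $ i"
proof -
  have 1: "(\<Sum>r\<in>UNIV. q j k l x y * y $ r * dy r (G i) x y) = 2 * q j k l x y * G i x y"
    using sum_snd_dy_G(1)[OF assms(3), of i]
    by (simp add: mult.assoc sum_distrib_left[symmetric] mult.commute[of "y $ _"])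
  show ?thesis using assms 1
    by (simp add: hcov3_0_eq cov3_def spray_deriv_add spray_deriv_mult spray_deriv_snd csmooth_intros distrib_right
        sum.distrib sum_distrib_right left_diff_distrib mult.assoc mult.commute[of _ "y $ i"] mult.left_commute[of _ "y $ i"] right_diff_distrib sum_distrib_left)
qed

lemma hcov3_0_diff:
  assumes "\<And>j i k l. csmooth S (T j i k l)" "\<And>j i k l. csmooth S (T' j i k l)" "(x, y) \<in> S"
  shows "hcov3_0 G (\<lambda>j i k l x y. T j i k l x y - T' j i k l x y) j i k l x y =
    hcov3_0 G T j i k l x y - hcov3_0 G T' j i k l x y"
  using assms by (simp add: hcov3_0_eq spray_deriv_diff left_diff_distrib sum_subtractf)

text \<open>The Kronecker delta is parallel: the connection terms of its upper and its lower index
  cancel, leaving \<open>cov2\<close> of the coefficient. The three summands are those that occur in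
  the Douglas tensor.\<close>

lemma hcov3_0_delta:
  assumes q: "\<And>j k. csmooth S (q j k)" and xy: "(x, y) \<in> S"
  shows "hcov3_0 G (\<lambda>j i k l x y. q j k x y * (if i = l then 1 else 0)
      + q j l x y * (if i = k then 1 else 0) + q k l x y * (if i = j then 1 else 0)) j i k l x y =
    cov2 q j k x y * (if i = l then 1 else 0)
      + cov2 q j l x y * (if i = k then 1 else 0) + cov2 q k l x y * (if i = j then 1 else 0)"
  using assms
  by (auto simp add: hcov3_0_eq cov2_def spray_deriv_add spray_deriv_mult csmooth_intros distrib_right sum.distrib
      if_distrib[of "\<lambda>a. _ * a"] if_distrib[of "\<lambda>a. a * _"] cong: if_cong)

section \<open>Berwald curvature and second derivatives of the Riemann curvature\<close>

definition berwald :: "'n \<Rightarrow> 'n \<Rightarrow> 'n \<Rightarrow> 'n \<Rightarrow> 'n coord_fun" where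
  "berwald j i k l = dy j (dy k (dy l (G i)))"

lemma csmooth_berwald: "csmooth S (berwald j i k l)"
  unfolding berwald_def by (intro csmooth_intros G)

text \<open>The two middle terms combine to the spray derivative of G^i_{.k}, so that
  \<open>dy_spray_deriv\<close> takes care of the \<open>y\<close>-derivatives.\<close>

lemma riemann_eq: "riemann G i k x y = 2 * dx k (G i) x y - spray_deriv (dy k (G i)) x y
     - (\<Sum>m\<in>UNIV. dy m (G i) x y * dy k (G m) x y)"
  by (simp add: riemann_def spray_deriv_def mult.commute)

lemma csmooth_riemann: "csmooth S (riemann G i k)"
  unfolding riemann_eq[abs_def] by (intro csmooth_intros csmooth_spray_deriv G)

lemma dy_riemann:
  assumes xy: "(x, y) \<in> S"
  shows "dy l (riemann G i k) x y = 2 * dx k (dy l (G i)) x y - spray_deriv (dy l (dy k (G i))) x y - dx l (dy k (G i)) x y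
    + 2 * (\<Sum>r\<in>UNIV. dy l (G r) x y * dy r (dy k (G i)) x y)
    - (\<Sum>m\<in>UNIV. dy l (dy m (G i)) x y * dy k (G m) x y + dy m (G i) x y * dy l (dy k (G m)) x y)"
  unfolding riemann_eq[abs_def] using xy by (simp add: d_simps G csmooth_spray_deriv dy_spray_deriv dx_dy)

lemma dy_dy_riemann:
  assumes xy: "(x, y) \<in> S"
  shows "dy j (dy l (riemann G i k)) x y = 2 * dx k (dy j (dy l (G i))) x y
    - spray_deriv (berwald j i l k) x y - dx j (dy l (dy k (G i))) x y
    + 2 * (\<Sum>r\<in>UNIV. dy j (G r) x y * berwald r i l k x y)
    - dx l (dy j (dy k (G i))) x y
    + 2 * (\<Sum>r\<in>UNIV. dy j (dy l (G r)) x y * dy r (dy k (G i)) x y + dy l (G r) x y * berwald j i r k x y)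
    - (\<Sum>m\<in>UNIV. berwald j i l m x y * dy k (G m) x y + dy l (dy m (G i)) x y * dy j (dy k (G m)) x y
       + dy j (dy m (G i)) x y * dy l (dy k (G m)) x y + dy m (G i) x y * berwald j m l k x y)"
  unfolding berwald_def
  by (subst dy_cong[OF xy dy_riemann]) (use xy in \<open>auto simp: d_simps G csmooth_spray_deriv dy_spray_deriv dx_dy add.assoc\<close>)

lemma berwald_sym:
  assumes xy: "(x, y) \<in> S"
  shows "berwald j i k l x y = berwald k i j l x y" "berwald j i k l x y = berwald j i l k x y"
proof -
  show "berwald j i k l x y = berwald k i j l x y" 
    unfolding berwald_def by (intro dy_dy csmooth_intros G xy)
  show "berwald j i k l x y = berwald j i l k x y"
    unfolding berwald_def by (rule dy_cong[OF xy]) (intro dy_dy csmooth_intros G)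
qed

lemma spray_deriv_berwald_sym:
  assumes xy: "(x, y) \<in> S"
  shows "spray_deriv (berwald j i k l) x y = spray_deriv (berwald k i j l) x y" "spray_deriv (berwald j i k l) x y = spray_deriv (berwald j i l k) x y"
  by (rule spray_deriv_cong[OF xy], erule berwald_sym)+

lemma dx_dy_dy_G:
  assumes xy: "(x, y) \<in> S"
  shows "dx k (dy j (dy l (G i))) x y = dx k (dy l (dy j (G i))) x y"
  by (rule dx_cong[OF xy]) (intro dy_dy G)

text \<open>In the expansion \<open>dy_dy_riemann\<close>, the connection term of each lower index
  occurs with the coefficients 2, 2, -1 over the cyclic sum, hence 3 in total; the upper-index term
  and the spray derivative occur three times with -1. Symmetry of \<open>berwald\<close> identifies
  the copies, and all remaining terms cancel.\<close>

lemma cyclic_riemann: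
  assumes xy: "(x, y) \<in> S"
  shows "dy j (dy k (riemann G i l)) x y + dy j (dy l (riemann G i k)) x y + dy k (dy l (riemann G i j)) x y
    = - 3 * hcov3_0 G berwald j i k l x y"
  using berwald_sym[OF xy] spray_deriv_berwald_sym[OF xy] dx_dy_dy_G[OF xy] dy_dy[OF G xy]
  by (simp add: dy_dy_riemann[OF xy] hcov3_0_eq[OF xy] sum.distrib algebra_simps)

end

section \<open>The Weyl and Douglas curvatures of a spray\<close>

context spray_coords begin

lemma euler_spray_deriv:
  assumes "euler c f" "csmooth S f"
  shows "euler (c + 1) (spray_deriv f)"
proof -
  have "euler (1 + c) (\<lambda>x y. \<Sum>m\<in>UNIV. y $ m * dx m f x y)"
    by (intro euler_sum euler_mult euler_snd euler_dx assms csmooth_intros)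
  moreover have "euler (0 + (2 + (c - 1))) (\<lambda>x y. 2 * (\<Sum>r\<in>UNIV. G r x y * dy r f x y))"
    by (rule euler_mult[OF euler_const], rule euler_sum, rule euler_mult)
      (intro euler_G euler_dy assms csmooth_intros G)+
  ultimately show ?thesis unfolding spray_deriv_def[abs_def]
    by (intro euler_diff csmooth_intros assms G) (simp_all add: algebra_simps)
qed

lemma euler_riemann: "euler 2 (riemann G i k)"
proof -
  have N: "euler 1 (dy k (G i))" for i k using euler_dy[OF euler_G G, of k i] by simp
  have "euler (0 + 2) (\<lambda>x y. 2 * dx k (G i) x y)"
    by (intro euler_mult euler_const euler_dx euler_G G csmooth_intros)
  moreover have "euler (1 + 1) (spray_deriv (dy k (G i)))"
    by (intro euler_spray_deriv N csmooth_intros G)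
  moreover have "euler (1 + 1) (\<lambda>x y. \<Sum>m\<in>UNIV. dy m (G i) x y * dy k (G m) x y)"
    by (intro euler_sum euler_mult N csmooth_intros G)
  ultimately show ?thesis unfolding riemann_eq[abs_def]
    by (intro euler_diff csmooth_intros csmooth_spray_deriv G) simp_all
qed

text \<open>After contraction with \<open>y\<close> every term is expressed by y^k d/dx^k of G^i and
  by G^m G^i_{.m}, and the coefficients add up to zero. The spray derivative is handled by applying
  the spray to Euler's relation y^k G^i_{.k} = 2 G^i.\<close>

lemma riemann_snd:
  assumes xy: "(x, y) \<in> S"
  shows "(\<Sum>k\<in>UNIV. riemann G i k x y * y $ k) = 0"
proof -
  have 1: "(\<Sum>k\<in>UNIV. y $ k * spray_deriv (dy k (G i)) x y) =
      2 * spray_deriv (G i) x y + 2 * (\<Sum>k\<in>UNIV. G k x y * dy k (G i) x y)"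
  proof -
    have "spray_deriv (\<lambda>x y. \<Sum>k\<in>UNIV. y $ k * dy k (G i) x y) x y = spray_deriv (\<lambda>x y. 2 * G i x y) x y"
      by (rule spray_deriv_cong[OF xy]) (rule eulerD[OF euler_G])
    then show ?thesis using xy
      by (simp add: spray_deriv_sum spray_deriv_mult spray_deriv_snd csmooth_intros G sum.distrib sum_subtractf sum_distrib_left sum_negf algebra_simps)
  qed
  have 2: "(\<Sum>k\<in>UNIV. y $ k * (\<Sum>m\<in>UNIV. dy m (G i) x y * dy k (G m) x y)) =
      2 * (\<Sum>m\<in>UNIV. G m x y * dy m (G i) x y)"
  proof -
    have "(\<Sum>k\<in>UNIV. y $ k * (\<Sum>m\<in>UNIV. dy m (G i) x y * dy k (G m) x y)) =
        (\<Sum>m\<in>UNIV. \<Sum>k\<in>UNIV. dy m (G i) x y * (y $ k * dy k (G m) x y))"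
      unfolding sum_distrib_left by (subst sum.swap) (simp add: mult_ac)
    also have "\<dots> = (\<Sum>m\<in>UNIV. dy m (G i) x y * (2 * G m x y))"
      unfolding sum_distrib_left[symmetric] by (simp add: eulerD[OF euler_G xy])
    finally show ?thesis by (simp add: sum_distrib_left mult_ac)
  qed
  have "(\<Sum>k\<in>UNIV. riemann G i k x y * y $ k) = 2 * (\<Sum>k\<in>UNIV. y $ k * dx k (G i) x y)
      - (\<Sum>k\<in>UNIV. y $ k * spray_deriv (dy k (G i)) x y)
      - (\<Sum>k\<in>UNIV. y $ k * (\<Sum>m\<in>UNIV. dy m (G i) x y * dy k (G m) x y))"
    by (simp add: riemann_eq algebra_simps sum.distrib sum_subtractf sum_distrib_left)
  then show ?thesis by (simp add: 1 2 spray_deriv_def[of "G i"])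
qed

section \<open>The Weyl curvature and its second derivatives\<close>

definition weyl_tau :: "'n \<Rightarrow> 'n coord_fun" where
  "weyl_tau k x y = - (1 / (real CARD('n) + 1) * (\<Sum>m\<in>UNIV. dy m (weyl_A G m k) x y))"

lemma csmooth_ricci: "csmooth S (ricci_scalar G)"
  unfolding ricci_scalar_def[abs_def] by (intro csmooth_intros csmooth_riemann)

lemma csmooth_weyl_A: "csmooth S (weyl_A G i k)"
  unfolding weyl_A_def[abs_def] by (intro csmooth_intros csmooth_riemann csmooth_ricci)

lemma csmooth_weyl_tau: "csmooth S (weyl_tau k)"
  unfolding weyl_tau_def[abs_def] by (intro csmooth_intros csmooth_weyl_A)

lemma weyl_eq: "weyl G i k x y =
    riemann G i k x y - ricci_scalar G x y * (if i = k then 1 else 0) + weyl_tau k x y * y $ i"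
  by (simp add: weyl_def weyl_A_def weyl_tau_def)

lemma csmooth_weyl: "csmooth S (weyl G i k)"
  unfolding weyl_eq[abs_def] by (intro csmooth_intros csmooth_riemann csmooth_ricci csmooth_weyl_tau)

lemma euler_ricci: "euler 2 (ricci_scalar G)"
proof -
  have "euler (0 + 2) (ricci_scalar G)"
    unfolding ricci_scalar_def[abs_def]
    by (intro euler_mult euler_const euler_sum euler_riemann csmooth_intros csmooth_riemann)
  then show ?thesis by simp
qed

lemma euler_weyl_A: "euler 2 (weyl_A G i k)"
proof -
  have "euler (2 + 0) (\<lambda>x y. ricci_scalar G x y * (if i = k then 1 else 0))"
    by (intro euler_mult euler_const euler_ricci csmooth_intros csmooth_ricci)
  then show ?thesis
    unfolding weyl_A_def[abs_def]
    by (intro euler_diff euler_riemann csmooth_intros csmooth_ricci csmooth_riemann) simp_all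
qed

lemma euler_weyl_tau: "euler 1 (weyl_tau k)"
proof -
  have "euler (0 + (2 - 1)) (\<lambda>x y. - (1 / (real CARD('n) + 1)) * (\<Sum>m\<in>UNIV. dy m (weyl_A G m k) x y))"
    by (intro euler_mult euler_const euler_sum euler_dy euler_weyl_A csmooth_intros csmooth_weyl_A)
  then show ?thesis unfolding weyl_tau_def[abs_def] by simp
qed

lemma euler_weyl: "euler 2 (weyl G i k)"
proof -
  have "euler (1 + 1) (\<lambda>x y. weyl_tau k x y * y $ i)"
    by (intro euler_mult euler_snd euler_weyl_tau csmooth_intros csmooth_weyl_tau)
  then have "euler 2 (\<lambda>x y. weyl_A G i k x y + weyl_tau k x y * y $ i)"
    by (intro euler_add euler_weyl_A csmooth_intros csmooth_weyl_A csmooth_weyl_tau) simp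
  then show ?thesis unfolding weyl_eq[abs_def] weyl_A_def[abs_def] .
qed

lemma dy_dy_weyl:
  assumes xy: "(x, y) \<in> S"
  shows "dy j (dy l (weyl G i k)) x y = dy j (dy l (riemann G i k)) x y
     - dy j (dy l (ricci_scalar G)) x y * (if i = k then 1 else 0)
     + dy j (dy l (weyl_tau k)) x y * y $ i + dy l (weyl_tau k) x y * (if i = j then 1 else 0)
     + dy j (weyl_tau k) x y * (if i = l then 1 else 0)"
proof -
  have "dy l (weyl G i k) x y = dy l (riemann G i k) x y - dy l (ricci_scalar G) x y * (if i = k then 1 else 0)
     + (dy l (weyl_tau k) x y * y $ i + weyl_tau k x y * (if i = l then 1 else 0))" if "(x, y) \<in> S" for x y
    unfolding weyl_eq[abs_def] using that
    by (simp add: d_simps csmooth_riemann csmooth_ricci csmooth_weyl_tau)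
  then show ?thesis
    by (subst dy_cong[OF xy, of "dy l (weyl G i k)"])
      (use xy in \<open>auto simp: d_simps csmooth_riemann csmooth_ricci csmooth_weyl_tau\<close>)
qed

section \<open>The Douglas tensor and its derivative along the spray\<close>

definition mean_trace :: "'n coord_fun" where
  "mean_trace x y = 1 / (real CARD('n) + 1) * (\<Sum>m\<in>UNIV. dy m (G m) x y)"

lemma csmooth_mean_trace: "csmooth S mean_trace"
  unfolding mean_trace_def[abs_def] by (intro csmooth_intros G)

text \<open>Since \<open>y^i\<close> is linear in \<open>y\<close>, the Leibniz rule leaves at most
  one of the three derivatives on it: none gives the last term, one gives the three Kronecker terms.
  The sign pattern \<open>+ -\<close> fits the shape required by
  \<open>hcov3_0_add_snd\<close>.\<close>

lemma douglas_eq: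
  assumes xy: "(x, y) \<in> S"
  shows "douglas G j i k l x y = berwald j i k l x y
    - (dy j (dy k mean_trace) x y * (if i = l then 1 else 0)
      + dy j (dy l mean_trace) x y * (if i = k then 1 else 0)
      + dy k (dy l mean_trace) x y * (if i = j then 1 else 0))
    + - dy j (dy k (dy l mean_trace)) x y * y $ i"
proof -
  let ?t = mean_trace
  have 1: "dy l (\<lambda>x y. G i x y - ?t x y * y $ i) x y =
      dy l (G i) x y - (dy l ?t x y * y $ i + ?t x y * (if i = l then 1 else 0))" if "(x, y) \<in> S" for x y
    using that by (simp add: d_simps G csmooth_mean_trace)
  have 2: "dy k (dy l (\<lambda>x y. G i x y - ?t x y * y $ i)) x y = dy k (dy l (G i)) x y
     - (dy k (dy l ?t) x y * y $ i + dy l ?t x y * (if i = k then 1 else 0)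
       + dy k ?t x y * (if i = l then 1 else 0))" if "(x, y) \<in> S" for x y
    by (subst dy_cong[OF that 1]) (use that in \<open>auto simp: d_simps G csmooth_mean_trace\<close>)
  have "dy j (dy k (dy l (\<lambda>x y. G i x y - ?t x y * y $ i))) x y = dy j (dy k (dy l (G i))) x y
     - (dy j (dy k (dy l ?t)) x y * y $ i + dy k (dy l ?t) x y * (if i = j then 1 else 0)
       + dy j (dy l ?t) x y * (if i = k then 1 else 0) + dy j (dy k ?t) x y * (if i = l then 1 else 0))"
    by (subst dy_cong[OF xy 2]) (use xy in \<open>auto simp: d_simps G csmooth_mean_trace\<close>)
  moreover have "douglas G j i k l = dy j (dy k (dy l (\<lambda>x y. G i x y - ?t x y * y $ i)))"
    by (simp only: douglas_def mean_trace_def)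
  ultimately show ?thesis
    by (simp add: berwald_def)
qed

lemma csmooth_douglas: "csmooth S (douglas G j i k l)"
  unfolding douglas_def by (intro csmooth_intros G)

text \<open>Both \<open>y^i\<close> and the Kronecker delta are parallel, so \<open>|_0\<close> acts
  only on their coefficients, which are the third and the second derivatives of
  \<open>mean_trace\<close>.\<close>

lemma douglas_tilde_eq:
  assumes xy: "(x, y) \<in> S"
  defines "e \<equiv> \<lambda>j k. dy j (dy k mean_trace)"
  shows "douglas_tilde G j i k l x y = hcov3_0 G berwald j i k l x y
    - (cov2 e j k x y * (if i = l then 1 else 0) + cov2 e j l x y * (if i = k then 1 else 0)
      + cov2 e k l x y * (if i = j then 1 else 0))
    + cov3 (\<lambda>j k l x y. - dy j (dy k (dy l mean_trace)) x y) j k l x y * y $ i"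
proof -
  note c = csmooth_intros csmooth_mean_trace csmooth_berwald
  have e: "csmooth S (e j k)" for j k unfolding e_def by (intro c)
  let ?E = "\<lambda>j i k l x y. e j k x y * (if i = l then 1 else 0)
      + e j l x y * (if i = k then 1 else 0) + e k l x y * (if i = j then 1 else 0)"
  have "douglas_tilde G j i k l x y = hcov3_0 G (\<lambda>j i k l x y. (berwald j i k l x y - ?E j i k l x y)
      + - dy j (dy k (dy l mean_trace)) x y * y $ i) j i k l x y"
    unfolding douglas_tilde_def by (rule hcov3_0_cong[OF xy]) (simp add: douglas_eq e_def)
  also have "\<dots> = hcov3_0 G (\<lambda>j i k l x y. berwald j i k l x y - ?E j i k l x y) j i k l x y
      + cov3 (\<lambda>j k l x y. - dy j (dy k (dy l mean_trace)) x y) j k l x y * y $ i"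
    by (rule hcov3_0_add_snd) (intro c e xy)+
  also have "hcov3_0 G (\<lambda>j i k l x y. berwald j i k l x y - ?E j i k l x y) j i k l x y =
      hcov3_0 G berwald j i k l x y - hcov3_0 G ?E j i k l x y"
    by (rule hcov3_0_diff) (intro c e xy)+
  also have "hcov3_0 G ?E j i k l x y = cov2 e j k x y * (if i = l then 1 else 0) + cov2 e j l x y * (if i = k then 1 else 0)
      + cov2 e k l x y * (if i = j then 1 else 0)"
    by (rule hcov3_0_delta[OF e xy])
  finally show ?thesis .
qed

text \<open>Contraction of the upper with the last lower index commutes with \<open>|_0\<close>,
  because the two connection terms of this pair agree after exchanging the summation
  variables.\<close>

lemma hcov3_0_trace:
  assumes T: "\<And>j i k l. csmooth S (T j i k l)" and xy: "(x, y) \<in> S"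
  shows "(\<Sum>i\<in>UNIV. hcov3_0 G T j i k i x y) = cov2 (\<lambda>j k x y. \<Sum>i\<in>UNIV. T j i k i x y) j k x y"
proof -
  have 1: "(\<Sum>i\<in>UNIV. \<Sum>r\<in>UNIV. T j r k i x y * dy r (G i) x y) = (\<Sum>i\<in>UNIV. \<Sum>r\<in>UNIV. T j i k r x y * dy i (G r) x y)"
    by (rule sum.swap)
  have 2: "(\<Sum>i\<in>UNIV. \<Sum>r\<in>UNIV. f i r * g r) = (\<Sum>r\<in>UNIV. (\<Sum>i\<in>UNIV. f i r) * g r)"
    for f :: "'n \<Rightarrow> 'n \<Rightarrow> real" and g
    by (subst sum.swap) (simp add: sum_distrib_right)
  show ?thesis using assms 1
    by (simp add: hcov3_0_eq cov2_def sum.distrib sum_subtractf spray_deriv_sum 2)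
qed

text \<open>The coefficient Q of the comparison: the first bracket collects the \<open>y^i\<close>
  terms in the cyclic sum of second derivatives of W, and the \<open>y^i\<close> coefficient of
  \<open>douglas_tilde\<close> is subtracted from them.\<close>

definition weyl_douglas_diff :: "'n \<Rightarrow> 'n \<Rightarrow> 'n \<Rightarrow> 'n coord_fun" where
  "weyl_douglas_diff j k l x y = - (1/3) * (dy j (dy k (weyl_tau l)) x y + dy j (dy l (weyl_tau k)) x y
     + dy k (dy l (weyl_tau j)) x y)
   - cov3 (\<lambda>j k l x y. - dy j (dy k (dy l mean_trace)) x y) j k l x y"

lemma csmooth_cov3: "(\<And>j k l. csmooth S (q j k l)) \<Longrightarrow> csmooth S (cov3 q j k l)"
  unfolding cov3_def[abs_def] by (intro csmooth_intros csmooth_spray_deriv G)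

lemma csmooth_weyl_douglas_diff: "csmooth S (weyl_douglas_diff j k l)"
  unfolding weyl_douglas_diff_def[abs_def]
  by (intro csmooth_intros csmooth_cov3 csmooth_weyl_tau csmooth_mean_trace)

lemma csmooth_douglas_tilde: "csmooth S (douglas_tilde G j i k l)"
  unfolding douglas_tilde_def by (intro csmooth_hcov3_0 csmooth_douglas)

lemma csmooth_weyl_tilde: "csmooth S (weyl_tilde G j i k l)"
  unfolding weyl_tilde_def[abs_def] weyl4_def by (intro csmooth_intros csmooth_weyl)

section \<open>Trace identities in dimension at least two\<close>

context
  assumes dim: "CARD('n) \<ge> 2"
begin

text \<open>Here the dimension enters: n - 1 is nonzero, so the trace of the curvature can be
  recovered from \<open>ricci_scalar\<close>.\<close>

lemma sum_riemann_diag: "(\<Sum>m\<in>UNIV. riemann G m m x y) = (real CARD('n) - 1) * ricci_scalar G x y"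
  using dim by (simp add: ricci_scalar_def)

text \<open>From R^m_k y^k = 0 follows A^m_k y^k = - R y^m. Differentiating by y^m and summing gives
  -2R by homogeneity, -nR from the divergence of \<open>y\<close> and +R from the trace of A, hence
  -(n + 1) R, which the factor -1/(n + 1) in \<open>weyl_tau\<close> turns into R.\<close>

lemma weyl_tau_snd:
  assumes xy: "(x, y) \<in> S"
  shows "(\<Sum>k\<in>UNIV. weyl_tau k x y * y $ k) = ricci_scalar G x y"
proof -
  let ?R = "ricci_scalar G" and ?n = "real CARD('n)"
  have A: "(\<Sum>k\<in>UNIV. y $ k * weyl_A G m k x y) = - ?R x y * y $ m" if "(x, y) \<in> S" for x y m
    using riemann_snd[OF that, of m]
    by (simp add: weyl_A_def right_diff_distrib sum_subtractf mult.commute if_distrib[of "\<lambda>a. _ * a"] cong: if_cong)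
  have "(\<Sum>k\<in>UNIV. y $ k * (\<Sum>m\<in>UNIV. dy m (weyl_A G m k) x y)) =
      (\<Sum>m\<in>UNIV. \<Sum>k\<in>UNIV. y $ k * dy m (weyl_A G m k) x y)"
    unfolding sum_distrib_left by (rule sum.swap)
  also have "\<dots> = (\<Sum>m\<in>UNIV. dy m (\<lambda>x y. - ?R x y * y $ m) x y - weyl_A G m m x y)"
  proof (rule sum.cong[OF refl])
    fix m
    show "(\<Sum>k\<in>UNIV. y $ k * dy m (weyl_A G m k) x y) =
        dy m (\<lambda>x y. - ?R x y * y $ m) x y - weyl_A G m m x y"
      unfolding sum_snd_dy[OF csmooth_weyl_A xy]
      by (subst dy_cong[OF xy A]) simp_all
  qed
  also have "\<dots> = - (\<Sum>m\<in>UNIV. y $ m * dy m ?R x y) - ?n * ?R x y - (\<Sum>m\<in>UNIV. weyl_A G m m x y)"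
    using xy by (simp add: d_simps csmooth_ricci sum.distrib sum_subtractf sum_negf algebra_simps)
  also have "\<dots> = - (?n + 1) * ?R x y"
    by (simp add: eulerD[OF euler_ricci xy] weyl_A_def sum_subtractf sum_riemann_diag algebra_simps)
  finally have "(\<Sum>k\<in>UNIV. y $ k * (\<Sum>m\<in>UNIV. dy m (weyl_A G m k) x y)) = - (?n + 1) * ?R x y" .
  moreover have "(\<Sum>k\<in>UNIV. weyl_tau k x y * y $ k) =
      - (1 / (?n + 1)) * (\<Sum>k\<in>UNIV. y $ k * (\<Sum>m\<in>UNIV. dy m (weyl_A G m k) x y))"
    by (simp add: weyl_tau_def sum_distrib_left mult_ac sum_negf)
  moreover have cancel: "- (1 / c) * (- c * r) = r" if "c \<noteq> 0" for c r :: real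
    using that by simp
  moreover have "?n + 1 \<noteq> 0" by (simp add: add_pos_nonneg)
  ultimately show ?thesis by (simp only: cancel)
qed

text \<open>The curvature itself is annihilated by \<open>y\<close>, and -R y^i cancels against the
  contraction of the \<tau> term.\<close>

lemma weyl_snd:
  assumes xy: "(x, y) \<in> S"
  shows "(\<Sum>k\<in>UNIV. y $ k * weyl G i k x y) = 0"
proof -
  have "(\<Sum>k\<in>UNIV. y $ k * weyl G i k x y) = (\<Sum>k\<in>UNIV. riemann G i k x y * y $ k)
     - ricci_scalar G x y * y $ i + (\<Sum>k\<in>UNIV. weyl_tau k x y * y $ k) * y $ i"
    by (simp add: weyl_eq algebra_simps sum.distrib sum_subtractf sum_distrib_left
        if_distrib[of "\<lambda>a. _ * a"] cong: if_cong)
  then show ?thesis using xy by (simp add: riemann_snd weyl_tau_snd)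
qed

text \<open>Moving y^m through three derivatives of W^i_m costs one term per derivative, and the
  remaining term vanishes because W^i_m y^m = 0. In the other half of \<open>weyl4\<close> the
  contracted index is a derivative index; two derivatives have brought the degree of W from 2 to 0,
  so Euler's relation makes that half vanish.\<close>

lemma weyl_tilde_cyclic:
  assumes xy: "(x, y) \<in> S"
  shows "weyl_tilde G j i k l x y = - (1/3) *
    (dy j (dy k (weyl G i l)) x y + dy j (dy l (weyl G i k)) x y + dy k (dy l (weyl G i j)) x y)"
proof -
  let ?W = "\<lambda>k. weyl G i k"
  note c = csmooth_intros csmooth_weyl
  have s1: "(\<Sum>m\<in>UNIV. y $ m * dy l (?W m) x y) = - ?W l x y" if "(x, y) \<in> S" for x y l
    by (subst sum_snd_dy[OF csmooth_weyl that], subst dy_cong[OF that weyl_snd]) simp_all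
  have s2: "(\<Sum>m\<in>UNIV. y $ m * dy j (dy l (?W m)) x y) = - dy j (?W l) x y - dy l (?W j) x y"
    if "(x, y) \<in> S" for x y l j
    by (subst sum_snd_dy[OF csmooth_dy[OF csmooth_weyl] that], subst dy_cong[OF that s1])
      (simp_all add: dy_minus csmooth_weyl that)
  have s3: "(\<Sum>m\<in>UNIV. y $ m * dy k (dy j (dy l (?W m))) x y) =
      - dy k (dy j (?W l)) x y - dy k (dy l (?W j)) x y - dy j (dy l (?W k)) x y"
    by (subst sum_snd_dy[OF csmooth_dy[OF csmooth_dy[OF csmooth_weyl]] xy], subst dy_cong[OF xy s2])
      (use xy in \<open>auto simp add: d_simps csmooth_weyl\<close>)
  have "euler (2 - 1 - 1) (dy k (dy j (?W l)))"
    by (intro euler_dy euler_weyl c)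
  then have e: "(\<Sum>m\<in>UNIV. y $ m * dy m (dy k (dy j (?W l))) x y) = 0"
    using eulerD[OF _ xy] by fastforce
  \<comment> \<open>The derivative index m is moved to the outermost place, where Euler's relation
    applies.\<close>
  have w: "dy k (weyl4 G j i m l) x y =
      1/3 * (dy k (dy j (dy l (?W m))) x y - dy m (dy k (dy j (?W l))) x y)" for m
  proof -
    have "weyl4 G j i m l x y = 1/3 * (dy j (dy l (?W m)) x y - dy j (dy m (?W l)) x y)"
      if "(x, y) \<in> S" for x y
      unfolding weyl4_def using that by (simp add: dy_cdivide dy_diff csmooth_diff csmooth_dy csmooth_weyl)
    then have "dy k (weyl4 G j i m l) x y =
        dy k (\<lambda>x y. 1/3 * (dy j (dy l (?W m)) x y - dy j (dy m (?W l)) x y)) x y"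
      by (rule dy_cong[OF xy])
    also have "\<dots> = 1/3 * (dy k (dy j (dy l (?W m))) x y - dy k (dy j (dy m (?W l))) x y)"
      using xy by (simp add: dy_cdivide dy_diff csmooth_diff csmooth_dy csmooth_weyl)
    also have "dy k (dy j (dy m (?W l))) x y = dy k (dy m (dy j (?W l))) x y"
      by (rule dy_cong[OF xy], rule dy_dy[OF csmooth_weyl])
    also have "\<dots> = dy m (dy k (dy j (?W l))) x y"
      by (intro dy_dy c xy)
    finally show ?thesis .
  qed
  have "weyl_tilde G j i k l x y = 1/3 * ((\<Sum>m\<in>UNIV. y $ m * dy k (dy j (dy l (?W m))) x y)
      - (\<Sum>m\<in>UNIV. y $ m * dy m (dy k (dy j (?W l))) x y))"
    by (simp add: weyl_tilde_def w right_diff_distrib sum_subtractf sum_distrib_left sum_divide_distrib)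
  then show ?thesis
    using dy_dy[OF csmooth_weyl xy] by (simp add: s3 e algebra_simps)
qed

text \<open>The cyclic identity is traced over i = l. R appears with the factor (n - 1) + 1 + 1, the
  derivatives of \<tau> and the trace of the Berwald curvature with n + 1, so the common factor
  cancels.\<close>

lemma cov2_mean_trace:
  assumes xy: "(x, y) \<in> S"
  shows "3 * cov2 (\<lambda>j k. dy j (dy k mean_trace)) j k x y =
     dy j (weyl_tau k) x y + dy k (weyl_tau j) x y - dy j (dy k (ricci_scalar G)) x y"
proof -
  let ?n = "real CARD('n)" and ?R = "ricci_scalar G"
  have b: "(\<Sum>i\<in>UNIV. berwald j i k i x y) = (?n + 1) * dy j (dy k mean_trace) x y"
    if "(x, y) \<in> S" for x y j k
  proof -
    have 1: "dy k mean_trace x y = 1 / (?n + 1) * (\<Sum>m\<in>UNIV. dy k (dy m (G m)) x y)"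
      if "(x, y) \<in> S" for x y
      unfolding mean_trace_def[abs_def] using that by (simp add: d_simps G)
    have "dy j (dy k mean_trace) x y = 1 / (?n + 1) * (\<Sum>m\<in>UNIV. berwald j m k m x y)"
      by (subst dy_cong[OF that 1]) (use that in \<open>simp_all add: d_simps G berwald_def\<close>)
    then show ?thesis by (simp add: field_simps add_pos_nonneg)
  qed
  have c2: "cov2 (\<lambda>j k x y. \<Sum>i\<in>UNIV. berwald j i k i x y) j k x y =
      (?n + 1) * cov2 (\<lambda>j k. dy j (dy k mean_trace)) j k x y"
  proof -
    have "spray_deriv (\<lambda>x y. \<Sum>i\<in>UNIV. berwald j i k i x y) x y = spray_deriv (\<lambda>x y. (?n + 1) * dy j (dy k mean_trace) x y) x y"
      by (rule spray_deriv_cong[OF xy b])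
    then show ?thesis
      unfolding cov2_def b[OF xy]
      using xy by (simp add: spray_deriv_cmult csmooth_intros csmooth_mean_trace right_diff_distrib sum_distrib_left mult.assoc)
  qed
  have ric: "(\<Sum>m\<in>UNIV. dy j (dy k (riemann G m m)) x y) = (?n - 1) * dy j (dy k ?R) x y"
  proof -
    have "(\<Sum>m\<in>UNIV. dy j (dy k (riemann G m m)) x y) =
        dy j (\<lambda>x y. \<Sum>m\<in>UNIV. dy k (riemann G m m) x y) x y"
      using xy by (simp add: d_simps csmooth_riemann)
    also have "\<dots> = dy j (dy k (\<lambda>x y. \<Sum>m\<in>UNIV. riemann G m m x y)) x y"
      by (rule dy_cong[OF xy]) (simp add: d_simps csmooth_riemann)
    also have "\<dots> = dy j (\<lambda>x y. (?n - 1) * dy k ?R x y) x y"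
      unfolding sum_riemann_diag by (rule dy_cong[OF xy]) (simp add: dy_cmult csmooth_ricci)
    also have "\<dots> = (?n - 1) * dy j (dy k ?R) x y"
      using xy by (simp add: dy_cmult csmooth_intros csmooth_ricci)
    finally show ?thesis .
  qed
  \<comment> \<open>The definition of \<tau> as a divergence, read backwards: the divergence of the
    Riemann curvature is expressed by R and \<tau>.\<close>
  have tau: "(\<Sum>m\<in>UNIV. dy j (dy m (riemann G m k)) x y) = dy j (dy k ?R) x y - (?n + 1) * dy j (weyl_tau k) x y" for j k
  proof -
    have "dy m (weyl_A G m k) x y = dy m (riemann G m k) x y - dy m ?R x y * (if m = k then 1 else 0)" 
      if "(x, y) \<in> S" for x y m
      unfolding weyl_A_def[abs_def] using that by (simp add: d_simps csmooth_riemann csmooth_ricci)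
    then have "(\<Sum>m\<in>UNIV. dy m (weyl_A G m k) x y) = (\<Sum>m\<in>UNIV. dy m (riemann G m k) x y) - dy k ?R x y"
      if "(x, y) \<in> S" for x y
      using that by (simp add: sum_subtractf if_distrib[of "\<lambda>a. _ * a"] cong: if_cong)
    moreover have "- (?n + 1) * weyl_tau k x y = (\<Sum>m\<in>UNIV. dy m (weyl_A G m k) x y)" for x y
    proof -
      have cancel: "- c * - (1 / c * r) = r" if "c \<noteq> 0" for c r :: real using that by simp
      have "?n + 1 \<noteq> 0" by (simp add: add_pos_nonneg)
      then show ?thesis unfolding weyl_tau_def by (rule cancel)
    qed
    ultimately have "- (?n + 1) * weyl_tau k x y = (\<Sum>m\<in>UNIV. dy m (riemann G m k) x y) - dy k ?R x y"
      if "(x, y) \<in> S" for x y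
      using that by simp
    then have "dy j (\<lambda>x y. - (?n + 1) * weyl_tau k x y) x y = dy j (\<lambda>x y. (\<Sum>m\<in>UNIV. dy m (riemann G m k) x y) - dy k ?R x y) x y"
      by (rule dy_cong[OF xy])
    then show ?thesis using xy
      by (simp only: dy_cmult csmooth_weyl_tau) (simp add: d_simps csmooth_riemann csmooth_ricci algebra_simps)
  qed
  have "(\<Sum>i\<in>UNIV. dy j (dy k (riemann G i i)) x y + dy j (dy i (riemann G i k)) x y + dy k (dy i (riemann G i j)) x y)
    = (\<Sum>i\<in>UNIV. - 3 * hcov3_0 G berwald j i k i x y)"
    by (rule sum.cong[OF refl cyclic_riemann[OF xy]])
  also have "\<dots> = - 3 * ((?n + 1) * cov2 (\<lambda>j k. dy j (dy k mean_trace)) j k x y)"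
    by (simp add: sum_distrib_left[symmetric] hcov3_0_trace[OF csmooth_berwald xy] c2 sum_negf)
  finally have "(?n - 1) * dy j (dy k ?R) x y + (dy j (dy k ?R) x y - (?n + 1) * dy j (weyl_tau k) x y)
      + (dy k (dy j ?R) x y - (?n + 1) * dy k (weyl_tau j) x y) =
      - 3 * ((?n + 1) * cov2 (\<lambda>j k. dy j (dy k mean_trace)) j k x y)"
    by (simp add: sum.distrib ric tau)
  then have "(?n + 1) * (3 * cov2 (\<lambda>j k. dy j (dy k mean_trace)) j k x y) =
      (?n + 1) * (dy j (weyl_tau k) x y + dy k (weyl_tau j) x y - dy j (dy k ?R) x y)"
    using dy_dy[OF csmooth_ricci xy, of j k] by (simp add: algebra_simps)
  then show ?thesis by (simp add: add_pos_nonneg)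
qed

text \<open>By \<open>cov2_mean_trace\<close> the coefficients of the Kronecker deltas agree on both
  sides; at \<delta>^i_l the common value is -1/3 (\<tau>_{k.j} + \<tau>_{j.k} - R_{.j.k}). The
  cyclic identity matches the curvature terms, so only multiples of \<open>y^i\<close> survive in
  the difference.\<close>

lemma weyl_tilde_eq:
  assumes xy: "(x, y) \<in> S"
  shows "weyl_tilde G j i k l x y = douglas_tilde G j i k l x y + weyl_douglas_diff j k l x y * y $ i"
proof -
  have c: "cov2 (\<lambda>j k. dy j (dy k mean_trace)) j k x y =
     1/3 * (dy j (weyl_tau k) x y + dy k (weyl_tau j) x y - dy j (dy k (ricci_scalar G)) x y)" for j k
    using cov2_mean_trace[OF xy, of j k] by simp
  have h: "hcov3_0 G berwald j i k l x y = - (1/3) * (dy j (dy k (riemann G i l)) x y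
      + dy j (dy l (riemann G i k)) x y + dy k (dy l (riemann G i j)) x y)"
    unfolding cyclic_riemann[OF xy] by simp
  show ?thesis
    unfolding weyl_tilde_cyclic[OF xy] dy_dy_weyl[OF xy] douglas_tilde_eq[OF xy] weyl_douglas_diff_def c h
    by (simp add: algebra_simps add_divide_distrib diff_divide_distrib)
qed

lemma hcov3_0_weyl_tilde:
  assumes xy: "(x, y) \<in> S"
  shows "hcov3_0 G (weyl_tilde G) j i k l x y =
    hcov3_0 G (douglas_tilde G) j i k l x y + cov3 weyl_douglas_diff j k l x y * y $ i"
  by (subst hcov3_0_cong[OF xy weyl_tilde_eq], assumption)
    (rule hcov3_0_add_snd[OF csmooth_douglas_tilde csmooth_weyl_douglas_diff xy])

end

end

section \<open>Finsler metrics in coordinates\<close>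

lemma sum_Basis_pair:
  fixes h :: "(real^'n::finite) \<times> (real^'n) \<Rightarrow> real"
  shows "(\<Sum>b\<in>Basis. h b) = (\<Sum>i\<in>UNIV. h (axis i 1, 0)) + (\<Sum>i\<in>UNIV. h (0, axis i 1))"
proof -
  have B: "(Basis :: (real^'n) set) = (\<lambda>i. axis i 1) ` UNIV"
    by (auto simp: Basis_vec_def)
  have inj: "inj (\<lambda>i::'n. axis i (1::real))"
    by (auto simp: inj_on_def axis_eq_axis)
  have "(Basis :: ((real^'n) \<times> (real^'n)) set) =
      (\<lambda>i. (axis i 1, 0)) ` UNIV \<union> (\<lambda>i. (0, axis i 1)) ` UNIV"
    unfolding Basis_prod_def B by auto
  then have "sum h Basis = sum h ((\<lambda>i. (axis i 1, 0)) ` UNIV \<union> (\<lambda>i. (0, axis i 1)) ` UNIV)"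
    by (rule arg_cong)
  also have "\<dots> = sum h ((\<lambda>i. (axis i 1, 0)) ` UNIV) + sum h ((\<lambda>i. (0, axis i 1)) ` UNIV)"
    by (rule sum.union_disjoint) (auto simp: axis_eq_0_iff)
  also have "\<dots> = (\<Sum>i\<in>UNIV. h (axis i 1, 0)) + (\<Sum>i\<in>UNIV. h (0, axis i 1))"
    using inj by (simp add: sum.reindex inj_on_def)
  finally show ?thesis .
qed

lemma csmooth_pair_component:
  fixes a b :: "real^'n::finite \<Rightarrow> real^'n \<Rightarrow> real^'n"
  assumes "\<And>i. csmooth S (\<lambda>x y. a x y $ i)" "\<And>i. csmooth S (\<lambda>x y. b x y $ i)" "e \<in> Basis"
  shows "csmooth S (\<lambda>x y. (a x y, b x y) \<bullet> e)"
  using assms by (auto simp: Basis_prod_def Basis_vec_def inner_axis)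

lemma csmooth_compose:
  fixes f :: "'n::finite coord_fun" and a b :: "real^'n \<Rightarrow> real^'n \<Rightarrow> real^'n"
  assumes "open S" "csmooth S' f" "\<And>i. csmooth S (\<lambda>x y. a x y $ i)" "\<And>i. csmooth S (\<lambda>x y. b x y $ i)"
    and "\<And>x y. (x, y) \<in> S \<Longrightarrow> (a x y, b x y) \<in> S'"
  shows "csmooth S (\<lambda>x y. f (a x y) (b x y))"
proof -
  have "Ck_on k S (\<lambda>z. case_prod f (case z of (x, y) \<Rightarrow> (a x y, b x y)))" for k
  proof (rule Ck_on_compose[where f = "case_prod f" and T = S', OF assms(1)])
    show "Ck_on k S' (case_prod f)" using assms(2) by (simp add: csmooth_def smooth_on_def)
    show "Ck_on k S (\<lambda>z. (case z of (x, y) \<Rightarrow> (a x y, b x y)) \<bullet> e)" if "e \<in> Basis" for e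
      using csmooth_pair_component[OF assms(3,4) that]
      by (simp add: csmooth_def smooth_on_def case_prod_unfold)
    show "(\<lambda>(x, y). (a x y, b x y)) ` S \<subseteq> S'" using assms(5) by auto
  qed
  then show ?thesis using assms(1) by (simp add: csmooth_def smooth_on_def case_prod_unfold)
qed

lemma frechet_derivative_compose_pair:
  fixes f :: "'n::finite coord_fun" and a b :: "real^'n \<Rightarrow> real^'n \<Rightarrow> real^'n"
  assumes "csmooth S' f" "\<And>i. csmooth S (\<lambda>x y. a x y $ i)" "\<And>i. csmooth S (\<lambda>x y. b x y $ i)"
    and "\<And>x y. (x, y) \<in> S \<Longrightarrow> (a x y, b x y) \<in> S'" and xy: "(x, y) \<in> S"
  shows "frechet_derivative (\<lambda>(x, y). f (a x y) (b x y)) (at (x, y)) v =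
    (\<Sum>i\<in>UNIV. frechet_derivative (\<lambda>(x, y). a x y $ i) (at (x, y)) v * dx i f (a x y) (b x y)) +
    (\<Sum>i\<in>UNIV. frechet_derivative (\<lambda>(x, y). b x y $ i) (at (x, y)) v * dy i f (a x y) (b x y))"
proof -
  let ?g = "\<lambda>z. case z of (x, y) \<Rightarrow> (a x y, b x y)"
  have S': "(a x y, b x y) \<in> S'" using assms(4) xy by simp
  have "((\<lambda>z. case_prod f (?g z)) has_derivative (\<lambda>v. \<Sum>e\<in>Basis.
      frechet_derivative (\<lambda>z. ?g z \<bullet> e) (at (x, y)) v * frechet_derivative (case_prod f) (at (?g (x, y))) e)) (at (x, y))"
  proof (rule has_derivative_compose_Basis)
    show "case_prod f differentiable (at (?g (x, y)))"
      using csmooth_has_derivative[OF assms(1) S'] by (auto simp: differentiable_def)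
    show "(\<lambda>z. ?g z \<bullet> e) differentiable (at (x, y))" if "e \<in> Basis" for e
      using csmooth_has_derivative[OF csmooth_pair_component[OF assms(2,3) that] xy]
      by (auto simp: differentiable_def case_prod_unfold)
  qed
  moreover have "(\<lambda>z. case_prod f (?g z)) = (\<lambda>(x, y). f (a x y) (b x y))" by auto
  ultimately have "frechet_derivative (\<lambda>(x, y). f (a x y) (b x y)) (at (x, y)) = (\<lambda>v. \<Sum>e\<in>Basis.
      frechet_derivative (\<lambda>z. ?g z \<bullet> e) (at (x, y)) v * frechet_derivative (case_prod f) (at (a x y, b x y)) e)"
    using frechet_derivative_at by fastforce
  then show ?thesis
    by (simp add: sum_Basis_pair dx_eq[OF assms(1) S'] dy_eq[OF assms(1) S'] case_prod_unfold inner_axis)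
qed

lemma d_compose:
  fixes f :: "'n::finite coord_fun" and a b :: "real^'n \<Rightarrow> real^'n \<Rightarrow> real^'n"
  assumes "csmooth S' f" "\<And>i. csmooth S (\<lambda>x y. a x y $ i)" "\<And>i. csmooth S (\<lambda>x y. b x y $ i)"
    and "\<And>x y. (x, y) \<in> S \<Longrightarrow> (a x y, b x y) \<in> S'" and xy: "(x, y) \<in> S"
  shows "dx k (\<lambda>x y. f (a x y) (b x y)) x y =
      (\<Sum>i\<in>UNIV. dx k (\<lambda>x y. a x y $ i) x y * dx i f (a x y) (b x y)) +
      (\<Sum>i\<in>UNIV. dx k (\<lambda>x y. b x y $ i) x y * dy i f (a x y) (b x y))"
    and "dy k (\<lambda>x y. f (a x y) (b x y)) x y =
      (\<Sum>i\<in>UNIV. dy k (\<lambda>x y. a x y $ i) x y * dx i f (a x y) (b x y)) +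
      (\<Sum>i\<in>UNIV. dy k (\<lambda>x y. b x y $ i) x y * dy i f (a x y) (b x y))"
proof -
  have c: "csmooth S (\<lambda>x y. f (a x y) (b x y))"
    by (rule csmooth_compose[OF csmooth_open[OF assms(2)] assms(1-4)])
  show "dx k (\<lambda>x y. f (a x y) (b x y)) x y =
      (\<Sum>i\<in>UNIV. dx k (\<lambda>x y. a x y $ i) x y * dx i f (a x y) (b x y)) +
      (\<Sum>i\<in>UNIV. dx k (\<lambda>x y. b x y $ i) x y * dy i f (a x y) (b x y))"
    unfolding dx_eq[OF c xy] dx_eq[OF assms(2) xy] dx_eq[OF assms(3) xy]
    by (rule frechet_derivative_compose_pair[OF assms])
  show "dy k (\<lambda>x y. f (a x y) (b x y)) x y =
      (\<Sum>i\<in>UNIV. dy k (\<lambda>x y. a x y $ i) x y * dx i f (a x y) (b x y)) +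
      (\<Sum>i\<in>UNIV. dy k (\<lambda>x y. b x y $ i) x y * dy i f (a x y) (b x y))"
    unfolding dy_eq[OF c xy] dy_eq[OF assms(2) xy] dy_eq[OF assms(3) xy]
    by (rule frechet_derivative_compose_pair[OF assms])
qed

text \<open>What a Finsler metric provides in one chart. The set \<open>S\<close> is an arbitrary
  open set so that the same data can be restricted to chart overlaps.\<close>

locale finsler_coords = coords S for S :: "((real^'n::finite) \<times> (real^'n)) set" +
  fixes f :: "'n coord_fun"
  assumes f: "csmooth S f"
    and euler_f: "euler 1 f"
    and posdef: "(x, y) \<in> S \<Longrightarrow> v \<noteq> 0 \<Longrightarrow> 0 < v \<bullet> (fund_tensor f x y *v v)"
begin

text \<open>The Euler-Lagrange expression of F^2 without its acceleration term; raising the index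
  and dividing by 4 gives the spray.\<close>

definition euler_lagrange :: "'n \<Rightarrow> 'n coord_fun" where
  "euler_lagrange l x y = (\<Sum>k\<in>UNIV. dx k (dy l (sq f)) x y * y $ k) - dx l (sq f) x y"

lemma csmooth_sq: "csmooth S (sq f)"
  unfolding sq_def[abs_def] power2_eq_square by (intro csmooth_intros f)

lemma csmooth_euler_lagrange: "csmooth S (euler_lagrange l)"
  unfolding euler_lagrange_def[abs_def] by (intro csmooth_intros csmooth_sq)

lemma csmooth_fund_tensor: "csmooth S (\<lambda>x y. fund_tensor f x y $ i $ j)"
  unfolding fund_tensor_def vec_lambda_beta by (intro csmooth_intros csmooth_sq)

text \<open>Serves to cancel the fundamental tensor: identities for the spray are verified with the
  index lowered, where no derivative of \<open>matrix_inv\<close> has to be computed.\<close>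

lemma fund_tensor_nondegenerate:
  assumes "(x, y) \<in> S" "\<And>i. (\<Sum>j\<in>UNIV. fund_tensor f x y $ i $ j * X j) = 0"
  shows "X j = 0"
proof -
  let ?v = "\<chi> j. X j"
  have "fund_tensor f x y *v ?v = 0"
    by (simp add: vec_eq_iff matrix_vector_mult_def assms(2))
  then have "?v = 0" using posdef[OF assms(1), of ?v] by auto
  then show ?thesis by (simp add: vec_eq_iff)
qed

lemma invertible_fund_tensor: 
  assumes "(x, y) \<in> S"
  shows "invertible (fund_tensor f x y)"
  unfolding invertible_left_inverse matrix_left_invertible_ker
proof (intro allI impI)
  fix v assume "fund_tensor f x y *v v = 0"
  then show "v = 0" using posdef[OF assms, of v] by auto
qed

lemma csmooth_spray: "csmooth S (spray f i)"
  unfolding spray_def[abs_def]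
  by (intro csmooth_intros csmooth_sq csmooth_matrix_inv csmooth_fund_tensor invertible_fund_tensor)

lemma fund_tensor_spray:
  assumes "(x, y) \<in> S"
  shows "(\<Sum>i\<in>UNIV. fund_tensor f x y $ l $ i * spray f i x y) = 1/4 * euler_lagrange l x y"
proof -
  let ?g = "fund_tensor f x y" and ?v = "\<chi> l. euler_lagrange l x y"
  have s: "spray f i x y = 1/4 * (matrix_inv ?g *v ?v) $ i" for i
    by (simp add: spray_def matrix_vector_mult_def euler_lagrange_def)
  have "(\<Sum>i\<in>UNIV. ?g $ l $ i * spray f i x y) = 1/4 * (?g *v (matrix_inv ?g *v ?v)) $ l"
    unfolding s by (simp add: matrix_vector_mult_def[of ?g] sum_divide_distrib)
  then show ?thesis
    by (simp add: matrix_vector_mul_assoc matrix_inv_right[OF invertible_fund_tensor[OF assms]])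
qed

lemma euler_sq: "euler 2 (sq f)"
proof -
  have "euler (1 + 1) (\<lambda>x y. f x y * f x y)" by (intro euler_mult euler_f f)
  then show ?thesis by (simp add: sq_def[abs_def] power2_eq_square)
qed

lemma euler_euler_lagrange: "euler 2 (euler_lagrange l)"
proof -
  have "euler ((2 - 1) + 1) (\<lambda>x y. \<Sum>k\<in>UNIV. dx k (dy l (sq f)) x y * y $ k)"
    by (intro euler_sum euler_mult euler_snd euler_dx euler_dy euler_sq csmooth_intros csmooth_sq)
  then show ?thesis unfolding euler_lagrange_def[abs_def]
    by (intro euler_diff euler_dx euler_sq csmooth_intros csmooth_sq) simp
qed

text \<open>With the index lowered the spray becomes 1/4 of \<open>euler_lagrange\<close>, which has
  degree 2, while g has degree 0. Hence g annihilates the defect y^m G^i_{.m} - 2 G^i.\<close>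

lemma euler_spray: "euler 2 (spray f i)"
  unfolding euler_def
proof (intro allI impI)
  fix x y assume xy: "(x, y) \<in> S"
  let ?g = "\<lambda>l i x y. fund_tensor f x y $ l $ i" and ?G = "spray f"
  have g0: "(\<Sum>m\<in>UNIV. y $ m * dy m (?g l i) x y) = 0" for l i
  proof -
    have "euler (0 + (2 - 1 - 1)) (\<lambda>x y. 1/2 * dy l (dy i (sq f)) x y)"
      by (intro euler_mult euler_const euler_dy euler_sq csmooth_intros csmooth_sq)
    from eulerD[OF this xy] show ?thesis by (simp add: fund_tensor_def)
  qed
  have "(\<Sum>i\<in>UNIV. ?g l i x y * ((\<Sum>m\<in>UNIV. y $ m * dy m (?G i) x y) - 2 * ?G i x y)) = 0" for l
  proof -
    have "(\<Sum>m\<in>UNIV. y $ m * dy m (\<lambda>x y. \<Sum>i\<in>UNIV. ?g l i x y * ?G i x y) x y) =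
       (\<Sum>m\<in>UNIV. y $ m * dy m (\<lambda>x y. 1/4 * euler_lagrange l x y) x y)"
      by (intro sum.cong refl arg_cong2[of _ _ _ _ "(*)"] dy_cong[OF xy] fund_tensor_spray)
    also have "\<dots> = 1/4 * (\<Sum>m\<in>UNIV. y $ m * dy m (euler_lagrange l) x y)"
      using xy by (simp add: dy_cdivide csmooth_euler_lagrange sum_divide_distrib)
    also have "\<dots> = 2 * (\<Sum>i\<in>UNIV. ?g l i x y * ?G i x y)"
      using eulerD[OF euler_euler_lagrange xy, of l] fund_tensor_spray[OF xy, of l] by simp
    finally have "2 * (\<Sum>i\<in>UNIV. ?g l i x y * ?G i x y) =
        (\<Sum>m\<in>UNIV. y $ m * dy m (\<lambda>x y. \<Sum>i\<in>UNIV. ?g l i x y * ?G i x y) x y)" ..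
    also have "\<dots> = (\<Sum>m\<in>UNIV. \<Sum>i\<in>UNIV. y $ m * (dy m (?g l i) x y * ?G i x y + ?g l i x y * dy m (?G i) x y))"
      using xy by (simp add: d_simps csmooth_fund_tensor csmooth_spray sum_distrib_left)
    also have "\<dots> = (\<Sum>i\<in>UNIV. (\<Sum>m\<in>UNIV. y $ m * dy m (?g l i) x y) * ?G i x y
         + ?g l i x y * (\<Sum>m\<in>UNIV. y $ m * dy m (?G i) x y))"
      by (subst sum.swap) (simp add: sum_distrib_left sum_distrib_right sum.distrib algebra_simps)
    finally show ?thesis
      by (simp add: g0 right_diff_distrib sum_subtractf sum_distrib_left mult.left_commute)
  qed
  from fund_tensor_nondegenerate[OF xy this]
  show "(\<Sum>m\<in>UNIV. y $ m * dy m (?G i) x y) = 2 * ?G i x y" by simp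
qed

sublocale spray_coords S "spray f"
  by unfold_locales (rule csmooth_spray, rule euler_spray)

end

section \<open>Coordinate changes\<close>

text \<open>\<open>\<phi>\<close> is the change of base coordinates, \<open>P\<close> its Jacobian
  with the new index first, and \<open>\<psi>\<close> the induced map of directions. They are
  constrained only on \<open>S\<close>, because transition maps are meaningful only on chart
  overlaps.\<close>

locale transform = coords S + T: coords S'
  for S S' :: "((real^'n::finite) \<times> (real^'n)) set" +
  fixes \<phi> :: "real^'n \<Rightarrow> real^'n" and P :: "'n \<Rightarrow> 'n \<Rightarrow> real^'n \<Rightarrow> real" and \<psi> :: "real^'n \<Rightarrow> real^'n \<Rightarrow> real^'n"
  assumes \<phi>: "csmooth S (\<lambda>x y. \<phi> x $ a)"
    and dx_\<phi>: "(x, y) \<in> S \<Longrightarrow> dx j (\<lambda>x y. \<phi> x $ a) x y = P a j x"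
    and \<psi>: "(x, y) \<in> S \<Longrightarrow> \<psi> x y $ a = (\<Sum>j\<in>UNIV. P a j x * y $ j)"
    and invertible_P: "(x, y) \<in> S \<Longrightarrow> invertible (\<chi> a j. P a j x)"
    and maps: "(x, y) \<in> S \<Longrightarrow> (\<phi> x, \<psi> x y) \<in> S'"
begin

text \<open>The argument \<open>0\<close> is arbitrary, as \<open>P\<close> does not depend on the fibre coordinate.\<close>

definition H :: "'n \<Rightarrow> 'n \<Rightarrow> 'n \<Rightarrow> real^'n \<Rightarrow> real" where
  "H a k m x = dx k (\<lambda>x y. P a m x) x 0"

text \<open>The position derivative of the new direction, d\<psi>^a/dx^k. Contracted once more with
  \<open>y\<close> it becomes \<open>KK\<close>, the quadratic form in the transformation law of the
  spray.\<close>

definition K :: "'n \<Rightarrow> 'n \<Rightarrow> 'n coord_fun" where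
  "K a k x y = (\<Sum>m\<in>UNIV. H a k m x * y $ m)"

definition KK :: "'n \<Rightarrow> 'n coord_fun" where
  "KK a x y = (\<Sum>k\<in>UNIV. K a k x y * y $ k)"

definition Q :: "'n \<Rightarrow> 'n \<Rightarrow> real^'n \<Rightarrow> real" where
  "Q j a x = matrix_inv (\<chi> a j. P a j x) $ j $ a"

definition pull :: "'n coord_fun \<Rightarrow> 'n coord_fun" where
  "pull f x y = f (\<phi> x) (\<psi> x y)"

lemma dx_P: "dx k (\<lambda>x y. P a m x) x y = H a k m x"
  by (simp add: H_def dx_def)

lemma csmooth_P: "csmooth S (\<lambda>x y. P a j x)"
  using csmooth_dx[OF \<phi>, of j a] csmooth_cong[of "dx j (\<lambda>x y. \<phi> x $ a)" "\<lambda>x y. P a j x", OF dx_\<phi>] by simp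

lemma csmooth_H: "csmooth S (\<lambda>x y. H a k m x)"
  using csmooth_dx[OF csmooth_P, of k a m] by (simp add: dx_P[abs_def])

lemma H_sym:
  assumes xy: "(x, y) \<in> S"
  shows "H a k m x = H a m k x"
proof -
  have "H a k m x = dx k (dx m (\<lambda>x y. \<phi> x $ a)) x y" for k m
    unfolding dx_P[symmetric, of _ _ _ _ y] by (rule dx_cong[OF xy]) (rule dx_\<phi>[symmetric])
  then show ?thesis using dx_dx[OF \<phi> xy] by simp
qed

lemma csmooth_K: "csmooth S (K a k)"
  unfolding K_def[abs_def] by (intro csmooth_intros csmooth_H)

lemma csmooth_KK: "csmooth S (KK a)"
  unfolding KK_def[abs_def] by (intro csmooth_intros csmooth_K)

lemma csmooth_Q: "csmooth S (\<lambda>x y. Q j a x)"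
  unfolding Q_def by (intro csmooth_matrix_inv) (simp_all add: csmooth_P invertible_P)

lemma P_Q:
  assumes xy: "(x, y) \<in> S"
  shows "(\<Sum>j\<in>UNIV. P a j x * Q j b x) = (if a = b then 1 else 0)"
  using arg_cong[OF matrix_inv_right[OF invertible_P[OF xy]], of "\<lambda>M. M $ a $ b"]
  by (simp add: matrix_matrix_mult_def Q_def mat_def)

lemma Q_P:
  assumes xy: "(x, y) \<in> S"
  shows "(\<Sum>a\<in>UNIV. Q i a x * P a j x) = (if i = j then 1 else 0)"
proof -
  have "matrix_inv (\<chi> a j. P a j x) ** (\<chi> a j. P a j x) = mat 1"
    using matrix_inv_right[OF invertible_P[OF xy]] matrix_left_right_inverse by blast
  from arg_cong[OF this, of "\<lambda>M. M $ i $ j"] show ?thesis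
    by (simp add: matrix_matrix_mult_def Q_def mat_def)
qed

lemma csmooth_\<psi>: "csmooth S (\<lambda>x y. \<psi> x y $ a)"
  by (subst csmooth_cong[OF \<psi>]) (auto intro!: csmooth_intros csmooth_P)

lemma csmooth_pull: "csmooth S' f \<Longrightarrow> csmooth S (pull f)"
  unfolding pull_def[abs_def] by (rule csmooth_compose[OF open_S _ \<phi> csmooth_\<psi> maps])

lemma dx_\<psi>: 
  assumes xy: "(x, y) \<in> S"
  shows "dx k (\<lambda>x y. \<psi> x y $ a) x y = K a k x y"
  by (subst dx_cong[OF xy \<psi>]) (use xy in \<open>auto simp: d_simps csmooth_P dx_P K_def\<close>)

lemma dy_\<psi>: 
  assumes xy: "(x, y) \<in> S"
  shows "dy k (\<lambda>x y. \<psi> x y $ a) x y = P a k x"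
  by (subst dy_cong[OF xy \<psi>])
    (use xy in \<open>auto simp: d_simps csmooth_P if_distrib[of "\<lambda>a. _ * a"] cong: if_cong\<close>)

lemma dy_pull:
  assumes "csmooth S' f" "(x, y) \<in> S"
  shows "dy k (pull f) x y = (\<Sum>a\<in>UNIV. P a k x * pull (dy a f) x y)"
  unfolding pull_def[abs_def] using d_compose(2)[OF assms(1) \<phi> csmooth_\<psi> maps assms(2), of k] assms
  by (simp add: dy_\<psi>)

text \<open>The second sum is present because the new direction depends on the old position; it is a
  source of the inhomogeneous terms below.\<close>

lemma dx_pull:
  assumes "csmooth S' f" "(x, y) \<in> S"
  shows "dx k (pull f) x y = (\<Sum>a\<in>UNIV. P a k x * pull (dx a f) x y) + (\<Sum>a\<in>UNIV. K a k x y * pull (dy a f) x y)"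
  unfolding pull_def[abs_def] using d_compose(1)[OF assms(1) \<phi> csmooth_\<psi> maps assms(2), of k] assms
  by (simp add: dx_\<psi> dx_\<phi>)

lemma dy_K: "(x, y) \<in> S \<Longrightarrow> dy j (K a k) x y = H a k j x"
  unfolding K_def[abs_def] by (simp add: d_simps csmooth_H if_distrib[of "\<lambda>a. _ * a"] cong: if_cong)

lemma K_sym: "(x, y) \<in> S \<Longrightarrow> (\<Sum>k\<in>UNIV. H a k j x * y $ k) = K a j x y"
  unfolding K_def by (simp add: H_sym[of x y a _ j])

lemma dy_KK: "(x, y) \<in> S \<Longrightarrow> dy j (KK a) x y = 2 * K a j x y"
  unfolding KK_def[abs_def]
  by (simp add: d_simps csmooth_K dy_K if_distrib[of "\<lambda>a. _ * a"] sum.distrib K_sym cong: if_cong)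

lemma P_left_cancel:
  assumes "(x, y) \<in> S" "\<And>l. (\<Sum>a\<in>UNIV. P a l x * Y a) = 0"
  shows "Y c = 0"
proof -
  have "Y c = (\<Sum>a\<in>UNIV. (\<Sum>l\<in>UNIV. P a l x * Q l c x) * Y a)"
    by (simp add: P_Q[OF assms(1)] if_distrib[of "\<lambda>a. a * _"] cong: if_cong)
  also have "\<dots> = (\<Sum>l\<in>UNIV. Q l c x * (\<Sum>a\<in>UNIV. P a l x * Y a))"
    unfolding sum_distrib_left sum_distrib_right by (subst sum.swap) (simp add: mult_ac)
  finally show ?thesis by (simp add: assms(2))
qed

text \<open>\<open>P\<close> depends on the position only, so iterated \<open>y\<close>-derivatives
  transform without extra terms.\<close>

lemma dy_dy_pull:
  assumes f: "csmooth S' f" and xy: "(x, y) \<in> S"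
  shows "dy j (dy k (pull f)) x y = (\<Sum>a\<in>UNIV. \<Sum>b\<in>UNIV. P a j x * P b k x * pull (dy a (dy b f)) x y)"
proof -
  have "dy j (dy k (pull f)) x y = dy j (\<lambda>x y. \<Sum>b\<in>UNIV. P b k x * pull (dy b f) x y) x y"
    by (rule dy_cong[OF xy]) (rule dy_pull[OF f])
  also have "\<dots> = (\<Sum>b\<in>UNIV. \<Sum>a\<in>UNIV. P a j x * P b k x * pull (dy a (dy b f)) x y)"
    using xy f by (simp add: d_simps csmooth_P csmooth_pull T.csmooth_dy dy_pull sum_distrib_left mult_ac)
  finally show ?thesis by (subst sum.swap)
qed

lemma dy_dy_dy_pull:
  assumes f: "csmooth S' f" and xy: "(x, y) \<in> S"
  shows "dy j (dy k (dy l (pull f))) x y =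
    (\<Sum>a\<in>UNIV. \<Sum>b\<in>UNIV. \<Sum>d\<in>UNIV. P a j x * P b k x * P d l x * pull (dy a (dy b (dy d f))) x y)"
proof -
  have "dy j (dy k (dy l (pull f))) x y =
      dy j (\<lambda>x y. \<Sum>b\<in>UNIV. \<Sum>d\<in>UNIV. P b k x * P d l x * pull (dy b (dy d f)) x y) x y"
    by (rule dy_cong[OF xy]) (rule dy_dy_pull[OF f])
  also have "\<dots> = (\<Sum>b\<in>UNIV. \<Sum>d\<in>UNIV. \<Sum>a\<in>UNIV. P a j x * P b k x * P d l x * pull (dy a (dy b (dy d f))) x y)"
    using xy f by (simp add: d_simps csmooth_P csmooth_pull T.csmooth_dy dy_pull sum_distrib_left mult_ac)
  also have "\<dots> = (\<Sum>b\<in>UNIV. \<Sum>a\<in>UNIV. \<Sum>d\<in>UNIV. P a j x * P b k x * P d l x * pull (dy a (dy b (dy d f))) x y)"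
    by (rule sum.cong[OF refl], rule sum.swap)
  finally show ?thesis by (subst sum.swap)
qed

lemma dy_dy_dy_quadratic:
  assumes c: "\<And>k m. csmooth S (\<lambda>x y. c k m x)" and xy: "(x, y) \<in> S"
  shows "dy j (dy k (dy l (\<lambda>x y. \<Sum>p\<in>UNIV. \<Sum>q\<in>UNIV. c p q x * y $ p * y $ q))) x y = 0"
proof -
  have 1: "dy l (\<lambda>x y. \<Sum>p\<in>UNIV. \<Sum>q\<in>UNIV. c p q x * y $ p * y $ q) x y =
      (\<Sum>q\<in>UNIV. (c l q x + c q l x) * y $ q)" if "(x, y) \<in> S" for x y
    using that by (simp add: d_simps c if_distrib[of "\<lambda>a. _ * a"] if_distrib[of "\<lambda>a. a * _"] sum.distrib
        distrib_right cong: if_cong) (simp add: sum.swap[of _ UNIV UNIV] cong: if_cong)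
  have 2: "dy k (dy l (\<lambda>x y. \<Sum>p\<in>UNIV. \<Sum>q\<in>UNIV. c p q x * y $ p * y $ q)) x y = c l k x + c k l x"
    if "(x, y) \<in> S" for x y
    by (subst dy_cong[OF that 1])
      (use that in \<open>auto simp: d_simps c if_distrib[of "\<lambda>a. _ * a"] cong: if_cong\<close>)
  show ?thesis by (subst dy_cong[OF xy 2]) simp_all
qed

end

section \<open>The algebra behind the covariance of the derivative along the spray\<close>

lemma sum_rotate3:
  fixes f :: "'n::finite \<Rightarrow> 'n \<Rightarrow> 'n \<Rightarrow> 'n \<Rightarrow> real"
  shows "(\<Sum>r\<in>UNIV. \<Sum>a\<in>UNIV. \<Sum>b\<in>UNIV. \<Sum>d\<in>UNIV. f r a b d) =
    (\<Sum>a\<in>UNIV. \<Sum>b\<in>UNIV. \<Sum>d\<in>UNIV. \<Sum>r\<in>UNIV. f r a b d)"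
proof -
  have "(\<Sum>r\<in>UNIV. \<Sum>a\<in>UNIV. \<Sum>b\<in>UNIV. \<Sum>d\<in>UNIV. f r a b d) =
      (\<Sum>a\<in>UNIV. \<Sum>r\<in>UNIV. \<Sum>b\<in>UNIV. \<Sum>d\<in>UNIV. f r a b d)" by (rule sum.swap)
  also have "\<dots> = (\<Sum>a\<in>UNIV. \<Sum>b\<in>UNIV. \<Sum>r\<in>UNIV. \<Sum>d\<in>UNIV. f r a b d)"
    by (rule sum.cong[OF refl], rule sum.swap)
  also have "\<dots> = (\<Sum>a\<in>UNIV. \<Sum>b\<in>UNIV. \<Sum>d\<in>UNIV. \<Sum>r\<in>UNIV. f r a b d)"
    by (rule sum.cong[OF refl], rule sum.cong[OF refl], rule sum.swap)
  finally show ?thesis .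
qed

text \<open>Calculus is removed by working with arrays at a single point: \<open>SP\<close>,
  \<open>ST\<close>, \<open>ST'\<close> stand for spray derivatives and \<open>N\<close>,
  \<open>N'\<close> for G^i_{.j}. The assumption \<open>SP\<close> is the inhomogeneous law of
  \<open>N\<close>; it replaces every contraction of \<open>P\<close> with \<open>N\<close>, and the
  resulting \<open>SP\<close> terms are those that the Leibniz rule produces in
  \<open>S\<close>.\<close>

lemma covariant_derivative_transform_pointwise:
  fixes P SP N N' :: "'n::finite \<Rightarrow> 'n \<Rightarrow> real" and T ST T' ST' :: "'n \<Rightarrow> 'n \<Rightarrow> 'n \<Rightarrow> 'n \<Rightarrow> real"
  assumes SP: "\<And>a j. SP a j = (\<Sum>i\<in>UNIV. P a i * N i j) - (\<Sum>b\<in>UNIV. P b j * N' a b)"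
    and T: "\<And>i j k l. (\<Sum>p\<in>UNIV. P i p * T j p k l) =
      (\<Sum>a\<in>UNIV. \<Sum>b\<in>UNIV. \<Sum>d\<in>UNIV. P a j * P b k * P d l * T' a i b d)"
    and S: "(\<Sum>p\<in>UNIV. SP i p * T j p k l + P i p * ST j p k l) =
      (\<Sum>a\<in>UNIV. \<Sum>b\<in>UNIV. \<Sum>d\<in>UNIV. (SP a j * P b k * P d l + P a j * SP b k * P d l + P a j * P b k * SP d l)
        * T' a i b d + P a j * P b k * P d l * ST' a i b d)"
  shows "(\<Sum>p\<in>UNIV. P i p * (ST j p k l + (\<Sum>r\<in>UNIV. T j r k l * N p r) - (\<Sum>r\<in>UNIV. T r p k l * N r j)
       - (\<Sum>r\<in>UNIV. T j p r l * N r k) - (\<Sum>r\<in>UNIV. T j p k r * N r l))) =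
    (\<Sum>a\<in>UNIV. \<Sum>b\<in>UNIV. \<Sum>d\<in>UNIV. P a j * P b k * P d l * (ST' a i b d + (\<Sum>c\<in>UNIV. T' a c b d * N' i c)
       - (\<Sum>c\<in>UNIV. T' c i b d * N' c a) - (\<Sum>c\<in>UNIV. T' a i c d * N' c b) - (\<Sum>c\<in>UNIV. T' a i b c * N' c d)))"
proof -
  have PN: "(\<Sum>i\<in>UNIV. P a i * N i j) = SP a j + (\<Sum>b\<in>UNIV. P b j * N' a b)" for a j
    by (simp add: SP)
  have up: "(\<Sum>p\<in>UNIV. P i p * (\<Sum>r\<in>UNIV. T j r k l * N p r)) = (\<Sum>p\<in>UNIV. SP i p * T j p k l) +
      (\<Sum>a\<in>UNIV. \<Sum>b\<in>UNIV. \<Sum>d\<in>UNIV. P a j * P b k * P d l * (\<Sum>c\<in>UNIV. T' a c b d * N' i c))"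
  proof -
    have "(\<Sum>p\<in>UNIV. P i p * (\<Sum>r\<in>UNIV. T j r k l * N p r)) = (\<Sum>r\<in>UNIV. (\<Sum>p\<in>UNIV. P i p * N p r) * T j r k l)"
      unfolding sum_distrib_left sum_distrib_right by (subst sum.swap) (simp add: mult_ac)
    also have "\<dots> = (\<Sum>r\<in>UNIV. SP i r * T j r k l) + (\<Sum>r\<in>UNIV. (\<Sum>c\<in>UNIV. P c r * N' i c) * T j r k l)"
      unfolding PN by (simp add: distrib_right sum.distrib)
    also have "(\<Sum>r\<in>UNIV. (\<Sum>c\<in>UNIV. P c r * N' i c) * T j r k l) = (\<Sum>c\<in>UNIV. N' i c * (\<Sum>r\<in>UNIV. P c r * T j r k l))"
      unfolding sum_distrib_left sum_distrib_right by (subst sum.swap) (simp add: mult_ac)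
    also have "\<dots> = (\<Sum>c\<in>UNIV. \<Sum>a\<in>UNIV. \<Sum>b\<in>UNIV. \<Sum>d\<in>UNIV. P a j * P b k * P d l * (T' a c b d * N' i c))"
      unfolding T by (simp add: sum_distrib_left mult_ac)
    also have "\<dots> = (\<Sum>a\<in>UNIV. \<Sum>b\<in>UNIV. \<Sum>d\<in>UNIV. \<Sum>c\<in>UNIV. P a j * P b k * P d l * (T' a c b d * N' i c))"
      by (rule sum_rotate3)
    finally show ?thesis unfolding sum_distrib_left .
  qed
  have low1: "(\<Sum>p\<in>UNIV. P i p * (\<Sum>r\<in>UNIV. T r p k l * N r j)) =
      (\<Sum>a\<in>UNIV. \<Sum>b\<in>UNIV. \<Sum>d\<in>UNIV. SP a j * P b k * P d l * T' a i b d) +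
      (\<Sum>a\<in>UNIV. \<Sum>b\<in>UNIV. \<Sum>d\<in>UNIV. P a j * P b k * P d l * (\<Sum>c\<in>UNIV. T' c i b d * N' c a))"
  proof -
    have "(\<Sum>p\<in>UNIV. P i p * (\<Sum>r\<in>UNIV. T r p k l * N r j)) = (\<Sum>r\<in>UNIV. N r j * (\<Sum>p\<in>UNIV. P i p * T r p k l))"
      unfolding sum_distrib_left by (subst sum.swap) (simp add: mult_ac)
    also have "\<dots> = (\<Sum>r\<in>UNIV. \<Sum>a\<in>UNIV. \<Sum>b\<in>UNIV. \<Sum>d\<in>UNIV. (P a r * N r j) * (P b k * P d l * T' a i b d))"
      unfolding T by (simp add: sum_distrib_left mult_ac)
    also have "\<dots> = (\<Sum>a\<in>UNIV. \<Sum>b\<in>UNIV. \<Sum>d\<in>UNIV. (SP a j + (\<Sum>c\<in>UNIV. P c j * N' a c)) * (P b k * P d l * T' a i b d))"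
      by (subst sum_rotate3) (simp only: sum_distrib_right[symmetric] PN)
    also have "\<dots> = (\<Sum>a\<in>UNIV. \<Sum>b\<in>UNIV. \<Sum>d\<in>UNIV. SP a j * P b k * P d l * T' a i b d) +
       (\<Sum>a\<in>UNIV. \<Sum>b\<in>UNIV. \<Sum>d\<in>UNIV. \<Sum>c\<in>UNIV. P c j * N' a c * (P b k * P d l * T' a i b d))"
      by (simp add: distrib_right sum.distrib sum_distrib_right mult.assoc)
    also have "(\<Sum>a\<in>UNIV. \<Sum>b\<in>UNIV. \<Sum>d\<in>UNIV. \<Sum>c\<in>UNIV. P c j * N' a c * (P b k * P d l * T' a i b d)) =
       (\<Sum>c\<in>UNIV. \<Sum>a\<in>UNIV. \<Sum>b\<in>UNIV. \<Sum>d\<in>UNIV. P c j * N' a c * (P b k * P d l * T' a i b d))"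
      by (rule sum_rotate3[symmetric])
    also have "\<dots> = (\<Sum>c\<in>UNIV. \<Sum>b\<in>UNIV. \<Sum>d\<in>UNIV. \<Sum>a\<in>UNIV. P c j * N' a c * (P b k * P d l * T' a i b d))"
      by (rule sum.cong[OF refl], subst sum.swap, rule sum.cong[OF refl], rule sum.swap)
    finally show ?thesis by (simp add: sum_distrib_left mult_ac)
  qed
  have low2: "(\<Sum>p\<in>UNIV. P i p * (\<Sum>r\<in>UNIV. T j p r l * N r k)) =
      (\<Sum>a\<in>UNIV. \<Sum>b\<in>UNIV. \<Sum>d\<in>UNIV. P a j * SP b k * P d l * T' a i b d) +
      (\<Sum>a\<in>UNIV. \<Sum>b\<in>UNIV. \<Sum>d\<in>UNIV. P a j * P b k * P d l * (\<Sum>c\<in>UNIV. T' a i c d * N' c b))"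
  proof -
    have "(\<Sum>p\<in>UNIV. P i p * (\<Sum>r\<in>UNIV. T j p r l * N r k)) = (\<Sum>r\<in>UNIV. N r k * (\<Sum>p\<in>UNIV. P i p * T j p r l))"
      unfolding sum_distrib_left by (subst sum.swap) (simp add: mult_ac)
    also have "\<dots> = (\<Sum>r\<in>UNIV. \<Sum>a\<in>UNIV. \<Sum>b\<in>UNIV. \<Sum>d\<in>UNIV. (P b r * N r k) * (P a j * P d l * T' a i b d))"
      unfolding T by (simp add: sum_distrib_left mult_ac)
    also have "\<dots> = (\<Sum>a\<in>UNIV. \<Sum>b\<in>UNIV. \<Sum>d\<in>UNIV. (SP b k + (\<Sum>c\<in>UNIV. P c k * N' b c)) * (P a j * P d l * T' a i b d))"
      by (subst sum_rotate3) (simp only: sum_distrib_right[symmetric] PN)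
    also have "\<dots> = (\<Sum>a\<in>UNIV. \<Sum>b\<in>UNIV. \<Sum>d\<in>UNIV. P a j * SP b k * P d l * T' a i b d) +
       (\<Sum>a\<in>UNIV. \<Sum>b\<in>UNIV. \<Sum>d\<in>UNIV. \<Sum>c\<in>UNIV. P c k * N' b c * (P a j * P d l * T' a i b d))"
      by (simp add: distrib_left distrib_right sum.distrib sum_distrib_left sum_distrib_right mult_ac)
    also have "(\<Sum>a\<in>UNIV. \<Sum>b\<in>UNIV. \<Sum>d\<in>UNIV. \<Sum>c\<in>UNIV. P c k * N' b c * (P a j * P d l * T' a i b d)) =
       (\<Sum>a\<in>UNIV. \<Sum>c\<in>UNIV. \<Sum>d\<in>UNIV. \<Sum>b\<in>UNIV. P c k * N' b c * (P a j * P d l * T' a i b d))"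
      by (rule sum.cong[OF refl], subst (2) sum.swap, subst sum.swap, subst (2) sum.swap, rule refl)
    finally show ?thesis by (simp add: sum_distrib_left mult_ac)
  qed
  have low3: "(\<Sum>p\<in>UNIV. P i p * (\<Sum>r\<in>UNIV. T j p k r * N r l)) =
      (\<Sum>a\<in>UNIV. \<Sum>b\<in>UNIV. \<Sum>d\<in>UNIV. P a j * P b k * SP d l * T' a i b d) +
      (\<Sum>a\<in>UNIV. \<Sum>b\<in>UNIV. \<Sum>d\<in>UNIV. P a j * P b k * P d l * (\<Sum>c\<in>UNIV. T' a i b c * N' c d))"
  proof -
    have "(\<Sum>p\<in>UNIV. P i p * (\<Sum>r\<in>UNIV. T j p k r * N r l)) = (\<Sum>r\<in>UNIV. N r l * (\<Sum>p\<in>UNIV. P i p * T j p k r))"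
      unfolding sum_distrib_left by (subst sum.swap) (simp add: mult_ac)
    also have "\<dots> = (\<Sum>r\<in>UNIV. \<Sum>a\<in>UNIV. \<Sum>b\<in>UNIV. \<Sum>d\<in>UNIV. (P d r * N r l) * (P a j * P b k * T' a i b d))"
      unfolding T by (simp add: sum_distrib_left mult_ac)
    also have "\<dots> = (\<Sum>a\<in>UNIV. \<Sum>b\<in>UNIV. \<Sum>d\<in>UNIV. (SP d l + (\<Sum>c\<in>UNIV. P c l * N' d c)) * (P a j * P b k * T' a i b d))"
      by (subst sum_rotate3) (simp only: sum_distrib_right[symmetric] PN)
    also have "\<dots> = (\<Sum>a\<in>UNIV. \<Sum>b\<in>UNIV. \<Sum>d\<in>UNIV. P a j * P b k * SP d l * T' a i b d) +
       (\<Sum>a\<in>UNIV. \<Sum>b\<in>UNIV. \<Sum>d\<in>UNIV. \<Sum>c\<in>UNIV. P c l * N' d c * (P a j * P b k * T' a i b d))"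
      by (simp add: distrib_left distrib_right sum.distrib sum_distrib_left sum_distrib_right mult_ac)
    also have "(\<Sum>a\<in>UNIV. \<Sum>b\<in>UNIV. \<Sum>d\<in>UNIV. \<Sum>c\<in>UNIV. P c l * N' d c * (P a j * P b k * T' a i b d)) =
       (\<Sum>a\<in>UNIV. \<Sum>b\<in>UNIV. \<Sum>c\<in>UNIV. \<Sum>d\<in>UNIV. P c l * N' d c * (P a j * P b k * T' a i b d))"
      by (rule sum.cong[OF refl], rule sum.cong[OF refl], rule sum.swap)
    finally show ?thesis by (simp add: sum_distrib_left mult_ac)
  qed
  have "(\<Sum>p\<in>UNIV. P i p * (ST j p k l + (\<Sum>r\<in>UNIV. T j r k l * N p r) - (\<Sum>r\<in>UNIV. T r p k l * N r j)
       - (\<Sum>r\<in>UNIV. T j p r l * N r k) - (\<Sum>r\<in>UNIV. T j p k r * N r l))) =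
     (\<Sum>p\<in>UNIV. P i p * ST j p k l) + (\<Sum>p\<in>UNIV. P i p * (\<Sum>r\<in>UNIV. T j r k l * N p r))
     - (\<Sum>p\<in>UNIV. P i p * (\<Sum>r\<in>UNIV. T r p k l * N r j)) - (\<Sum>p\<in>UNIV. P i p * (\<Sum>r\<in>UNIV. T j p r l * N r k))
     - (\<Sum>p\<in>UNIV. P i p * (\<Sum>r\<in>UNIV. T j p k r * N r l))"
    by (simp only: right_diff_distrib distrib_left sum.distrib sum_subtractf)
  \<comment> \<open>\<open>S\<close> trades the \<open>ST\<close> sum for the \<open>ST'\<close> sum
    at the cost of \<open>SP\<close> terms, and these cancel those split off in \<open>up\<close>,
    \<open>low1\<close>, \<open>low2\<close> and \<open>low3\<close>.\<close>
  also have "\<dots> = (\<Sum>a\<in>UNIV. \<Sum>b\<in>UNIV. \<Sum>d\<in>UNIV. P a j * P b k * P d l * ST' a i b d)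
     + (\<Sum>a\<in>UNIV. \<Sum>b\<in>UNIV. \<Sum>d\<in>UNIV. P a j * P b k * P d l * (\<Sum>c\<in>UNIV. T' a c b d * N' i c))
     - (\<Sum>a\<in>UNIV. \<Sum>b\<in>UNIV. \<Sum>d\<in>UNIV. P a j * P b k * P d l * (\<Sum>c\<in>UNIV. T' c i b d * N' c a))
     - (\<Sum>a\<in>UNIV. \<Sum>b\<in>UNIV. \<Sum>d\<in>UNIV. P a j * P b k * P d l * (\<Sum>c\<in>UNIV. T' a i c d * N' c b))
     - (\<Sum>a\<in>UNIV. \<Sum>b\<in>UNIV. \<Sum>d\<in>UNIV. P a j * P b k * P d l * (\<Sum>c\<in>UNIV. T' a i b c * N' c d))"
    using S unfolding up low1 low2 low3 distrib_right sum.distrib by linarith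
  also have "\<dots> = (\<Sum>a\<in>UNIV. \<Sum>b\<in>UNIV. \<Sum>d\<in>UNIV. P a j * P b k * P d l * (ST' a i b d + (\<Sum>c\<in>UNIV. T' a c b d * N' i c)
       - (\<Sum>c\<in>UNIV. T' c i b d * N' c a) - (\<Sum>c\<in>UNIV. T' a i c d * N' c b) - (\<Sum>c\<in>UNIV. T' a i b c * N' c d)))"
    by (simp only: right_diff_distrib distrib_left sum.distrib sum_subtractf)
  finally show ?thesis .
qed

section \<open>Transformation of the spray and the Douglas tensor\<close>

locale transform_finsler = transform S S' \<phi> P \<psi> + finsler_coords S f + F': finsler_coords S' f'
  for S S' :: "((real^'n::finite) \<times> (real^'n)) set" and \<phi> P \<psi> f f' +
  assumes f_pull: "(x, y) \<in> S \<Longrightarrow> f x y = f' (\<phi> x) (\<psi> x y)"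
begin

lemma sq_pull: "(x, y) \<in> S \<Longrightarrow> sq f x y = pull (sq f') x y"
  by (simp add: sq_def pull_def f_pull)

lemma fund_tensor_pull:
  assumes xy: "(x, y) \<in> S"
  shows "fund_tensor f x y $ l $ i =
    (\<Sum>a\<in>UNIV. \<Sum>b\<in>UNIV. P a l x * P b i x * pull (\<lambda>x y. fund_tensor f' x y $ a $ b) x y)"
proof -
  have "dy l (dy i (sq f)) x y = dy l (dy i (pull (sq f'))) x y"
    by (rule dy_cong[OF xy], erule dy_cong, rule sq_pull)
  then show ?thesis
    by (simp add: fund_tensor_def dy_dy_pull[OF F'.csmooth_sq xy] pull_def sum_distrib_left sum_divide_distrib)
qed

text \<open>The terms of type \<open>K\<close> with first \<open>y\<close>-derivatives of F^2 occur
  equally in both halves of the expression and cancel. What is left is \<open>KK\<close> contracted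
  with a second derivative of F^2, that is, with twice the fundamental tensor.\<close>

lemma euler_lagrange_pull:
  assumes xy: "(x, y) \<in> S"
  shows "euler_lagrange l x y = (\<Sum>a\<in>UNIV. P a l x * (pull (F'.euler_lagrange a) x y +
    2 * (\<Sum>b\<in>UNIV. pull (\<lambda>x y. fund_tensor f' x y $ a $ b) x y * KK b x y)))"
proof -
  let ?L = "sq f'"
  note L = F'.csmooth_sq
  have dyl: "dy l (sq f) x y = (\<Sum>a\<in>UNIV. P a l x * pull (dy a ?L) x y)" if "(x, y) \<in> S" for x y
    using dy_cong[OF that sq_pull] dy_pull[OF L that] by simp
  have dxdy: "dx k (dy l (sq f)) x y = (\<Sum>a\<in>UNIV. H a k l x * pull (dy a ?L) x y + P a l x *
      ((\<Sum>b\<in>UNIV. P b k x * pull (dx b (dy a ?L)) x y) + (\<Sum>b\<in>UNIV. K b k x y * pull (dy b (dy a ?L)) x y)))" for k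
    by (subst dx_cong[OF xy dyl])
      (use xy in \<open>auto simp: d_simps csmooth_P csmooth_pull T.csmooth_dy L dx_P dx_pull\<close>)
  have dxl: "dx l (sq f) x y = (\<Sum>a\<in>UNIV. P a l x * pull (dx a ?L) x y) + (\<Sum>a\<in>UNIV. K a l x y * pull (dy a ?L) x y)"
    using dx_cong[OF xy sq_pull] dx_pull[OF L xy] by simp
  have "(\<Sum>k\<in>UNIV. dx k (dy l (sq f)) x y * y $ k) =
     (\<Sum>k\<in>UNIV. \<Sum>a\<in>UNIV. H a k l x * y $ k * pull (dy a ?L) x y)
     + (\<Sum>k\<in>UNIV. \<Sum>a\<in>UNIV. \<Sum>b\<in>UNIV. P a l x * (P b k x * y $ k * pull (dx b (dy a ?L)) x y))
     + (\<Sum>k\<in>UNIV. \<Sum>a\<in>UNIV. \<Sum>b\<in>UNIV. P a l x * (K b k x y * y $ k * pull (dy b (dy a ?L)) x y))"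
    by (simp add: dxdy sum_distrib_left sum_distrib_right distrib_left distrib_right sum.distrib mult_ac)
  also have "(\<Sum>k\<in>UNIV. \<Sum>a\<in>UNIV. H a k l x * y $ k * pull (dy a ?L) x y) =
      (\<Sum>a\<in>UNIV. K a l x y * pull (dy a ?L) x y)"
    by (subst sum.swap) (simp add: sum_distrib_right[symmetric] K_sym[OF xy])
  also have "(\<Sum>k\<in>UNIV. \<Sum>a\<in>UNIV. \<Sum>b\<in>UNIV. P a l x * (P b k x * y $ k * pull (dx b (dy a ?L)) x y)) =
      (\<Sum>a\<in>UNIV. P a l x * (\<Sum>b\<in>UNIV. pull (dx b (dy a ?L)) x y * \<psi> x y $ b))"
  proof -
    have "(\<Sum>k\<in>UNIV. \<Sum>a\<in>UNIV. \<Sum>b\<in>UNIV. P a l x * (P b k x * y $ k * pull (dx b (dy a ?L)) x y)) =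
      (\<Sum>a\<in>UNIV. \<Sum>b\<in>UNIV. \<Sum>k\<in>UNIV. P a l x * (P b k x * y $ k * pull (dx b (dy a ?L)) x y))"
      by (subst sum.swap, rule sum.cong[OF refl], rule sum.swap)
    then show ?thesis by (simp add: \<psi>[OF xy] sum_distrib_left sum_distrib_right mult_ac)
  qed
  also have "(\<Sum>k\<in>UNIV. \<Sum>a\<in>UNIV. \<Sum>b\<in>UNIV. P a l x * (K b k x y * y $ k * pull (dy b (dy a ?L)) x y)) =
      (\<Sum>a\<in>UNIV. P a l x * (2 * (\<Sum>b\<in>UNIV. pull (\<lambda>x y. fund_tensor f' x y $ a $ b) x y * KK b x y)))"
  proof -
    have "(\<Sum>k\<in>UNIV. \<Sum>a\<in>UNIV. \<Sum>b\<in>UNIV. P a l x * (K b k x y * y $ k * pull (dy b (dy a ?L)) x y)) =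
      (\<Sum>a\<in>UNIV. \<Sum>b\<in>UNIV. \<Sum>k\<in>UNIV. P a l x * (K b k x y * y $ k * pull (dy b (dy a ?L)) x y))"
      by (subst sum.swap, rule sum.cong[OF refl], rule sum.swap)
    moreover have "pull (dy b (dy a ?L)) x y = 2 * pull (\<lambda>x y. fund_tensor f' x y $ a $ b) x y" for a b
      using T.dy_dy[OF L maps[OF xy], of a b] by (simp add: pull_def fund_tensor_def)
    ultimately show ?thesis by (simp add: KK_def sum_distrib_left sum_distrib_right mult_ac)
  qed
  finally have e: "(\<Sum>k\<in>UNIV. dx k (dy l (sq f)) x y * y $ k) =
      (\<Sum>a\<in>UNIV. K a l x y * pull (dy a ?L) x y)
      + (\<Sum>a\<in>UNIV. P a l x * (\<Sum>b\<in>UNIV. pull (dx b (dy a ?L)) x y * \<psi> x y $ b))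
      + (\<Sum>a\<in>UNIV. P a l x * (2 * (\<Sum>b\<in>UNIV. pull (\<lambda>x y. fund_tensor f' x y $ a $ b) x y * KK b x y)))" .
  have p: "pull (F'.euler_lagrange a) x y = (\<Sum>b\<in>UNIV. pull (dx b (dy a ?L)) x y * \<psi> x y $ b) - pull (dx a ?L) x y" for a
    by (simp add: pull_def F'.euler_lagrange_def)
  show ?thesis
    unfolding euler_lagrange_def e dxl p distrib_left right_diff_distrib sum.distrib sum_subtractf by simp
qed

text \<open>The Euler--Lagrange expression of \<open>F\<^sup>2\<close> is covariant up to the second derivatives of the
  coordinate change; solving for the spray coefficients uses that the Jacobian and the fundamental
  tensor are nondegenerate.\<close>

lemma spray_pull:
  assumes xy: "(x, y) \<in> S"
  shows "pull (spray f' b) x y = (\<Sum>i\<in>UNIV. P b i x * spray f i x y) - KK b x y / 2"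
proof -
  let ?g = "\<lambda>a b. pull (\<lambda>x y. fund_tensor f' x y $ a $ b) x y"
  \<comment> \<open>The defect of the claimed law. The factor 1/2 at \<open>KK\<close> is the 2 of
    \<open>euler_lagrange_pull\<close> times the 1/4 in the definition of the spray.\<close>
  let ?X = "\<lambda>b. (\<Sum>i\<in>UNIV. P b i x * spray f i x y) - KK b x y / 2 - pull (spray f' b) x y"
  have "(\<Sum>a\<in>UNIV. P a l x * (\<Sum>b\<in>UNIV. ?g a b * ?X b)) = 0" for l
  proof -
    have 1: "(\<Sum>a\<in>UNIV. P a l x * (\<Sum>b\<in>UNIV. ?g a b * (\<Sum>i\<in>UNIV. P b i x * spray f i x y))) =
        (\<Sum>i\<in>UNIV. fund_tensor f x y $ l $ i * spray f i x y)"
    proof -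
      have "(\<Sum>i\<in>UNIV. fund_tensor f x y $ l $ i * spray f i x y) =
          (\<Sum>i\<in>UNIV. \<Sum>a\<in>UNIV. \<Sum>b\<in>UNIV. P a l x * (?g a b * (P b i x * spray f i x y)))"
        by (simp add: fund_tensor_pull[OF xy] sum_distrib_left sum_distrib_right mult_ac)
      also have "\<dots> = (\<Sum>a\<in>UNIV. \<Sum>b\<in>UNIV. \<Sum>i\<in>UNIV. P a l x * (?g a b * (P b i x * spray f i x y)))"
        by (subst sum.swap, rule sum.cong[OF refl], rule sum.swap)
      finally show ?thesis by (simp add: sum_distrib_left)
    qed
    have 2: "(\<Sum>b\<in>UNIV. ?g a b * pull (spray f' b) x y) = 1/4 * pull (F'.euler_lagrange a) x y" for a
      using F'.fund_tensor_spray[OF maps[OF xy], of a] by (simp add: pull_def)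
    have "(\<Sum>a\<in>UNIV. P a l x * (\<Sum>b\<in>UNIV. ?g a b * ?X b)) =
        (\<Sum>a\<in>UNIV. P a l x * (\<Sum>b\<in>UNIV. ?g a b * (\<Sum>i\<in>UNIV. P b i x * spray f i x y)))
        - (\<Sum>a\<in>UNIV. P a l x * (\<Sum>b\<in>UNIV. ?g a b * (KK b x y / 2)))
        - (\<Sum>a\<in>UNIV. P a l x * (\<Sum>b\<in>UNIV. ?g a b * pull (spray f' b) x y))"
      by (simp only: right_diff_distrib sum_subtractf)
    also have "\<dots> = 1/4 * euler_lagrange l x y - (\<Sum>a\<in>UNIV. P a l x * (\<Sum>b\<in>UNIV. ?g a b * (KK b x y / 2)))
        - (\<Sum>a\<in>UNIV. P a l x * (1/4 * pull (F'.euler_lagrange a) x y))"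
      unfolding 1 2 fund_tensor_spray[OF xy] ..
    also have "\<dots> = 0"
      unfolding euler_lagrange_pull[OF xy] by (simp add: distrib_left sum.distrib sum_distrib_left sum_divide_distrib add_divide_distrib mult_ac)
    finally show ?thesis .
  qed
  from P_left_cancel[OF xy this] have "(\<Sum>b\<in>UNIV. ?g a b * ?X b) = 0" for a .
  then have "(\<Sum>b\<in>UNIV. fund_tensor f' (\<phi> x) (\<psi> x y) $ a $ b * ?X b) = 0" for a
    by (simp only: pull_def)
  from F'.fund_tensor_nondegenerate[OF maps[OF xy] this, of b] show ?thesis by simp
qed

text \<open>The law of G^i_{.j}: differentiating the law of the spray turns half the quadratic form
  \<open>KK\<close> into \<open>K\<close>.\<close>

lemma dy_spray_pull:
  assumes xy: "(x, y) \<in> S"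
  shows "(\<Sum>b\<in>UNIV. P b j x * pull (dy b (spray f' a)) x y) = (\<Sum>i\<in>UNIV. P a i x * dy j (spray f i) x y) - K a j x y"
proof -
  have "(\<Sum>b\<in>UNIV. P b j x * pull (dy b (spray f' a)) x y) = dy j (pull (spray f' a)) x y"
    by (rule dy_pull[OF F'.csmooth_spray xy, symmetric])
  also have "\<dots> = dy j (\<lambda>x y. (\<Sum>i\<in>UNIV. P a i x * spray f i x y) - KK a x y / 2) x y"
    by (rule dy_cong[OF xy spray_pull])
  also have "\<dots> = (\<Sum>i\<in>UNIV. P a i x * dy j (spray f i) x y) - K a j x y"
    using xy by (simp add: d_simps csmooth_P csmooth_spray csmooth_KK dy_KK)
  finally show ?thesis .
qed

text \<open>The spray is a single vector field on the slit tangent bundle: the \<open>KK\<close>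
  terms from the position derivative and from the law of the spray coefficients cancel.\<close>

lemma spray_deriv_pull:
  assumes h: "csmooth S' h" and xy: "(x, y) \<in> S"
  shows "spray_deriv (pull h) x y = pull (F'.spray_deriv h) x y"
proof -
  have 1: "(\<Sum>m\<in>UNIV. y $ m * dx m (pull h) x y) =
      (\<Sum>a\<in>UNIV. \<psi> x y $ a * pull (dx a h) x y) + (\<Sum>a\<in>UNIV. KK a x y * pull (dy a h) x y)"
  proof -
    have "(\<Sum>m\<in>UNIV. y $ m * dx m (pull h) x y) =
       (\<Sum>m\<in>UNIV. \<Sum>a\<in>UNIV. P a m x * y $ m * pull (dx a h) x y)
       + (\<Sum>m\<in>UNIV. \<Sum>a\<in>UNIV. K a m x y * y $ m * pull (dy a h) x y)"
      by (simp add: dx_pull[OF h xy] distrib_left sum.distrib sum_distrib_left mult_ac)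
    also have "(\<Sum>m\<in>UNIV. \<Sum>a\<in>UNIV. P a m x * y $ m * pull (dx a h) x y) = (\<Sum>a\<in>UNIV. \<psi> x y $ a * pull (dx a h) x y)"
      by (subst sum.swap) (simp add: \<psi>[OF xy] sum_distrib_right)
    also have "(\<Sum>m\<in>UNIV. \<Sum>a\<in>UNIV. K a m x y * y $ m * pull (dy a h) x y) = (\<Sum>a\<in>UNIV. KK a x y * pull (dy a h) x y)"
      by (subst sum.swap) (simp add: KK_def sum_distrib_right)
    finally show ?thesis .
  qed
  have "(\<Sum>r\<in>UNIV. spray f r x y * dy r (pull h) x y) =
      (\<Sum>r\<in>UNIV. \<Sum>a\<in>UNIV. P a r x * spray f r x y * pull (dy a h) x y)"
    by (simp add: dy_pull[OF h xy] sum_distrib_left mult_ac)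
  also have "\<dots> = (\<Sum>a\<in>UNIV. (pull (spray f' a) x y + KK a x y / 2) * pull (dy a h) x y)"
    by (subst sum.swap) (simp add: spray_pull[OF xy] sum_distrib_right)
  finally have 2: "(\<Sum>r\<in>UNIV. spray f r x y * dy r (pull h) x y) =
      (\<Sum>a\<in>UNIV. pull (spray f' a) x y * pull (dy a h) x y) + 1/2 * (\<Sum>a\<in>UNIV. KK a x y * pull (dy a h) x y)"
    by (simp add: distrib_right sum.distrib sum_divide_distrib)
  show ?thesis
    unfolding spray_deriv_def 1 2 by (simp add: pull_def F'.spray_deriv_def)
qed

text \<open>\<open>P\<close> depends on the position only, so its spray derivative is
  \<open>K\<close>, exactly the inhomogeneous term of \<open>dy_spray_pull\<close>. This is the
  assumption \<open>SP\<close> of the pointwise identity.\<close>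

lemma spray_deriv_P:
  assumes xy: "(x, y) \<in> S"
  shows "spray_deriv (\<lambda>x y. P a j x) x y =
    (\<Sum>i\<in>UNIV. P a i x * dy j (spray f i) x y) - (\<Sum>b\<in>UNIV. P b j x * pull (dy b (spray f' a)) x y)"
proof -
  have "spray_deriv (\<lambda>x y. P a j x) x y = K a j x y"
    using K_sym[OF xy, of a j] by (simp add: spray_deriv_def dx_P mult.commute)
  then show ?thesis by (simp add: dy_spray_pull[OF xy])
qed

text \<open>The upper index is multiplied by \<open>P\<close> on the left-hand side instead of by
  the inverse Jacobian on the right, so that only \<open>P\<close> has to be differentiated.\<close>

definition tensorial :: "('n \<Rightarrow> 'n \<Rightarrow> 'n \<Rightarrow> 'n \<Rightarrow> 'n coord_fun) \<Rightarrow> ('n \<Rightarrow> 'n \<Rightarrow> 'n \<Rightarrow> 'n \<Rightarrow> 'n coord_fun) \<Rightarrow> bool" where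
  "tensorial T T' \<longleftrightarrow> (\<forall>x y. (x, y) \<in> S \<longrightarrow> (\<forall>i j k l. (\<Sum>p\<in>UNIV. P i p x * T j p k l x y) =
     (\<Sum>a\<in>UNIV. \<Sum>b\<in>UNIV. \<Sum>d\<in>UNIV. P a j x * P b k x * P d l x * pull (T' a i b d) x y)))"

text \<open>The spray is applied to both sides of the tensor law. By the Leibniz rule and
  \<open>spray_deriv_pull\<close> this is the assumption \<open>S\<close> of
  \<open>covariant_derivative_transform_pointwise\<close>, and the rest is algebra.\<close>

lemma tensorial_hcov3_0:
  assumes T: "\<And>j i k l. csmooth S (T j i k l)" and T': "\<And>j i k l. csmooth S' (T' j i k l)"
    and tens: "tensorial T T'"
  shows "tensorial (hcov3_0 (spray f) T) (hcov3_0 (spray f') T')"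
  unfolding tensorial_def
proof (intro allI impI)
  fix x y i j k l assume xy: "(x, y) \<in> S"
  have e: "(\<Sum>p\<in>UNIV. P i p x * T j p k l x y) =
     (\<Sum>a\<in>UNIV. \<Sum>b\<in>UNIV. \<Sum>d\<in>UNIV. P a j x * P b k x * P d l x * pull (T' a i b d) x y)" 
     if "(x, y) \<in> S" for x y i j k l
    using tens that by (simp add: tensorial_def)
  have "spray_deriv (\<lambda>x y. \<Sum>p\<in>UNIV. P i p x * T j p k l x y) x y =
     spray_deriv (\<lambda>x y. \<Sum>a\<in>UNIV. \<Sum>b\<in>UNIV. \<Sum>d\<in>UNIV. P a j x * P b k x * P d l x * pull (T' a i b d) x y) x y"
    by (rule spray_deriv_cong[OF xy e])
  then have S: "(\<Sum>p\<in>UNIV. spray_deriv (\<lambda>x y. P i p x) x y * T j p k l x y + P i p x * spray_deriv (T j p k l) x y) =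
      (\<Sum>a\<in>UNIV. \<Sum>b\<in>UNIV. \<Sum>d\<in>UNIV. (spray_deriv (\<lambda>x y. P a j x) x y * P b k x * P d l x
          + P a j x * spray_deriv (\<lambda>x y. P b k x) x y * P d l x + P a j x * P b k x * spray_deriv (\<lambda>x y. P d l x) x y)
        * pull (T' a i b d) x y + P a j x * P b k x * P d l x * pull (F'.spray_deriv (T' a i b d)) x y)"
    using xy by (simp add: spray_deriv_sum spray_deriv_mult csmooth_sum csmooth_mult csmooth_P T csmooth_pull T' spray_deriv_pull distrib_right)
  show "(\<Sum>p\<in>UNIV. P i p x * hcov3_0 (spray f) T j p k l x y) =
     (\<Sum>a\<in>UNIV. \<Sum>b\<in>UNIV. \<Sum>d\<in>UNIV. P a j x * P b k x * P d l x * pull (hcov3_0 (spray f') T' a i b d) x y)"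
    using covariant_derivative_transform_pointwise[
        of "\<lambda>a j. spray_deriv (\<lambda>x y. P a j x) x y" "\<lambda>a j. P a j x" "\<lambda>i j. dy j (spray f i) x y"
          "\<lambda>a b. pull (dy b (spray f' a)) x y" "\<lambda>j p k l. T j p k l x y" "\<lambda>a i b d. pull (T' a i b d) x y"
          i j k l "\<lambda>j p k l. spray_deriv (T j p k l) x y" "\<lambda>a i b d. pull (F'.spray_deriv (T' a i b d)) x y",
        OF spray_deriv_P[OF xy] e[OF xy] S]
    unfolding hcov3_0_eq[OF xy] by (simp only: pull_def F'.hcov3_0_eq[OF maps[OF xy]])
qed

text \<open>A trace pairs an old with a new index, so the inverse Jacobian is inserted in the form
  PQ = 1. The correction is the derivative of log |det P| in the direction \<open>y\<close>, a
  linear form in \<open>y\<close>.\<close>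

lemma trace_spray_pull:
  assumes xy: "(x, y) \<in> S"
  shows "(\<Sum>m\<in>UNIV. pull (dy m (spray f' m)) x y) =
    (\<Sum>m\<in>UNIV. dy m (spray f m) x y) - (\<Sum>a\<in>UNIV. \<Sum>j\<in>UNIV. Q j a x * K a j x y)"
proof -
  have "(\<Sum>m\<in>UNIV. pull (dy m (spray f' m)) x y) =
      (\<Sum>a\<in>UNIV. \<Sum>b\<in>UNIV. (\<Sum>j\<in>UNIV. P b j x * Q j a x) * pull (dy b (spray f' a)) x y)"
    by (simp add: P_Q[OF xy] if_distrib[of "\<lambda>a. a * _"] cong: if_cong)
  also have "\<dots> = (\<Sum>a\<in>UNIV. \<Sum>j\<in>UNIV. Q j a x * (\<Sum>b\<in>UNIV. P b j x * pull (dy b (spray f' a)) x y))"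
    unfolding sum_distrib_left sum_distrib_right
    by (rule sum.cong[OF refl], subst sum.swap) (simp add: mult_ac)
  also have "\<dots> = (\<Sum>a\<in>UNIV. \<Sum>j\<in>UNIV. Q j a x * (\<Sum>i\<in>UNIV. P a i x * dy j (spray f i) x y))
      - (\<Sum>a\<in>UNIV. \<Sum>j\<in>UNIV. Q j a x * K a j x y)"
    unfolding dy_spray_pull[OF xy] right_diff_distrib sum_subtractf ..
  also have "(\<Sum>a\<in>UNIV. \<Sum>j\<in>UNIV. Q j a x * (\<Sum>i\<in>UNIV. P a i x * dy j (spray f i) x y)) =
      (\<Sum>j\<in>UNIV. \<Sum>i\<in>UNIV. (\<Sum>a\<in>UNIV. Q j a x * P a i x) * dy j (spray f i) x y)"
    unfolding sum_distrib_left sum_distrib_right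
    by (subst sum.swap, rule sum.cong[OF refl], subst sum.swap) (simp add: mult_ac)
  also have "\<dots> = (\<Sum>m\<in>UNIV. dy m (spray f m) x y)"
    by (simp add: Q_P[OF xy] if_distrib[of "\<lambda>a. a * _"] cong: if_cong)
  finally show ?thesis .
qed

text \<open>The trace-adjusted spray coefficients transform linearly up to a quadratic form in \<open>y\<close>, which
  third derivatives annihilate.\<close>

lemma tensorial_douglas: "tensorial (douglas (spray f)) (douglas (spray f'))"
  unfolding tensorial_def
proof (intro allI impI)
  fix x y i j k l assume xy: "(x, y) \<in> S"
  let ?n = "real CARD('n)"
  define p where "p i x y = spray f i x y - 1 / (?n + 1) * (\<Sum>m\<in>UNIV. dy m (spray f m) x y) * y $ i" for i x y
  define p' where "p' i x y = spray f' i x y - 1 / (?n + 1) * (\<Sum>m\<in>UNIV. dy m (spray f' m) x y) * y $ i" for i x y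
  \<comment> \<open>\<open>w\<close> holds the coefficients of the trace correction as a linear form
    in \<open>y\<close>. \<open>c\<close> holds those of the quadratic form that joins its product
    with \<psi>^i/(n + 1) and the term -\<open>KK\<close>/2 of the spray law.\<close>
  define w where "w u x = (\<Sum>a\<in>UNIV. \<Sum>j\<in>UNIV. Q j a x * H a j u x)" for u x
  define c where "c u v x = 1 / (?n + 1) * w u x * P i v x - 1/2 * H i v u x" for u v x
  have p: "csmooth S (p i)" for i
    unfolding p_def[abs_def] by (intro csmooth_intros csmooth_spray)
  have p': "csmooth S' (p' i)" for i
    unfolding p'_def[abs_def] by (intro T.csmooth_intros F'.csmooth_spray)
  have c: "csmooth S (\<lambda>x y. c u v x)" for u v
    unfolding c_def[abs_def] w_def by (intro csmooth_intros csmooth_Q csmooth_H csmooth_P)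
  have q: "csmooth S (\<lambda>x y. \<Sum>u\<in>UNIV. \<Sum>v\<in>UNIV. c u v x * y $ u * y $ v)"
    by (intro csmooth_intros c)
  have pp: "pull (p' i) x y = (\<Sum>r\<in>UNIV. P i r x * p r x y) + (\<Sum>u\<in>UNIV. \<Sum>v\<in>UNIV. c u v x * y $ u * y $ v)"
    if xy: "(x, y) \<in> S" for x y
  proof -
    define t where "t = 1 / (?n + 1) * (\<Sum>m\<in>UNIV. dy m (spray f m) x y)"
    define th where "th = (\<Sum>a\<in>UNIV. \<Sum>j\<in>UNIV. Q j a x * K a j x y)"
    have th: "th = (\<Sum>u\<in>UNIV. w u x * y $ u)"
    proof -
      have "th = (\<Sum>a\<in>UNIV. \<Sum>j\<in>UNIV. \<Sum>u\<in>UNIV. Q j a x * H a j u x * y $ u)"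
        by (simp add: th_def K_def sum_distrib_left mult_ac)
      also have "\<dots> = (\<Sum>a\<in>UNIV. \<Sum>u\<in>UNIV. \<Sum>j\<in>UNIV. Q j a x * H a j u x * y $ u)"
        by (rule sum.cong[OF refl], rule sum.swap)
      also have "\<dots> = (\<Sum>u\<in>UNIV. \<Sum>a\<in>UNIV. \<Sum>j\<in>UNIV. Q j a x * H a j u x * y $ u)"
        by (rule sum.swap)
      finally show ?thesis by (simp add: w_def sum_distrib_right)
    qed
    have "(\<Sum>u\<in>UNIV. \<Sum>v\<in>UNIV. c u v x * y $ u * y $ v) =
        1 / (?n + 1) * (\<Sum>u\<in>UNIV. w u x * y $ u) * (\<Sum>v\<in>UNIV. P i v x * y $ v)
        - 1/2 * (\<Sum>u\<in>UNIV. \<Sum>v\<in>UNIV. H i v u x * y $ u * y $ v)"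
      unfolding c_def left_diff_distrib sum_subtractf
      by (simp add: sum_product sum_divide_distrib sum_distrib_left mult_ac)
    also have "(\<Sum>u\<in>UNIV. \<Sum>v\<in>UNIV. H i v u x * y $ u * y $ v) = KK i x y"
      unfolding KK_def K_def sum_distrib_right by (rule sum.swap)
    finally have cc: "(\<Sum>u\<in>UNIV. \<Sum>v\<in>UNIV. c u v x * y $ u * y $ v) =
        1 / (?n + 1) * th * \<psi> x y $ i - 1/2 * KK i x y"
      by (simp only: th \<psi>[OF xy])
    have "pull (p' i) x y = pull (spray f' i) x y
        - 1 / (?n + 1) * (\<Sum>m\<in>UNIV. pull (dy m (spray f' m)) x y) * \<psi> x y $ i"
      by (simp only: pull_def p'_def)
    also have "\<dots> = (\<Sum>r\<in>UNIV. P i r x * spray f r x y) - KK i x y / 2 - (t - 1 / (?n + 1) * th) * \<psi> x y $ i"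
      unfolding spray_pull[OF xy] trace_spray_pull[OF xy] t_def th_def right_diff_distrib ..
    also have "\<dots> = (\<Sum>r\<in>UNIV. P i r x * spray f r x y) - t * \<psi> x y $ i
        + (\<Sum>u\<in>UNIV. \<Sum>v\<in>UNIV. c u v x * y $ u * y $ v)"
      unfolding cc by (simp add: left_diff_distrib)
    also have "(\<Sum>r\<in>UNIV. P i r x * spray f r x y) - t * \<psi> x y $ i = (\<Sum>r\<in>UNIV. P i r x * p r x y)"
    proof -
      have "p r x y = spray f r x y - t * y $ r" for r by (simp only: p_def t_def)
      then show ?thesis
        by (simp add: \<psi>[OF xy] right_diff_distrib sum_subtractf sum_distrib_left mult_ac)
    qed
    finally show ?thesis .
  qed
  have lin: "dy l (\<lambda>x y. (\<Sum>r\<in>UNIV. P i r x * h r x y) + w x y) x y =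
      (\<Sum>r\<in>UNIV. P i r x * dy l (h r) x y) + dy l w x y"
    if "(x, y) \<in> S" "\<And>r. csmooth S (h r)" "csmooth S w" for l h w x y
    using that by (simp add: d_simps csmooth_P)
  let ?q = "\<lambda>x y. \<Sum>u\<in>UNIV. \<Sum>v\<in>UNIV. c u v x * y $ u * y $ v"
  have 1: "dy l (pull (p' i)) x y = (\<Sum>r\<in>UNIV. P i r x * dy l (p r) x y) + dy l ?q x y" if "(x, y) \<in> S" for x y
    by (subst dy_cong[OF that pp]) (assumption, rule lin[OF that p q])
  have 2: "dy k (dy l (pull (p' i))) x y = (\<Sum>r\<in>UNIV. P i r x * dy k (dy l (p r)) x y) + dy k (dy l ?q) x y"
    if "(x, y) \<in> S" for x y
    by (subst dy_cong[OF that 1]) (assumption, rule lin[OF that csmooth_dy[OF p] csmooth_dy[OF q]])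
  have "dy j (dy k (dy l (pull (p' i)))) x y =
      (\<Sum>r\<in>UNIV. P i r x * dy j (dy k (dy l (p r))) x y) + dy j (dy k (dy l ?q)) x y"
    by (subst dy_cong[OF xy 2]) (assumption, rule lin[OF xy csmooth_dy[OF csmooth_dy[OF p]] csmooth_dy[OF csmooth_dy[OF q]]])
  also have "dy j (dy k (dy l ?q)) x y = 0"
    by (rule dy_dy_dy_quadratic[OF c xy])
  finally have "(\<Sum>r\<in>UNIV. P i r x * dy j (dy k (dy l (p r))) x y) =
      (\<Sum>a\<in>UNIV. \<Sum>b\<in>UNIV. \<Sum>d\<in>UNIV. P a j x * P b k x * P d l x * pull (dy a (dy b (dy d (p' i)))) x y)"
    by (simp add: dy_dy_dy_pull[OF p' xy])
  then show "(\<Sum>r\<in>UNIV. P i r x * douglas (spray f) j r k l x y) =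
      (\<Sum>a\<in>UNIV. \<Sum>b\<in>UNIV. \<Sum>d\<in>UNIV. P a j x * P b k x * P d l x * pull (douglas (spray f') a i b d) x y)"
    unfolding douglas_def p_def[abs_def] p'_def[abs_def] .
qed

end

section \<open>Finsler manifolds\<close>

lemma finsler_coords_subset:
  assumes "finsler_coords S f" "open S'" "S' \<subseteq> S"
  shows "finsler_coords S' f"
proof -
  interpret finsler_coords S f by fact
  interpret T: coords S' by unfold_locales fact
  show ?thesis
  proof
    show "csmooth S' f" using f assms(2,3) by (rule csmooth_subset)
    show "T.euler 1 f" using euler_f assms(3) by (auto simp: euler_def T.euler_def)
    show "0 < v \<bullet> (fund_tensor f x y *v v)" if "(x, y) \<in> S'" "v \<noteq> 0" for x y v
      using posdef that assms(3) by auto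
  qed
qed

locale manifold =
  fixes X :: "'m topology" and A :: "('m, 'n::finite) chart set"
  assumes M: "smooth_manifold X A"
begin

lemma open_cimage: "c \<in> A \<Longrightarrow> open (cimage c)"
  using M by (simp add: smooth_manifold_def)

lemma open_slit: "c \<in> A \<Longrightarrow> open (slit c)"
  by (intro open_Times open_cimage open_Compl closed_singleton)

lemma smooth_transition: "c \<in> A \<Longrightarrow> c' \<in> A \<Longrightarrow> smooth_on (overlap c c') (transition c c')"
  using M by (simp add: smooth_manifold_def)

lemma open_overlap: "c \<in> A \<Longrightarrow> c' \<in> A \<Longrightarrow> open (overlap c c')"
  using smooth_transition by (auto simp: smooth_on_def)

lemma cinv_snd: 
  assumes "c \<in> A" "p \<in> fst c"
  shows "cinv c (snd c p) = p"
proof -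
  have "openin X (fst c)" "homeomorphic_map (subtopology X (fst c)) (top_of_set (cimage c)) (snd c)"
    using M assms by (auto simp: smooth_manifold_def)
  then have "inj_on (snd c) (fst c)"
    by (metis homeomorphic_map_def openin_subset topspace_subtopology_subset)
  then show ?thesis using assms by (simp add: cinv_def)
qed

lemma overlap_cases:
  assumes "c \<in> A" "x \<in> overlap c c'"
  shows "cinv c x \<in> fst c" "cinv c x \<in> fst c'" "snd c (cinv c x) = x" "x \<in> cimage c"
proof -
  obtain p where "x = snd c p" "p \<in> fst c" "p \<in> fst c'" using assms(2) by (auto simp: overlap_def)
  then show "cinv c x \<in> fst c" "cinv c x \<in> fst c'" "snd c (cinv c x) = x" "x \<in> cimage c"
    using cinv_snd[OF assms(1)] by (simp_all add: cimage_def)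
qed

lemma overlapI: "x \<in> cimage c \<Longrightarrow> cinv c x \<in> fst c' \<Longrightarrow> x \<in> overlap c c'"
  unfolding overlap_def cimage_def cinv_def
  by (rule image_eqI[of _ _ "inv_into (fst c) (snd c) x"]) (auto simp: f_inv_into_f inv_into_into)

lemma transition_in_cimage:
  assumes "c \<in> A" "x \<in> overlap c c'"
  shows "transition c c' x \<in> cimage c'"
  using overlap_cases[OF assms] by (simp add: transition_def cimage_def)

lemma has_derivative_transition:
  assumes "c \<in> A" "c' \<in> A" "x \<in> overlap c c'"
  shows "(transition c c' has_derivative dtransition c c' x) (at x)"
proof -
  have "Ck_on (Suc 0) (overlap c c') (transition c c')"
    using smooth_transition[OF assms(1,2)] unfolding smooth_on_def by blast
  from Ck_on_Suc_has_derivative[OF this assms(3)] show ?thesis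
    unfolding dtransition_def .
qed

lemma linear_dtransition:
  "c \<in> A \<Longrightarrow> c' \<in> A \<Longrightarrow> x \<in> overlap c c' \<Longrightarrow> linear (dtransition c c' x)"
  using has_derivative_transition has_derivative_linear by blast

lemma tpoint_in_tangent_bundle: "c \<in> A \<Longrightarrow> x \<in> cimage c \<Longrightarrow> tpoint A c x y \<in> tangent_bundle A"
  unfolding tangent_bundle_eq_tpoint[OF M] by blast

text \<open>The chain rule is read off from the compatibility condition in
  \<open>tangent_bundle\<close>, which every \<open>tpoint\<close> is already known to
  satisfy.\<close>

lemma dtransition_chain:
  assumes c: "c \<in> A" "c' \<in> A" "c'' \<in> A" and x: "x \<in> overlap c c'" "cinv c x \<in> fst c''"
  shows "dtransition c c'' x y = dtransition c' c'' (transition c c' x) (dtransition c c' x y)"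
proof -
  define v where "v d = (if d \<in> A \<and> cinv c x \<in> fst d then dtransition c d x y else 0)" for d
  have "(cinv c x, v) \<in> tangent_bundle A"
    using tpoint_in_tangent_bundle[OF c(1) overlap_cases(4)[OF c(1) x(1)], of y]
    unfolding tpoint_def v_def[abs_def] .
  then have "v c'' = dtransition c' c'' (snd c' (cinv c x)) (v c')"
    using c x(2) overlap_cases[OF c(1) x(1)] unfolding tangent_bundle_def by blast
  then show ?thesis
    using c x(2) overlap_cases[OF c(1) x(1)] by (simp add: v_def transition_def)
qed

lemma tpoint_transition:
  assumes c: "c \<in> A" "c' \<in> A" and x: "x \<in> overlap c c'"
  shows "tpoint A c' (transition c c' x) (dtransition c c' x y) = tpoint A c x y"
proof -
  have p: "cinv c' (transition c c' x) = cinv c x"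
    using overlap_cases[OF c(1) x] by (simp add: transition_def cinv_snd c)
  show ?thesis
    unfolding tpoint_def p using dtransition_chain[OF c _ x, of _ y]
    by (intro arg_cong[of _ _ "Pair (cinv c x)"] ext) auto
qed

lemma local_rep_transition:
  assumes "c \<in> A" "c' \<in> A" "x \<in> overlap c c'"
  shows "local_rep A h c' (transition c c' x) (dtransition c c' x y) = local_rep A h c x y"
  unfolding local_rep_def tpoint_transition[OF assms] ..

lemma dtransition_self:
  assumes "c \<in> A" "x \<in> cimage c"
  shows "dtransition c c x y = y"
proof -
  have "transition c c z = z" if "z \<in> cimage c" for z
    using that by (auto simp: cimage_def transition_def cinv_snd assms(1))
  then have "(transition c c has_derivative (\<lambda>y. y)) (at x)"
    using has_derivative_transform_within_open[OF has_derivative_ident open_cimage[OF assms(1)] assms(2)]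
    by metis
  from frechet_derivative_at[OF this] show ?thesis
    unfolding dtransition_def by metis
qed

text \<open>The reverse transition recovers \<open>y\<close> by the chain rule. Chart changes
  therefore preserve the condition that the direction is nonzero.\<close>

lemma dtransition_eq_0_iff:
  assumes c: "c \<in> A" "c' \<in> A" and x: "x \<in> overlap c c'"
  shows "dtransition c c' x y = 0 \<longleftrightarrow> y = 0"
proof
  assume z: "dtransition c c' x y = 0"
  have "cinv c x \<in> fst c" "cinv c x \<in> fst c'" using overlap_cases[OF c(1) x] by auto
  then have tx: "transition c c' x \<in> overlap c' c"
    by (simp add: transition_def overlap_def)
  have "y = dtransition c c x y"
    using dtransition_self[OF c(1) overlap_cases(4)[OF c(1) x]] by simp
  also have "\<dots> = dtransition c' c (transition c c' x) 0"
    using dtransition_chain[OF c c(1) x \<open>cinv c x \<in> fst c\<close>, of y] z by simp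
  also have "\<dots> = 0" using linear_0[OF linear_dtransition[OF c(2,1) tx]] .
  finally show "y = 0" .
next
  assume "y = 0"
  then show "dtransition c c' x y = 0" using linear_0[OF linear_dtransition[OF assms]] by simp
qed

lemma tpoint_scaleR:
  assumes "c \<in> A" "x \<in> cimage c"
  shows "tpoint A c x (t *\<^sub>R y) = tscale t (tpoint A c x y)"
  unfolding tpoint_def tscale_def
  using linear_scale[OF linear_dtransition[OF assms(1) _ overlapI[OF assms(2)]]] by auto

lemma jacobian_matrix: "(\<chi> a j. jacobian c c' x a j) = matrix (dtransition c c' x)"
  by (simp add: jacobian_def matrix_def)

lemma dtransition_component:
  assumes "c \<in> A" "c' \<in> A" "x \<in> overlap c c'"
  shows "dtransition c c' x y $ a = (\<Sum>j\<in>UNIV. jacobian c c' x a j * y $ j)"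
proof -
  have "dtransition c c' x y = (\<chi> a j. jacobian c c' x a j) *v y"
    unfolding jacobian_matrix using matrix_works[of "dtransition c c' x"] linear_dtransition[OF assms]
    by (simp add: linear_matrix_vector_mul_eq)
  then show ?thesis by (simp add: matrix_vector_mult_def)
qed

lemma transform_transition:
  assumes c: "c \<in> A" "c' \<in> A"
  shows "transform (overlap c c' \<times> (- {0})) (slit c') (transition c c')
    (\<lambda>a j x. jacobian c c' x a j) (dtransition c c')"
proof
  let ?S = "overlap c c' \<times> (- {0 :: real^'n})"
  show S: "open ?S" by (intro open_Times open_overlap c open_Compl closed_singleton)
  show "open (slit c')" by (rule open_slit[OF c(2)])
  show "csmooth ?S (\<lambda>x y. transition c c' x $ a)" for a
  proof -
    have "Ck_on k ?S (\<lambda>z. transition c c' (fst z) $ a)" for k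
    proof (rule Ck_on_compose[where f = "\<lambda>x. transition c c' x $ a" and g = fst, OF S])
      show "Ck_on k (overlap c c') (\<lambda>x. transition c c' x $ a)"
      proof (rule Ck_on_linear_compose[OF open_overlap[OF c] bounded_linear_vec_nth])
        show "Ck_on k (overlap c c') (transition c c')"
          using smooth_transition[OF c] unfolding smooth_on_def by blast
      qed
      show "Ck_on k ?S (\<lambda>z. fst z \<bullet> b)" for b
        by (intro Ck_on_linear S bounded_linear_compose[OF bounded_linear_inner_left] bounded_linear_fst)
    qed auto
    then show ?thesis using S by (simp add: csmooth_def smooth_on_def case_prod_unfold)
  qed
  fix x y assume "(x, y) \<in> ?S"
  then have x: "x \<in> overlap c c'" and y: "y \<noteq> 0" by auto
  show "dx j (\<lambda>x y. transition c c' x $ a) x y = jacobian c c' x a j" for j a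
  proof -
    have "((\<lambda>x. transition c c' x $ a) has_derivative (\<lambda>h. dtransition c c' x h $ a)) (at x)"
      by (rule bounded_linear.has_derivative[OF bounded_linear_vec_nth has_derivative_transition[OF c x]])
    from frechet_derivative_at[OF this, symmetric] show ?thesis
      by (simp add: dx_def jacobian_def)
  qed
  show "dtransition c c' x y $ a = (\<Sum>j\<in>UNIV. jacobian c c' x a j * y $ j)" for a
    by (rule dtransition_component[OF c x])
  show "invertible (\<chi> a j. jacobian c c' x a j)"
    unfolding invertible_left_inverse matrix_left_invertible_ker
  proof (intro allI impI)
    fix v assume "(\<chi> a j. jacobian c c' x a j) *v v = 0"
    then have "dtransition c c' x v = 0"
      by (simp add: vec_eq_iff dtransition_component[OF c x] matrix_vector_mult_def)
    then show "v = 0" by (simp add: dtransition_eq_0_iff[OF c x])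
  qed
  show "(transition c c' x, dtransition c c' x y) \<in> slit c'"
    using transition_in_cimage[OF c(1) x] y by (simp add: dtransition_eq_0_iff[OF c x])
qed

end

section \<open>Finsler metrics in charts and on chart overlaps\<close>

locale finsler_manifold = manifold X A for X :: "'m topology" and A :: "('m, 'n::finite) chart set" +
  fixes F :: "('m, 'n) tvec \<Rightarrow> real"
  assumes F: "finsler_metric A F"
begin

lemma local_rep_scaleR:
  assumes "c \<in> A" "x \<in> cimage c" "t > 0"
  shows "local_rep A F c x (t *\<^sub>R y) = t * local_rep A F c x y"
  using F tpoint_in_tangent_bundle[OF assms(1,2), of y] assms
  by (simp add: local_rep_def tpoint_scaleR finsler_metric_def)

text \<open>Euler's relation comes from differentiating f(x, ty) at t = 1 in two ways, by the chain
  rule and by positive homogeneity.\<close>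

lemma finsler_coords_slit:
  assumes c: "c \<in> A"
  shows "finsler_coords (slit c) (local_rep A F c)"
proof -
  interpret coords "slit c" by unfold_locales (rule open_slit[OF c])
  have smooth: "csmooth (slit c) (local_rep A F c)"
    using F c by (simp add: finsler_metric_def smooth_scalar_def csmooth_def)
  show ?thesis
  proof
    show "csmooth (slit c) (local_rep A F c)" by fact
    show "0 < v \<bullet> (fund_tensor (local_rep A F c) x y *v v)" if "(x, y) \<in> slit c" "v \<noteq> 0" for x y v
      using F c that by (simp add: finsler_metric_def)
    show "euler 1 (local_rep A F c)"
      unfolding euler_def
    proof (intro allI impI)
      fix x y assume xy: "(x, y) \<in> slit c"
      let ?f = "local_rep A F c x" and ?D = "frechet_derivative (local_rep A F c x) (at y)"
      have D: "(?f has_derivative ?D) (at y)" using csmooth_slice(2)[OF smooth xy] by simp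
      have "((\<lambda>t. ?f (t *\<^sub>R y)) has_derivative (\<lambda>t. ?D (t *\<^sub>R y))) (at 1)"
        by (rule has_derivative_compose[of "\<lambda>t. t *\<^sub>R y" "\<lambda>t. t *\<^sub>R y" 1 UNIV])
          (use D in \<open>auto intro!: derivative_eq_intros\<close>)
      \<comment> \<open>Homogeneity is available for positive t, which is an open neighbourhood of
        1.\<close>
      moreover have "((\<lambda>t. ?f (t *\<^sub>R y)) has_derivative (\<lambda>t. t * ?f y)) (at 1)"
        by (rule has_derivative_transform_within_open[of "\<lambda>t. t * ?f y" _ _ _ "{0<..}"])
          (use xy in \<open>auto intro!: derivative_eq_intros simp: local_rep_scaleR[OF c]\<close>)
      ultimately have "(\<lambda>t. ?D (t *\<^sub>R y)) = (\<lambda>t. t * ?f y)" by (rule has_derivative_unique)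
      from fun_cong[OF this, of 1] have "?D y = ?f y" by simp
      moreover have "?D y = (\<Sum>m\<in>UNIV. y $ m * ?D (axis m 1))"
      proof -
        interpret linear ?D using has_derivative_linear[OF D] .
        have "?D y = ?D (\<Sum>m\<in>UNIV. y $ m *\<^sub>R axis m 1)"
          by (simp add: basis_expansion scalar_mult_eq_scaleR[symmetric])
        then show ?thesis by (simp add: sum scale)
      qed
      ultimately show "(\<Sum>m\<in>UNIV. y $ m * dy m (local_rep A F c) x y) = 1 * local_rep A F c x y"
        by (simp add: dy_def)
    qed
  qed
qed

lemma transform_finsler_transition:
  assumes c: "c \<in> A" "c' \<in> A"
  shows "transform_finsler (overlap c c' \<times> (- {0})) (slit c') (transition c c')
    (\<lambda>a j x. jacobian c c' x a j) (dtransition c c') (local_rep A F c) (local_rep A F c')"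
proof -
  let ?S = "overlap c c' \<times> (- {0 :: real^'n})"
  interpret transform ?S "slit c'" "transition c c'" "\<lambda>a j x. jacobian c c' x a j" "dtransition c c'"
    by (rule transform_transition[OF c])
  interpret C: finsler_coords ?S "local_rep A F c"
    by (rule finsler_coords_subset[OF finsler_coords_slit[OF c(1)] open_S]) (auto dest: overlap_cases[OF c(1)])
  interpret C': finsler_coords "slit c'" "local_rep A F c'"
    by (rule finsler_coords_slit[OF c(2)])
  show ?thesis
    by unfold_locales (auto simp: local_rep_transition[OF c])
qed

end

section \<open>Assembling the global tensor field\<close>

theorem theorem4p13:
  fixes X :: "'m topology"
    and A :: "('m, 'n::finite) chart set"
    and F :: "('m, 'n) tvec \<Rightarrow> real"
  assumes "CARD('n) \<ge> 2"
    and "smooth_manifold X A"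
    and "finsler_metric A F"
    and "generalized_weakly_Weyl A F"
  shows "W_GDW A F"
proof -
  note dim = assms(1)
  interpret finsler_manifold X A F by unfold_locales fact+
  from assms(4) obtain lam \<mu> where lam: "smooth_scalar A lam" and \<mu>: "tensor_field1 A \<mu>"
    and "\<forall>c\<in>A. \<forall>x\<in>cimage c. \<forall>y. y \<noteq> 0 \<longrightarrow> (\<forall>j i k l.
      hcov3_0 (spray (local_rep A F c)) (weyl_tilde (spray (local_rep A F c))) j i k l x y
        + local_rep A lam c x y * local_rep A F c x y * weyl_tilde (spray (local_rep A F c)) j i k l x y
      = (\<Sum>r\<in>UNIV. \<mu> c r x y * weyl_tilde (spray (local_rep A F c)) j r k l x y) * y $ i)"
    unfolding generalized_weakly_Weyl_def Let_def by (elim exE conjE)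
  then have weyl: "c \<in> A \<Longrightarrow> x \<in> cimage c \<Longrightarrow> y \<noteq> 0 \<Longrightarrow>
      hcov3_0 (spray (local_rep A F c)) (weyl_tilde (spray (local_rep A F c))) j i k l x y
        + local_rep A lam c x y * local_rep A F c x y * weyl_tilde (spray (local_rep A F c)) j i k l x y
      = (\<Sum>r\<in>UNIV. \<mu> c r x y * weyl_tilde (spray (local_rep A F c)) j r k l x y) * y $ i"
    for c x y j i k l
    by simp
  define G where "G c = spray (local_rep A F c)" for c
  define q where "q c = spray_coords.weyl_douglas_diff (G c)" for c
  \<comment> \<open>Obtained by inserting \<open>weyl_tilde_eq\<close> into the hypothesis: each of
    the two terms on its left contributes one multiple of \<open>y^i\<close>, and both multiples are
    moved to the right.\<close>
  define U where "U c j k l x y = (\<Sum>r\<in>UNIV. \<mu> c r x y * weyl_tilde (G c) j r k l x y)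
      - spray_coords.cov3 (G c) (q c) j k l x y
      - local_rep A lam c x y * local_rep A F c x y * q c j k l x y" for c j k l x y
  \<comment> \<open>The left-hand side of the W-GDW equation. Its covariance follows from that of
    the Douglas tensor and of the scalars \<open>lam\<close> and \<open>F\<close>.\<close>
  define E where "E c j i k l x y = hcov3_0 (G c) (douglas_tilde (G c)) j i k l x y
      + local_rep A lam c x y * local_rep A F c x y * douglas_tilde (G c) j i k l x y" for c j i k l x y
  have EU: "E c j i k l x y = U c j k l x y * y $ i" if c: "c \<in> A" and x: "x \<in> cimage c" and y: "y \<noteq> 0" for c j i k l x y
  proof -
    interpret finsler_coords "slit c" "local_rep A F c" by (rule finsler_coords_slit[OF c])
    have xy: "(x, y) \<in> slit c" using x y by simp
    show ?thesis
      using weyl[OF c x y, of j i k l]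
      unfolding hcov3_0_weyl_tilde[OF dim xy] weyl_tilde_eq[OF dim xy, of j i k l] E_def U_def q_def G_def
      by (simp add: algebra_simps)
  qed
  have "csmooth (slit c) (U c j k l)" if c: "c \<in> A" for c j k l
  proof -
    interpret finsler_coords "slit c" "local_rep A F c" by (rule finsler_coords_slit[OF c])
    have "csmooth (slit c) (local_rep A lam c)" "\<And>r. csmooth (slit c) (\<mu> c r)"
      using lam \<mu> c by (simp_all add: smooth_scalar_def tensor_field1_def csmooth_def)
    then show ?thesis
      unfolding U_def[abs_def] q_def G_def
      by (intro csmooth_intros f csmooth_weyl_tilde csmooth_cov3 csmooth_weyl_douglas_diff)
  qed
  moreover have "U c j k l x y = (\<Sum>a\<in>UNIV. \<Sum>b\<in>UNIV. \<Sum>d\<in>UNIV.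
      jacobian c c' x a j * jacobian c c' x b k * jacobian c c' x d l *
      U c' a b d (transition c c' x) (dtransition c c' x y))"
    if c: "c \<in> A" "c' \<in> A" and x: "x \<in> overlap c c'" and y: "y \<noteq> 0" for c c' x y j k l
  proof -
    let ?f = "local_rep A F c" and ?f' = "local_rep A F c'"
    interpret transform_finsler "overlap c c' \<times> (- {0})" "slit c'" "transition c c'"
        "\<lambda>a j x. jacobian c c' x a j" "dtransition c c'" ?f ?f'
      by (rule transform_finsler_transition[OF c])
    have xy: "(x, y) \<in> overlap c c' \<times> (- {0})" using x y by simp
    have t1: "tensorial (douglas_tilde (G c)) (douglas_tilde (G c'))"
      unfolding douglas_tilde_def G_def
      by (intro tensorial_hcov3_0 tensorial_douglas csmooth_douglas F'.csmooth_douglas)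
    have t2: "tensorial (hcov3_0 (G c) (douglas_tilde (G c))) (hcov3_0 (G c') (douglas_tilde (G c')))"
      using t1 unfolding G_def
      by (intro tensorial_hcov3_0 csmooth_douglas_tilde F'.csmooth_douglas_tilde)
    let ?v = "dtransition c c' x y" and ?J = "\<lambda>a b d. jacobian c c' x a j * jacobian c c' x b k * jacobian c c' x d l"
    have x': "x \<in> cimage c" "transition c c' x \<in> cimage c'" and v: "?v \<noteq> 0"
      using overlap_cases[OF c(1) x] transition_in_cimage[OF c(1) x] y by (auto simp: dtransition_eq_0_iff[OF c x])
    have EE: "(\<Sum>p\<in>UNIV. jacobian c c' x i p * E c j p k l x y) =
      (\<Sum>a\<in>UNIV. \<Sum>b\<in>UNIV. \<Sum>d\<in>UNIV. ?J a b d * E c' a i b d (transition c c' x) ?v)" for i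
    proof -
      let ?s = "local_rep A lam c x y * ?f x y"
      have s: "local_rep A lam c' (transition c c' x) ?v * ?f' (transition c c' x) ?v = ?s"
        by (simp add: local_rep_transition[OF c x])
      have "(\<Sum>p\<in>UNIV. jacobian c c' x i p * E c j p k l x y) =
        (\<Sum>p\<in>UNIV. jacobian c c' x i p * hcov3_0 (G c) (douglas_tilde (G c)) j p k l x y)
        + ?s * (\<Sum>p\<in>UNIV. jacobian c c' x i p * douglas_tilde (G c) j p k l x y)"
        unfolding E_def by (simp add: distrib_left sum.distrib sum_distrib_left mult_ac)
      also have "\<dots> = (\<Sum>a\<in>UNIV. \<Sum>b\<in>UNIV. \<Sum>d\<in>UNIV. ?J a b d * E c' a i b d (transition c c' x) ?v)"
        using t1 t2 xy unfolding tensorial_def E_def s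
        by (simp add: pull_def distrib_left sum.distrib sum_distrib_left mult_ac)
      finally show ?thesis .
    qed
    \<comment> \<open>The Jacobian carries \<open>y\<close> to the new direction, so the covariance
      of \<open>E\<close> becomes the desired law for \<open>U\<close> multiplied by a component of
      that direction.\<close>
    have e: "?v $ i * U c j k l x y = ?v $ i * (\<Sum>a\<in>UNIV. \<Sum>b\<in>UNIV. \<Sum>d\<in>UNIV.
        ?J a b d * U c' a b d (transition c c' x) ?v)" for i
    proof -
      have "?v $ i * U c j k l x y = (\<Sum>p\<in>UNIV. jacobian c c' x i p * E c j p k l x y)"
        unfolding EU[OF c(1) x'(1) y] dtransition_component[OF c x, of y i]
        by (simp add: sum_distrib_left mult_ac)
      also have "\<dots> = ?v $ i * (\<Sum>a\<in>UNIV. \<Sum>b\<in>UNIV. \<Sum>d\<in>UNIV. ?J a b d * U c' a b d (transition c c' x) ?v)"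
        unfolding EE EU[OF c(2) x'(2) v] by (simp add: sum_distrib_left mult_ac)
      finally show ?thesis .
    qed
    \<comment> \<open>A nonzero direction has a nonzero component, and \<open>U\<close> has no upper
      index, so a single such \<open>i\<close> suffices.\<close>
    obtain i where "?v $ i \<noteq> 0" using v by (auto simp: vec_eq_iff)
    from mult_left_cancel[OF this] e[of i] show ?thesis by (rule iffD1)
  qed
  ultimately have "tensor_field3 A U"
    unfolding tensor_field3_def csmooth_def by blast
  then show ?thesis
    unfolding W_GDW_def Let_def using lam EU unfolding E_def G_def by blast
qed

end
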